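(* Let $\mu,\nu$ be compactly supported probability measures on $\mathbb{R}$ and let $X_1,X_2\in\mathcal B(\mathcal H)$ be bounded self-adjoint random variables, free with respect to the vacuum state $\varphi$, realized on the free product Hilbert space $\mathcal H$ as in the context, with $\varphi$-distributions $\mu$ and $\nu$, respectively. For $j=1,2$, in the decomposition $X_1+X_2=X_j(1)+Z_j$ (which defines $Z_j$), the pair of random variables $(X_j(1),Z_j)$ is monotone independent with respect to $\varphi$. Therefore $$\mu\boxplus\nu=\mu\vartriangleright(\nu\boxplus_s\mu),\qquad \nu\boxplus\mu=\nu\vartriangleright(\mu\boxplus_s\nu)$$ are the corresponding decompositions of the free additive convolution for $j=1,2$, respectively.
   Context: Free product: for Hilbert spaces with unit vectors $(\mathcal H_1,\xi_1),(\mathcal H_2,\xi_2)$ put $\mathcal H_i^0=\mathcal H_i\ominus\mathbb{C}\xi_i$ and $\mathcal H=\mathbb{C}\xi\oplus\bigoplus_{n\ge1}\bigoplus_{i_1\ne\cdots\ne i_n}\mathcal H_{i_1}^0\otimes\cdots\otimes\mathcal H_{i_n}^0$ (indices in $\{1,2\}$, $\xi$ a unit vector); $\varphi(\cdot)=\langle\cdot\,\xi,\xi\rangle$. For $j\in\{1,2\}$ let $\bar j$ be the other index, $\mathcal H^{(0)}(j)=\mathbb{C}\xi$, and for $n\ge1$ let $\mathcal H^{(n)}(j)$ be the sum of those $\mathcal H_{i_1}^0\otimes\cdots\otimes\mathcal H_{i_n}^0$ with $i_1\ne\cdots\ne i_n$ and $i_1\ne j$; $\mathcal H(j)=\bigoplus_{n\ge1}\mathcal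 H^{(n)}(j)$. The representation $\lambda_j:\mathcal B(\mathcal H_j)\to\mathcal B(\mathcal H)$ is $\lambda_j(a)(h_1\otimes h)=(ah_1)^0\otimes h+\langle ah_1,\xi_j\rangle h$ for $h_1\in\mathcal H_j$, $h\in\mathbb{C}\xi\oplus\mathcal H(j)$, where $v^0$ is the projection of $v$ onto $\mathcal H_j^0$ and $\xi_j\otimes h\equiv h$, $h_1\otimes\xi\equiv h_1$. Let $x_j\in\mathcal B(\mathcal H_j)$ be self-adjoint, with distributions $\mu$ ($j=1$) and $\nu$ ($j=2$) in the vector states of $\xi_1,\xi_2$, and $X_j=\lambda_j(x_j)$; these are free w.r.t. $\varphi$. Let $P_j(n)$ be the orthogonal projection onto $\mathcal H^{(n-1)}(j)\oplus\mathcal H^{(n)}(\bar j)$ and $X_j(n)=P_j(n)X_jP_j(n)$, $n\ge1$. s-free convolution (written here $\boxplus_s$): $\mu\boxplus_s\nu$ is the $\varphi$-distribution of $\sum_{r\ge0}X_1(2r+1)+\sum_{r\ge1}X_2(2r)$ (strongly convergent series); it depends only on $\mu,\nu$, and $\nu\boxplus_s\mu$ is obtained by interchanging the roles of the two variables. Monotone independence: the pair $(a,b)$ is monotone independent w.r.t. $\varphi$ if for all $n\ge1$ and all $w,w_1,w_2$ in the unital algebra generated by $a,b$: $\varphi(w_1ab^naw_2)=\varphi(b^n)\varphi(w_1a^2w_2)$, $\varphi(wab^n)=\varphi(b^n)\varphi(wa)$ and $\varphi(b^naw)=\varphi(b^n)\varphi(aw)$. The monotone convolution $\mu\vartriangleright\nu$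 is the unique probability measure with $F_{\mu\vartriangleright\nu}(z)=F_\mu(F_\nu(z))$ on $\mathbb{C}^+$, where $F_\mu=1/G_\mu$, $G_\mu(z)=\int\frac{\mu(dx)}{z-x}$; it is the distribution of $a+b$ when $(a,b)$ is monotone independent with distributions $\mu,\nu$. $\boxplus$ is Voiculescu's free additive convolution. *)

theory Defs
  imports "HOL-Probability.Probability"
begin

section \<open>Complex Hilbert spaces\<close>

text \<open>The inner product is linear in its \<^emph>\<open>first\<close> argument.\<close>

class chilbert_space = banach +
  fixes scaleC :: "complex \<Rightarrow> 'a \<Rightarrow> 'a" (infixr \<open>*\<^sub>C\<close> 75)
    and cinner :: "'a \<Rightarrow> 'a \<Rightarrow> complex"
  assumes scaleC_add_right: "c *\<^sub>C (x + y) = c *\<^sub>C x + c *\<^sub>C y"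
    and scaleC_add_left: "(c + d) *\<^sub>C x = c *\<^sub>C x + d *\<^sub>C x"
    and scaleC_scaleC: "c *\<^sub>C (d *\<^sub>C x) = (c * d) *\<^sub>C x"
    and scaleC_one: "1 *\<^sub>C x = x"
    and scaleR_eq_scaleC: "r *\<^sub>R x = complex_of_real r *\<^sub>C x"
    and cinner_add_left: "cinner (x + y) z = cinner x z + cinner y z"
    and cinner_scaleC_left: "cinner (c *\<^sub>C x) y = c * cinner x y"
    and cinner_commute: "cinner y x = cnj (cinner x y)"
    and cinner_self: "cinner x x = complex_of_real ((norm x)\<^sup>2)"

global_interpretation complex_space: vector_space "scaleC :: complex \<Rightarrow> 'a \<Rightarrow> 'a::chilbert_space"
  defines cspan = complex_space.span
  by unfold_locales
    (simp_all add: scaleC_add_right scaleC_add_left scaleC_scaleC scaleC_one)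

definition bounded_clinear :: "('a::chilbert_space \<Rightarrow> 'b::chilbert_space) \<Rightarrow> bool" where
  "bounded_clinear A \<longleftrightarrow> bounded_linear A \<and> (\<forall>c x. A (c *\<^sub>C x) = c *\<^sub>C A x)"

definition selfadjoint :: "('a::chilbert_space \<Rightarrow> 'a) \<Rightarrow> bool" where
  "selfadjoint A \<longleftrightarrow> bounded_clinear A \<and> (\<forall>x y. cinner (A x) y = cinner x (A y))"

definition orth_proj :: "'a::chilbert_space set \<Rightarrow> 'a \<Rightarrow> 'a" where
  "orth_proj S x = (THE y. y \<in> S \<and> (\<forall>s\<in>S. cinner (x - y) s = 0))"


subsection \<open>The separable infinite-dimensional Hilbert space\<close>

typedef ell2 = "{f :: nat \<Rightarrow> complex. summable (\<lambda>n. (cmod (f n))\<^sup>2)}"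
  by (rule exI[of _ "\<lambda>_. 0"]) simp

setup_lifting type_definition_ell2

lemma ell2_summable: "summable (\<lambda>n. (cmod (Rep_ell2 f n))\<^sup>2)"
  using Rep_ell2 by blast

lemma square_summable_add:
  fixes f g :: "nat \<Rightarrow> complex"
  assumes "summable (\<lambda>n. (cmod (f n))\<^sup>2)" "summable (\<lambda>n. (cmod (g n))\<^sup>2)"
  shows "summable (\<lambda>n. (cmod (f n + g n))\<^sup>2)"
proof (rule summable_comparison_test')
  show "summable (\<lambda>n. 2 * (cmod (f n))\<^sup>2 + 2 * (cmod (g n))\<^sup>2)"
    using assms by (intro summable_add summable_mult)
  fix n
  have "(cmod (f n + g n))\<^sup>2 \<le> (cmod (f n) + cmod (g n))\<^sup>2"
    by (intro power_mono norm_triangle_ineq) simp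
  also have "\<dots> \<le> 2 * (cmod (f n))\<^sup>2 + 2 * (cmod (g n))\<^sup>2"
    using sum_squares_bound[of "cmod (f n)" "cmod (g n)"] by (simp add: power2_sum)
  finally show "norm ((cmod (f n + g n))\<^sup>2) \<le> 2 * (cmod (f n))\<^sup>2 + 2 * (cmod (g n))\<^sup>2" by simp
qed

lemma square_summable_scale:
  fixes f :: "nat \<Rightarrow> complex"
  assumes "summable (\<lambda>n. (cmod (f n))\<^sup>2)"
  shows "summable (\<lambda>n. (cmod (c * f n))\<^sup>2)"
  using summable_mult[OF assms, of "(cmod c)\<^sup>2"] by (simp add: norm_mult power_mult_distrib)

lemma square_summable_prod:
  fixes f g :: "nat \<Rightarrow> complex"
  assumes "summable (\<lambda>n. (cmod (f n))\<^sup>2)" "summable (\<lambda>n. (cmod (g n))\<^sup>2)"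
  shows "summable (\<lambda>n. f n * cnj (g n))"
proof (rule summable_comparison_test')
  show "summable (\<lambda>n. (cmod (f n))\<^sup>2 + (cmod (g n))\<^sup>2)"
    using assms by (intro summable_add)
  fix n
  have "0 \<le> cmod (f n) * cmod (g n)"
    by simp
  then show "norm (f n * cnj (g n)) \<le> (cmod (f n))\<^sup>2 + (cmod (g n))\<^sup>2"
    using sum_squares_bound[of "cmod (f n)" "cmod (g n)"]
    unfolding norm_mult complex_mod_cnj by linarith
qed

instantiation ell2 :: real_normed_vector
begin

lift_definition zero_ell2 :: ell2 is "\<lambda>_. 0" by simp
lift_definition plus_ell2 :: "ell2 \<Rightarrow> ell2 \<Rightarrow> ell2" is "\<lambda>f g n. f n + g n"
  by (rule square_summable_add)
lift_definition uminus_ell2 :: "ell2 \<Rightarrow> ell2" is "\<lambda>f n. - f n" by simp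
lift_definition minus_ell2 :: "ell2 \<Rightarrow> ell2 \<Rightarrow> ell2" is "\<lambda>f g n. f n - g n"
  subgoal for f g using square_summable_add[of f "\<lambda>n. - g n"] by simp
  done
lift_definition scaleR_ell2 :: "real \<Rightarrow> ell2 \<Rightarrow> ell2" is "\<lambda>r f n. of_real r * f n"
  by (rule square_summable_scale)
lift_definition norm_ell2 :: "ell2 \<Rightarrow> real" is "\<lambda>f. sqrt (\<Sum>n. (cmod (f n))\<^sup>2)" .
definition sgn_ell2 :: "ell2 \<Rightarrow> ell2" where "sgn_ell2 x = inverse (norm x) *\<^sub>R x"
definition dist_ell2 :: "ell2 \<Rightarrow> ell2 \<Rightarrow> real" where "dist_ell2 x y = norm (x - y)"
definition uniformity_ell2 :: "(ell2 \<times> ell2) filter" where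
  "uniformity_ell2 = (INF e\<in>{0<..}. principal {(x, y). dist x y < e})"
definition open_ell2 :: "ell2 set \<Rightarrow> bool" where
  "open_ell2 U \<longleftrightarrow> (\<forall>x\<in>U. eventually (\<lambda>(x', y). x' = x \<longrightarrow> y \<in> U) uniformity)"

instance
proof
  fix x y z :: ell2 and a b :: real and U :: "ell2 set"
  show "dist x y = norm (x - y)" by (rule dist_ell2_def)
  show "sgn x = inverse (norm x) *\<^sub>R x" by (rule sgn_ell2_def)
  show "(uniformity :: (ell2 \<times> ell2) filter) = (INF e\<in>{0<..}. principal {(x, y). dist x y < e})"
    by (rule uniformity_ell2_def)
  show "open U \<longleftrightarrow> (\<forall>x\<in>U. eventually (\<lambda>(x', y). x' = x \<longrightarrow> y \<in> U) uniformity)"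
    by (rule open_ell2_def)
  show "x + y + z = x + (y + z)" "x + y = y + x" "0 + x = x" "- x + x = 0" "x - y = x + - y"
    "a *\<^sub>R (x + y) = a *\<^sub>R x + a *\<^sub>R y" "(a + b) *\<^sub>R x = a *\<^sub>R x + b *\<^sub>R x"
    "a *\<^sub>R b *\<^sub>R x = (a * b) *\<^sub>R x" "1 *\<^sub>R x = x"
    by (transfer, simp add: algebra_simps)+
  show "norm x = 0 \<longleftrightarrow> x = 0"
    by transfer (simp add: suminf_eq_zero_iff fun_eq_iff)
  show "norm (a *\<^sub>R x) = \<bar>a\<bar> * norm x"
    by transfer (simp add: norm_mult power_mult_distrib suminf_mult real_sqrt_mult)
  show "norm (x + y) \<le> norm x + norm y"
  proof transfer
    fix f g :: "nat \<Rightarrow> complex"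
    assume f: "summable (\<lambda>n. (cmod (f n))\<^sup>2)" and g: "summable (\<lambda>n. (cmod (g n))\<^sup>2)"
    have lim: "(\<lambda>N. L2_set (\<lambda>n. cmod (h n)) {..<N}) \<longlonglongrightarrow> sqrt (\<Sum>n. (cmod (h n))\<^sup>2)"
      if "summable (\<lambda>n. (cmod (h n))\<^sup>2)" for h :: "nat \<Rightarrow> complex"
      unfolding L2_set_def by (intro tendsto_real_sqrt summable_LIMSEQ that)
    show "sqrt (\<Sum>n. (cmod (f n + g n))\<^sup>2) \<le> sqrt (\<Sum>n. (cmod (f n))\<^sup>2) + sqrt (\<Sum>n. (cmod (g n))\<^sup>2)"
    proof (rule LIMSEQ_le[OF lim[OF square_summable_add[OF f g]] tendsto_add[OF lim[OF f] lim[OF g]]])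
      have "L2_set (\<lambda>n. cmod (f n + g n)) {..<N}
          \<le> L2_set (\<lambda>n. cmod (f n)) {..<N} + L2_set (\<lambda>n. cmod (g n)) {..<N}" for N
        by (rule order_trans[OF L2_set_mono L2_set_triangle_ineq]) (auto intro: norm_triangle_ineq)
      then show "\<exists>N0. \<forall>N\<ge>N0. L2_set (\<lambda>n. cmod (f n + g n)) {..<N}
          \<le> L2_set (\<lambda>n. cmod (f n)) {..<N} + L2_set (\<lambda>n. cmod (g n)) {..<N}" by blast
    qed
  qed
qed

end

lemma ell2_sum_le: "(\<Sum>n<N. (cmod (Rep_ell2 x n))\<^sup>2) \<le> (norm x)\<^sup>2"
proof -
  have "(norm x)\<^sup>2 = (\<Sum>n. (cmod (Rep_ell2 x n))\<^sup>2)"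
    by (simp add: norm_ell2.rep_eq suminf_nonneg ell2_summable)
  then show ?thesis
    using sum_le_suminf[OF ell2_summable, of "{..<N}" x] by simp
qed

instance ell2 :: banach
proof
  fix X :: "nat \<Rightarrow> ell2"
  assume C: "Cauchy X"
  have coord: "cmod (Rep_ell2 x n) \<le> norm x" for x n
  proof -
    have "(cmod (Rep_ell2 x n))\<^sup>2 \<le> (\<Sum>k<Suc n. (cmod (Rep_ell2 x k))\<^sup>2)"
      by (simp add: sum_nonneg)
    also note ell2_sum_le
    finally show ?thesis by (rule power2_le_imp_le) simp
  qed
  have "Cauchy (\<lambda>m. Rep_ell2 (X m) n)" for n
  proof (rule metric_CauchyI)
    fix e :: real assume "0 < e"
    then obtain M where M: "\<forall>m\<ge>M. \<forall>k\<ge>M. dist (X m) (X k) < e"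
      using C unfolding Cauchy_def by blast
    have "dist (Rep_ell2 (X m) n) (Rep_ell2 (X k) n) \<le> dist (X m) (X k)" for m k
      using coord[of "X m - X k" n] by (simp add: dist_norm minus_ell2.rep_eq)
    then show "\<exists>M. \<forall>m\<ge>M. \<forall>k\<ge>M. dist (Rep_ell2 (X m) n) (Rep_ell2 (X k) n) < e"
      using M by (meson le_less_trans)
  qed
  then have "\<exists>l. (\<lambda>m. Rep_ell2 (X m) n) \<longlonglongrightarrow> l" for n
    using Cauchy_convergent convergent_def by blast
  then obtain f where f: "\<And>n. (\<lambda>m. Rep_ell2 (X m) n) \<longlonglongrightarrow> f n" by metis
  have bound: "(\<Sum>n<N. (cmod (Rep_ell2 (X m) n - f n))\<^sup>2) \<le> e\<^sup>2"
    if e: "\<forall>k\<ge>M. dist (X m) (X k) < e" for m M N and e :: real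
  proof (rule LIMSEQ_le_const2)
    show "(\<lambda>k. \<Sum>n<N. (cmod (Rep_ell2 (X m) n - Rep_ell2 (X k) n))\<^sup>2)
        \<longlonglongrightarrow> (\<Sum>n<N. (cmod (Rep_ell2 (X m) n - f n))\<^sup>2)"
      by (intro tendsto_intros f)
    have "(\<Sum>n<N. (cmod (Rep_ell2 (X m) n - Rep_ell2 (X k) n))\<^sup>2) \<le> e\<^sup>2" if "k \<ge> M" for k
    proof -
      have "(\<Sum>n<N. (cmod (Rep_ell2 (X m) n - Rep_ell2 (X k) n))\<^sup>2) \<le> (norm (X m - X k))\<^sup>2"
        using ell2_sum_le[of "X m - X k" N] by (simp add: minus_ell2.rep_eq)
      also have "\<dots> \<le> e\<^sup>2"
        using e that by (intro power_mono) (auto simp: dist_norm intro: less_imp_le)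
      finally show ?thesis .
    qed
    then show "\<exists>M. \<forall>k\<ge>M. (\<Sum>n<N. (cmod (Rep_ell2 (X m) n - Rep_ell2 (X k) n))\<^sup>2) \<le> e\<^sup>2"
      by blast
  qed
  have summ: "summable (\<lambda>n. (cmod (Rep_ell2 (X m) n - f n))\<^sup>2)"
    if "\<forall>k\<ge>M. dist (X m) (X k) < e" for m M and e :: real
    by (rule summableI_nonneg_bounded[where x = "e\<^sup>2"]) (use bound[OF that] in auto)
  obtain M0 where M0: "\<forall>m\<ge>M0. \<forall>k\<ge>M0. dist (X m) (X k) < 1"
    using C zero_less_one unfolding Cauchy_def by blast
  have "summable (\<lambda>n. (cmod (- 1 * (Rep_ell2 (X M0) n - f n)))\<^sup>2)"
    using summ[of M0 M0 1] M0 by (intro square_summable_scale) auto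
  from square_summable_add[OF this ell2_summable[of "X M0"]]
  have "summable (\<lambda>n. (cmod (f n))\<^sup>2)" by simp
  then obtain L where L: "Rep_ell2 L = f"
    using Abs_ell2_inverse[of f] by blast
  have "X \<longlonglongrightarrow> L"
  proof (rule metric_LIMSEQ_I)
    fix r :: real assume "0 < r"
    then obtain M where M: "\<forall>m\<ge>M. \<forall>k\<ge>M. dist (X m) (X k) < r / 2"
      using C half_gt_zero unfolding Cauchy_def by blast
    have "dist (X m) L < r" if "m \<ge> M" for m
    proof -
      have b: "\<forall>k\<ge>M. dist (X m) (X k) < r / 2" using M that by blast
      have "(\<Sum>n. (cmod (Rep_ell2 (X m) n - f n))\<^sup>2) \<le> (r / 2)\<^sup>2"
        by (rule suminf_le_const[OF summ[OF b] bound[OF b]])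
      then have "dist (X m) L \<le> sqrt ((r / 2)\<^sup>2)"
        by (simp add: dist_norm norm_ell2.rep_eq minus_ell2.rep_eq L del: real_sqrt_abs)
      then show ?thesis using \<open>0 < r\<close> by simp
    qed
    then show "\<exists>no. \<forall>n\<ge>no. dist (X n) L < r" by blast
  qed
  then show "convergent X" by (rule convergentI)
qed

instantiation ell2 :: chilbert_space
begin

lift_definition scaleC_ell2 :: "complex \<Rightarrow> ell2 \<Rightarrow> ell2" is "\<lambda>c f n. c * f n"
  by (rule square_summable_scale)
lift_definition cinner_ell2 :: "ell2 \<Rightarrow> ell2 \<Rightarrow> complex" is "\<lambda>f g. \<Sum>n. f n * cnj (g n)" .

instance
proof
  fix x y z :: ell2 and c d :: complex and r :: real
  show "c *\<^sub>C (x + y) = c *\<^sub>C x + c *\<^sub>C y" "(c + d) *\<^sub>C x = c *\<^sub>C x + d *\<^sub>C x"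
    "c *\<^sub>C d *\<^sub>C x = (c * d) *\<^sub>C x" "1 *\<^sub>C x = x" "r *\<^sub>R x = complex_of_real r *\<^sub>C x"
    by (transfer, simp add: algebra_simps)+
  show "cinner (x + y) z = cinner x z + cinner y z"
    by transfer (simp add: distrib_right suminf_add square_summable_prod)
  show "cinner (c *\<^sub>C x) y = c * cinner x y"
    by transfer (simp add: mult.assoc suminf_mult square_summable_prod)
  show "cinner y x = cnj (cinner x y)"
  proof transfer
    fix f g :: "nat \<Rightarrow> complex"
    assume "summable (\<lambda>n. (cmod (f n))\<^sup>2)" "summable (\<lambda>n. (cmod (g n))\<^sup>2)"
    then have "(\<lambda>n. cnj (f n * cnj (g n))) sums cnj (\<Sum>n. f n * cnj (g n))"
      unfolding sums_cnj by (intro summable_sums square_summable_prod)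
    then show "(\<Sum>n. g n * cnj (f n)) = cnj (\<Sum>n. f n * cnj (g n))"
      by (simp add: sums_iff mult.commute)
  qed
  show "cinner x x = complex_of_real ((norm x)\<^sup>2)"
    by transfer (simp add: suminf_nonneg suminf_of_real flip: complex_norm_square)
qed

end


section \<open>Distributions and independence in a vector state\<close>

definition vstate :: "'h::chilbert_space \<Rightarrow> ('h \<Rightarrow> 'h) \<Rightarrow> complex" where
  "vstate \<xi> A = cinner (A \<xi>) \<xi>"

definition compactly_supported_prob :: "real measure \<Rightarrow> bool" where
  "compactly_supported_prob \<mu> \<longleftrightarrow>
     prob_space \<mu> \<and> sets \<mu> = sets borel \<and> (\<exists>K. compact K \<and> (AE x in \<mu>. x \<in> K))"

definition has_distribution :: "'h::chilbert_space \<Rightarrow> ('h \<Rightarrow> 'h) \<Rightarrow> real measure \<Rightarrow> bool" where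
  "has_distribution \<xi> A \<mu> \<longleftrightarrow> compactly_supported_prob \<mu> \<and>
     (\<forall>n. complex_of_real (\<integral>x. x ^ n \<partial>\<mu>) = vstate \<xi> (A ^^ n))"

inductive_set unital_algebra :: "('h::chilbert_space \<Rightarrow> 'h) set \<Rightarrow> ('h \<Rightarrow> 'h) set"
  for G :: "('h \<Rightarrow> 'h) set" where
  unit: "id \<in> unital_algebra G"
| gen: "A \<in> G \<Longrightarrow> A \<in> unital_algebra G"
| add: "A \<in> unital_algebra G \<Longrightarrow> B \<in> unital_algebra G \<Longrightarrow> (\<lambda>h. A h + B h) \<in> unital_algebra G"
| scale: "A \<in> unital_algebra G \<Longrightarrow> (\<lambda>h. c *\<^sub>C A h) \<in> unital_algebra G"
| mult: "A \<in> unital_algebra G \<Longrightarrow> B \<in> unital_algebra G \<Longrightarrow> A \<circ> B \<in> unital_algebra G"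

text \<open>In \<open>cs\<close>, the Boolean tag of a factor says to which of the two algebras it belongs.\<close>

definition free_indep :: "'h::chilbert_space \<Rightarrow> ('h \<Rightarrow> 'h) \<Rightarrow> ('h \<Rightarrow> 'h) \<Rightarrow> bool" where
  "free_indep \<xi> A B \<longleftrightarrow>
     (\<forall>cs :: (bool \<times> ('h \<Rightarrow> 'h)) list.
        cs \<noteq> [] \<longrightarrow> successively (\<lambda>p q. fst p \<noteq> fst q) cs \<longrightarrow>
        (\<forall>(i, C) \<in> set cs. C \<in> unital_algebra {if i then A else B} \<and> vstate \<xi> C = 0) \<longrightarrow>
        vstate \<xi> (foldr (\<circ>) (map snd cs) id) = 0)"

definition monotone_indep :: "'h::chilbert_space \<Rightarrow> ('h \<Rightarrow> 'h) \<Rightarrow> ('h \<Rightarrow> 'h) \<Rightarrow> bool" where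
  "monotone_indep \<xi> a b \<longleftrightarrow>
     (\<forall>n\<ge>1. \<forall>w \<in> unital_algebra {a, b}. \<forall>w1 \<in> unital_algebra {a, b}. \<forall>w2 \<in> unital_algebra {a, b}.
        vstate \<xi> (w1 \<circ> a \<circ> (b ^^ n) \<circ> a \<circ> w2) = vstate \<xi> (b ^^ n) * vstate \<xi> (w1 \<circ> (a ^^ 2) \<circ> w2) \<and>
        vstate \<xi> (w \<circ> a \<circ> (b ^^ n)) = vstate \<xi> (b ^^ n) * vstate \<xi> (w \<circ> a) \<and>
        vstate \<xi> ((b ^^ n) \<circ> a \<circ> w) = vstate \<xi> (b ^^ n) * vstate \<xi> (a \<circ> w))"


section \<open>The free product of Hilbert spaces\<close>

text \<open>
  A letter \<open>Inl h\<close> is a vector of the first space, \<open>Inr h\<close> one of the second. Reduced words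
  are alternating words whose letters are orthogonal to the distinguished unit vectors; they stand
  for elementary tensors.
\<close>

fun letter_index :: "'a + 'b \<Rightarrow> nat" where
  "letter_index (Inl _) = 1"
| "letter_index (Inr _) = 2"

abbreviation other_index :: "nat \<Rightarrow> nat" where
  "other_index j \<equiv> 3 - j"

definition reduced_words ::
    "'a::chilbert_space \<Rightarrow> 'b::chilbert_space \<Rightarrow> ('a + 'b) list set" where
  "reduced_words \<xi>1 \<xi>2 = {w. successively (\<lambda>u v. letter_index u \<noteq> letter_index v) w \<and>
     (\<forall>u \<in> set w. case u of Inl h \<Rightarrow> cinner h \<xi>1 = 0 | Inr h \<Rightarrow> cinner h \<xi>2 = 0)}"

text \<open>Inner product of elementary tensors; different summands of the direct sum are orthogonal.\<close>

fun word_cinner :: "('a::chilbert_space + 'b::chilbert_space) list \<Rightarrow> ('a + 'b) list \<Rightarrow> complex" where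
  "word_cinner [] [] = 1"
| "word_cinner (Inl g # v) (Inl h # w) = cinner g h * word_cinner v w"
| "word_cinner (Inr g # v) (Inr h # w) = cinner g h * word_cinner v w"
| "word_cinner _ _ = 0"

text \<open>
  The Hilbert direct sum of the Hilbert tensor products is determined, up to a unique unitary
  compatible with the elementary tensors, by the inner products of the elementary tensors
  \<open>T w\<close> and their totality; in particular multilinearity of \<open>T\<close> follows. The type \<open>'h\<close> with \<open>T\<close> is
  any realization of it. The vacuum vector is \<open>T []\<close>.
\<close>

definition is_free_product :: "'a::chilbert_space \<Rightarrow> 'b::chilbert_space \<Rightarrow>
    (('a + 'b) list \<Rightarrow> 'h::chilbert_space) \<Rightarrow> bool" where
  "is_free_product \<xi>1 \<xi>2 T \<longleftrightarrow> norm \<xi>1 = 1 \<and> norm \<xi>2 = 1 \<and>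
     (\<forall>v \<in> reduced_words \<xi>1 \<xi>2. \<forall>w \<in> reduced_words \<xi>1 \<xi>2. cinner (T v) (T w) = word_cinner v w) \<and>
     closure (cspan (T ` reduced_words \<xi>1 \<xi>2)) = UNIV"

definition words_not_from ::
    "'a::chilbert_space \<Rightarrow> 'b::chilbert_space \<Rightarrow> nat \<Rightarrow> ('a + 'b) list set" where
  "words_not_from \<xi>1 \<xi>2 j = {w \<in> reduced_words \<xi>1 \<xi>2. w \<noteq> [] \<longrightarrow> letter_index (hd w) \<noteq> j}"

text \<open>The subspace \<open>\<H>\<^bsup>(n)\<^esup>(j)\<close>; for \<open>n = 0\<close> it is spanned by the vacuum vector.\<close>

definition level :: "'a::chilbert_space \<Rightarrow> 'b::chilbert_space \<Rightarrow>
    (('a + 'b) list \<Rightarrow> 'h::chilbert_space) \<Rightarrow> nat \<Rightarrow> nat \<Rightarrow> 'h set" where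
  "level \<xi>1 \<xi>2 T n j = closure (cspan (T ` {w \<in> words_not_from \<xi>1 \<xi>2 j. length w = n}))"

text \<open>
  \<open>left_tensor Inl \<xi>1 T h w\<close> is \<open>h \<otimes> T w\<close> for a vector \<open>h\<close> of the first space and a reduced word
  \<open>w\<close> not starting in the first space, with the identification of \<open>\<xi>1 \<otimes> T w\<close> with \<open>T w\<close>;
  likewise for \<open>Inr\<close>, \<open>\<xi>2\<close> and the second space.
\<close>

definition left_tensor :: "('c \<Rightarrow> 'a + 'b) \<Rightarrow> 'c::chilbert_space \<Rightarrow>
    (('a + 'b) list \<Rightarrow> 'h::chilbert_space) \<Rightarrow> 'c \<Rightarrow> ('a + 'b) list \<Rightarrow> 'h" where
  "left_tensor \<iota> \<xi>0 T h w = T (\<iota> (h - cinner h \<xi>0 *\<^sub>C \<xi>0) # w) + cinner h \<xi>0 *\<^sub>C T w"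

text \<open>
  The representations: \<open>a\<close> acts on the first tensor factor. A bounded operator is determined by its
  values on the total set of vectors \<open>h \<otimes> T w\<close>.
\<close>

definition lambda1 :: "'a::chilbert_space \<Rightarrow> 'b::chilbert_space \<Rightarrow>
    (('a + 'b) list \<Rightarrow> 'h::chilbert_space) \<Rightarrow> ('a \<Rightarrow> 'a) \<Rightarrow> 'h \<Rightarrow> 'h" where
  "lambda1 \<xi>1 \<xi>2 T a = (THE L. bounded_clinear L \<and> (\<forall>h. \<forall>w \<in> words_not_from \<xi>1 \<xi>2 1.
     L (left_tensor Inl \<xi>1 T h w) = left_tensor Inl \<xi>1 T (a h) w))"

definition lambda2 :: "'a::chilbert_space \<Rightarrow> 'b::chilbert_space \<Rightarrow>
    (('a + 'b) list \<Rightarrow> 'h::chilbert_space) \<Rightarrow> ('b \<Rightarrow> 'b) \<Rightarrow> 'h \<Rightarrow> 'h" where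
  "lambda2 \<xi>1 \<xi>2 T a = (THE L. bounded_clinear L \<and> (\<forall>h. \<forall>w \<in> words_not_from \<xi>1 \<xi>2 2.
     L (left_tensor Inr \<xi>2 T h w) = left_tensor Inr \<xi>2 T (a h) w))"

definition level_proj :: "'a::chilbert_space \<Rightarrow> 'b::chilbert_space \<Rightarrow>
    (('a + 'b) list \<Rightarrow> 'h::chilbert_space) \<Rightarrow> nat \<Rightarrow> nat \<Rightarrow> 'h \<Rightarrow> 'h" where
  "level_proj \<xi>1 \<xi>2 T j n = orth_proj
     {u + v | u v. u \<in> level \<xi>1 \<xi>2 T (n - 1) j \<and> v \<in> level \<xi>1 \<xi>2 T n (other_index j)}"

definition compress :: "'a::chilbert_space \<Rightarrow> 'b::chilbert_space \<Rightarrow>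
    (('a + 'b) list \<Rightarrow> 'h::chilbert_space) \<Rightarrow> nat \<Rightarrow> ('h \<Rightarrow> 'h) \<Rightarrow> nat \<Rightarrow> 'h \<Rightarrow> 'h" where
  "compress \<xi>1 \<xi>2 T j X n = level_proj \<xi>1 \<xi>2 T j n \<circ> X \<circ> level_proj \<xi>1 \<xi>2 T j n"

text \<open>The strongly convergent series \<open>\<Sum>\<^bsub>r\<ge>0\<^esub> X\<^sub>1(2r+1) + \<Sum>\<^bsub>r\<ge>1\<^esub> X\<^sub>2(2r)\<close>.\<close>

definition s_free_sum :: "'a::chilbert_space \<Rightarrow> 'b::chilbert_space \<Rightarrow>
    (('a + 'b) list \<Rightarrow> 'h::chilbert_space) \<Rightarrow> ('a \<Rightarrow> 'a) \<Rightarrow> ('b \<Rightarrow> 'b) \<Rightarrow> 'h \<Rightarrow> 'h" where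
  "s_free_sum \<xi>1 \<xi>2 T x1 x2 h =
     (\<Sum>r. compress \<xi>1 \<xi>2 T 1 (lambda1 \<xi>1 \<xi>2 T x1) (2 * r + 1) h) +
     (\<Sum>r. compress \<xi>1 \<xi>2 T 2 (lambda2 \<xi>1 \<xi>2 T x2) (2 * (r + 1)) h)"


section \<open>Convolutions\<close>

text \<open>
  Every pair of compactly supported distributions is realized by (free) bounded self-adjoint
  operators on the separable Hilbert space \<open>ell2\<close>, and the outcome does not depend on the
  realization; \<open>ell2\<close> therefore serves as a universal space in these definitions.
\<close>

definition free_conv :: "real measure \<Rightarrow> real measure \<Rightarrow> real measure" (infixl \<open>\<boxplus>\<close> 65) where
  "\<mu> \<boxplus> \<nu> = (THE \<rho>. \<exists>(\<xi> :: ell2) A B. norm \<xi> = 1 \<and> selfadjoint A \<and> selfadjoint B \<and>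
     free_indep \<xi> A B \<and> has_distribution \<xi> A \<mu> \<and> has_distribution \<xi> B \<nu> \<and>
     has_distribution \<xi> (\<lambda>h. A h + B h) \<rho>)"

definition s_free_conv :: "real measure \<Rightarrow> real measure \<Rightarrow> real measure" (infixl \<open>\<boxplus>\<^sub>s\<close> 65) where
  "\<mu> \<boxplus>\<^sub>s \<nu> = (THE \<rho>. \<exists>(\<xi>1 :: ell2) (\<xi>2 :: ell2) (T :: (ell2 + ell2) list \<Rightarrow> ell2) x1 x2.
     is_free_product \<xi>1 \<xi>2 T \<and> selfadjoint x1 \<and> selfadjoint x2 \<and>
     has_distribution \<xi>1 x1 \<mu> \<and> has_distribution \<xi>2 x2 \<nu> \<and>
     has_distribution (T []) (s_free_sum \<xi>1 \<xi>2 T x1 x2) \<rho>)"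

definition cauchy_transform :: "real measure \<Rightarrow> complex \<Rightarrow> complex" where
  "cauchy_transform \<mu> z = (\<integral>x. 1 / (z - complex_of_real x) \<partial>\<mu>)"

definition reciprocal_cauchy :: "real measure \<Rightarrow> complex \<Rightarrow> complex" where
  "reciprocal_cauchy \<mu> z = 1 / cauchy_transform \<mu> z"

definition monotone_conv :: "real measure \<Rightarrow> real measure \<Rightarrow> real measure" (infixl \<open>\<rhd>\<close> 65) where
  "\<mu> \<rhd> \<nu> = (THE \<rho>. prob_space \<rho> \<and> sets \<rho> = sets borel \<and>
     (\<forall>z. Im z > 0 \<longrightarrow>
        reciprocal_cauchy \<rho> z = reciprocal_cauchy \<mu> (reciprocal_cauchy \<nu> z)))"

end

theory Submission
  imports Defs "HOL-Complex_Analysis.Complex_Analysis"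
begin

text \<open>
  Let \<open>P\<close> be the projection onto the span of the vacuum and of the letters from the second space,
  \<open>a = P X\<^sub>2 P\<close> (that is, \<open>X\<^sub>2(1)\<close>) and \<open>b = X\<^sub>1 + X\<^sub>2 - a\<close>. Appending a letter \<open>k\<close> of the second space
  to the right of the words that are empty or end in the first space intertwines \<open>b\<close> with itself,
  whence \<open>P b\<^sup>n P = \<phi>(b\<^sup>n) P\<close>; since \<open>a = P a P\<close>, this is monotone independence. On the words that are
  empty or end in the first space, \<open>b\<close> agrees termwise with the series of the s-free convolution.
  Only elementary tensors are involved, as moments of the vacuum never leave their linear span.

  Monotone independence expresses the moments \<open>\<phi>(a\<^sup>m (a + b)\<^sup>n)\<close> recursively by those of \<open>a\<close> and \<open>b\<close>.
  This recursion can be solved for the moments of \<open>b\<close>, so that the s-free convolution is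
  well defined because the free one is, and its generating function is the functional equation of
  the monotone convolution near infinity, which extends to the upper half plane by analytic
  continuation. The case of the first variable follows by exchanging the two spaces.
\<close>

section \<open>Hilbert space preliminaries\<close>

text \<open>Both \<boxplus> and \<open>\<boxplus>\<^sub>s\<close> are definite descriptions over
  models on \<open>ell2\<close>, whereas the spaces of the theorem are arbitrary. Every appeal to
  them thus needs a model on \<open>ell2\<close> with the same moments; it is obtained by
  compressing each variable to the cyclic subspace of its unit vector. Since laws are defined
  through moments, the existence of a law for X_1 + X_2 and for Z_j is itself a moment problem,
  solved by positivity on the products X^k (1 - X)^l.

  The free product is given only by inner products of elementary tensors and their totality.
  Multilinearity of \<open>T\<close> and boundedness of the amplified operators are therefore both
  extracted from Gram matrices, the latter by an estimate on orbits of symmetric operators.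

  X_2(1) is exactly what obstructs appending: X_2 can send the vacuum to a vector with a component
  in the second space, to which no further letter of that space can be appended. Subtracting X_2(1)
  leaves an operator that vanishes on the vacuum and on single letters of the second space, so the
  conflict never arises.\<close>

lemma cinner_add_right: "cinner x (y + z) = cinner x y + cinner x z"
  for x :: "'a::chilbert_space"
  by (metis cinner_add_left cinner_commute complex_cnj_add)

lemma cinner_scaleC_right: "cinner x (c *\<^sub>C y) = cnj c * cinner x y"
  for x :: "'a::chilbert_space"
  by (metis cinner_scaleC_left cinner_commute complex_cnj_mult)

lemma cinner_self_eq_0_iff [simp]: "cinner x x = 0 \<longleftrightarrow> x = 0"
  for x :: "'a::chilbert_space"
  by (simp add: cinner_self)

lemma norm_scaleC: "norm (c *\<^sub>C x) = cmod c * norm x"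
  for x :: "'a::chilbert_space"
proof -
  have "complex_of_real ((norm (c *\<^sub>C x))\<^sup>2) = complex_of_real ((cmod c * norm x)\<^sup>2)"
    unfolding cinner_self[symmetric] power_mult_distrib of_real_mult complex_norm_square
    by (simp add: cinner_scaleC_left cinner_scaleC_right)
  then have "(norm (c *\<^sub>C x))\<^sup>2 = (cmod c * norm x)\<^sup>2"
    using of_real_eq_iff by blast
  then show ?thesis
    by (simp add: power2_eq_iff_nonneg)
qed

lemma scaleC_zero_right [simp]: "c *\<^sub>C (0::'a::chilbert_space) = 0"
  by (metis add_cancel_right_right scaleC_add_right)

lemma cinner_zero_left [simp]: "cinner 0 (y::'a::chilbert_space) = 0"
  by (metis add_cancel_right_right cinner_add_left)

lemma cinner_zero_right [simp]: "cinner (y::'a::chilbert_space) 0 = 0"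
  by (metis add_cancel_right_right cinner_add_right)

lemma norm_add_square:
  fixes x y :: "'a::chilbert_space"
  shows "complex_of_real ((norm (x + y))\<^sup>2) = cinner x x + cinner x y + cinner y x + cinner y y"
  unfolding cinner_self[symmetric] by (simp add: cinner_add_left cinner_add_right)

lemma cinner_Cauchy_Schwarz: "cmod (cinner x y) \<le> norm x * norm y"
  for x :: "'a::chilbert_space"
proof (cases "y = 0")
  case False
  define c where "c = - cinner x y / cinner y y"
  have y: "cinner y y \<noteq> 0" using False by simp
  have n: "cnj (cinner y y) = cinner y y" by (simp add: cinner_self)
  have "complex_of_real ((norm (x + c *\<^sub>C y))\<^sup>2)
      = cinner x x + cnj c * cinner x y + c * cnj (cinner x y) + c * (cnj c * cinner y y)"
    unfolding norm_add_square cinner_scaleC_left cinner_scaleC_right cinner_commute[of y x] by simp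
  also have "\<dots> = cinner x x - cinner x y * cnj (cinner x y) / cinner y y"
    using y n by (simp add: c_def)
  also have "\<dots> = complex_of_real ((norm x)\<^sup>2 - (cmod (cinner x y))\<^sup>2 / (norm y)\<^sup>2)"
    by (simp add: cinner_self flip: complex_norm_square)
  finally have "(norm (x + c *\<^sub>C y))\<^sup>2 = (norm x)\<^sup>2 - (cmod (cinner x y))\<^sup>2 / (norm y)\<^sup>2"
    using of_real_eq_iff by blast
  then have "(cmod (cinner x y))\<^sup>2 / (norm y)\<^sup>2 \<le> (norm x)\<^sup>2"
    by (smt (verit) zero_le_power2)
  then have "(cmod (cinner x y))\<^sup>2 \<le> (norm x * norm y)\<^sup>2"
    using False by (simp add: divide_le_eq power_mult_distrib)
  then show ?thesis
    by (rule power2_le_imp_le) simp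
qed simp

interpretation cinner: bounded_bilinear "cinner :: 'a::chilbert_space \<Rightarrow> 'a \<Rightarrow> complex"
proof
  show "cinner (r *\<^sub>R a) b = r *\<^sub>R cinner a b" "cinner a (r *\<^sub>R b) = r *\<^sub>R cinner a b" for r and a b :: 'a
    by (simp_all add: scaleR_eq_scaleC cinner_scaleC_left cinner_scaleC_right scaleR_conv_of_real)
  show "\<exists>K. \<forall>a b :: 'a. norm (cinner a b) \<le> norm a * norm b * K"
    by (intro exI[of _ 1]) (simp add: cinner_Cauchy_Schwarz)
qed (simp_all add: cinner_add_left cinner_add_right)

interpretation scaleC: bounded_bilinear "scaleC :: complex \<Rightarrow> 'a \<Rightarrow> 'a::chilbert_space"
proof
  show "(r *\<^sub>R a) *\<^sub>C b = r *\<^sub>R (a *\<^sub>C b)" "a *\<^sub>C (r *\<^sub>R b) = r *\<^sub>R (a *\<^sub>C b)" for r a and b :: 'a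
    by (simp_all add: scaleR_eq_scaleC scaleC_scaleC scaleR_conv_of_real mult.commute)
  show "\<exists>K. \<forall>a (b :: 'a). norm (a *\<^sub>C b) \<le> norm a * norm b * K"
    by (intro exI[of _ 1]) (simp add: norm_scaleC)
qed (simp_all add: scaleC_add_left scaleC_add_right)

lemma Pythagoras:
  assumes "cinner x y = 0"
  shows "(norm (x + y))\<^sup>2 = (norm x)\<^sup>2 + (norm y)\<^sup>2"
proof -
  have "cinner y x = 0" by (metis assms cinner_commute complex_cnj_zero)
  then have "complex_of_real ((norm (x + y))\<^sup>2) = complex_of_real ((norm x)\<^sup>2 + (norm y)\<^sup>2)"
    using assms norm_add_square[of x y] by (simp add: cinner_self)
  then show ?thesis using of_real_eq_iff by blast
qed

lemma bounded_clinearI: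
  assumes "\<And>x y. A (x + y) = A x + A y" "\<And>c x. A (c *\<^sub>C x) = c *\<^sub>C A x"
    and "\<And>x. norm (A x) \<le> norm x * K"
  shows "bounded_clinear A"
  unfolding bounded_clinear_def using assms
  by (auto intro!: bounded_linear_intro simp: scaleR_eq_scaleC)

lemma
  assumes "bounded_clinear A"
  shows bounded_clinear_bounded_linear: "bounded_linear A"
    and bounded_clinear_add: "A (x + y) = A x + A y"
    and bounded_clinear_diff: "A (x - y) = A x - A y"
    and bounded_clinear_zero: "A 0 = 0"
    and bounded_clinear_scaleC: "A (c *\<^sub>C x) = c *\<^sub>C A x"
    and bounded_clinear_scaleR: "A (r *\<^sub>R x) = r *\<^sub>R A x"
    and bounded_clinear_continuous_on: "continuous_on S A"
proof -
  show bl: "bounded_linear A" using assms by (simp add: bounded_clinear_def)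
  then interpret bounded_linear A .
  show "A (x + y) = A x + A y" "A (x - y) = A x - A y" "A 0 = 0" "A (r *\<^sub>R x) = r *\<^sub>R A x"
    by (simp_all add: add diff zero scaleR)
  show "A (c *\<^sub>C x) = c *\<^sub>C A x" using assms by (simp add: bounded_clinear_def)
  show "continuous_on S A" by (simp add: bl linear_continuous_on)
qed

lemma bounded_clinear_id: "bounded_clinear (\<lambda>x. x)"
  by (simp add: bounded_clinear_def bounded_linear_ident)

lemma bounded_clinear_plus: "bounded_clinear A \<Longrightarrow> bounded_clinear B \<Longrightarrow> bounded_clinear (\<lambda>x. A x + B x)"
  by (simp add: bounded_clinear_def bounded_linear_add scaleC_add_right)

lemma bounded_clinear_minus: "bounded_clinear A \<Longrightarrow> bounded_clinear B \<Longrightarrow> bounded_clinear (\<lambda>x. A x - B x)"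
  by (simp add: bounded_clinear_def bounded_linear_sub scaleC.diff_right)

lemma bounded_clinear_scale: "bounded_clinear A \<Longrightarrow> bounded_clinear (\<lambda>x. c *\<^sub>C A x)"
  using bounded_linear_compose[OF scaleC.bounded_linear_right, of A c]
  by (simp add: bounded_clinear_def scaleC_scaleC mult.commute)

lemma bounded_clinear_comp: "bounded_clinear A \<Longrightarrow> bounded_clinear B \<Longrightarrow> bounded_clinear (A \<circ> B)"
  by (simp add: bounded_clinear_def bounded_linear_compose o_def)

lemma bounded_clinear_funpow: "bounded_clinear A \<Longrightarrow> bounded_clinear (A ^^ n)"
  for A :: "'a::chilbert_space \<Rightarrow> 'a"
proof (induction n)
  case 0
  have "A ^^ 0 = (\<lambda>x. x)" by (rule ext) simp
  then show ?case using bounded_clinear_id by metis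
qed (simp add: bounded_clinear_comp)

lemma bounded_clinear_unital_algebra:
  assumes "\<And>A. A \<in> G \<Longrightarrow> bounded_clinear A" "C \<in> unital_algebra G"
  shows "bounded_clinear C"
  using assms(2)
proof induction
  case unit
  then show ?case using bounded_clinear_id by (simp add: id_def)
qed (use assms(1) bounded_clinear_plus bounded_clinear_scale bounded_clinear_comp in blast)+

section \<open>Orthogonal projections, total sets and self-adjointness\<close>

lemma orth_proj_eqI:
  assumes "y \<in> S" and "\<And>s. s \<in> S \<Longrightarrow> cinner (x - y) s = 0"
    and diff: "\<And>u v. u \<in> S \<Longrightarrow> v \<in> S \<Longrightarrow> u - v \<in> S"
  shows "orth_proj S x = y"
  unfolding orth_proj_def
proof (rule the_equality)
  fix z assume z: "z \<in> S \<and> (\<forall>s\<in>S. cinner (x - z) s = 0)"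
  \<comment> \<open>Two candidates differ by an element of \<open>S\<close> that is orthogonal to
    itself.\<close>
  then have "z - y \<in> S" using assms by blast
  then have "cinner (x - y) (z - y) = 0" "cinner (x - z) (z - y) = 0"
    using z assms(2) by blast+
  then have "cinner (z - y) (z - y) = 0"
    by (simp add: cinner.diff_left)
  then show "z = y" by simp
qed (use assms in blast)

lemma bounded_clinear_eq_0_on_closure_cspan:
  assumes "bounded_clinear A" "\<And>x. x \<in> S \<Longrightarrow> A x = 0" "x \<in> closure (cspan S)"
  shows "A x = 0"
proof -
  have "A x = 0" if "x \<in> cspan S" for x
    using that
    by (induction rule: complex_space.span_induct_alt)
      (simp_all add: assms(2) bounded_clinear_zero[OF assms(1)] bounded_clinear_add[OF assms(1)]
        bounded_clinear_scaleC[OF assms(1)])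
  then show ?thesis
    using continuous_constant_on_closure[OF bounded_clinear_continuous_on[OF assms(1)]] assms(3) by blast
qed

lemma bounded_clinear_eqI_total:
  assumes "bounded_clinear A" "bounded_clinear B" "closure (cspan S) = UNIV"
    and "\<And>x. x \<in> S \<Longrightarrow> A x = B x"
  shows "A = B"
  using bounded_clinear_eq_0_on_closure_cspan[OF bounded_clinear_minus[OF assms(1,2)], of S] assms(3,4)
  by auto

lemma cinner_eq_0_closure_cspan:
  assumes "\<And>x y. x \<in> S \<Longrightarrow> y \<in> R \<Longrightarrow> cinner x y = 0"
    and "x \<in> closure (cspan S)" "y \<in> closure (cspan R)"
  shows "cinner x y = 0"
proof -
  have *: "cinner x y = 0" if "\<And>x. x \<in> S \<Longrightarrow> cinner x y = 0" "x \<in> closure (cspan S)"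
    for S and x y :: 'a
  proof -
    have "cinner x y = 0" if "x \<in> cspan S" for x
      using that
      by (induction rule: complex_space.span_induct_alt)
        (simp_all add: \<open>\<And>x. x \<in> S \<Longrightarrow> cinner x y = 0\<close> cinner_add_left cinner_scaleC_left)
    moreover have "continuous_on (closure (cspan S)) (\<lambda>x. cinner x y)"
      by (intro cinner.continuous_on continuous_on_id continuous_on_const)
    ultimately show ?thesis
      using continuous_constant_on_closure[of "cspan S" "\<lambda>x. cinner x y" 0 x] that(2) by blast
  qed
  have "cinner y x = 0" if "x \<in> S" for x
    by (rule *[OF _ assms(3)]) (metis assms(1) cinner_commute complex_cnj_zero that)
  then show ?thesis
    by (intro *[OF _ assms(2)]) (metis cinner_commute complex_cnj_zero)
qed

lemma selfadjointI_total:
  assumes "bounded_clinear A" "closure (cspan S) = UNIV"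
    and "\<And>x y. x \<in> S \<Longrightarrow> y \<in> S \<Longrightarrow> cinner (A x) y = cinner x (A y)"
  shows "selfadjoint A"
  unfolding selfadjoint_def
proof (intro conjI allI)
  \<comment> \<open>Extension by density in one variable with the other fixed. It is used twice:
    once to free the first argument, and inside that once more with the roles exchanged through
    \<open>cinner_commute\<close>.\<close>
  have *: "cinner (A x) y = cinner x (A y)" if y: "\<And>x. x \<in> S \<Longrightarrow> cinner (A x) y = cinner x (A y)" for x y
  proof -
    have "cinner (A x) y - cinner x (A y) = 0" if "x \<in> cspan S" for x
      using that
      by (induction rule: complex_space.span_induct_alt)
        (simp_all add: y cinner_add_left cinner_scaleC_left bounded_clinear_add[OF assms(1)]
          bounded_clinear_scaleC[OF assms(1)] bounded_clinear_zero[OF assms(1)])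
    moreover have "continuous_on (closure (cspan S)) (\<lambda>x. cinner (A x) y - cinner x (A y))"
      by (intro continuous_on_diff cinner.continuous_on continuous_on_id continuous_on_const
          bounded_clinear_continuous_on[OF assms(1)])
    ultimately have "cinner (A x) y - cinner x (A y) = 0"
      using continuous_constant_on_closure[of "cspan S" "\<lambda>x. cinner (A x) y - cinner x (A y)" 0 x] assms(2)
      by blast
    then show ?thesis by simp
  qed
  show "cinner (A x) y = cinner x (A y)" for x y
  proof (rule *)
    fix u assume "u \<in> S"
    have "cinner (A y) u = cinner y (A u)"
      by (rule *) (simp add: assms(3) \<open>u \<in> S\<close>)
    then show "cinner (A u) y = cinner u (A y)"
      by (metis cinner_commute)
  qed
qed (fact assms(1))

lemma
  assumes "selfadjoint A"
  shows selfadjoint_bounded_clinear: "bounded_clinear A"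
    and selfadjoint_cinner: "cinner (A x) y = cinner x (A y)"
  using assms by (simp_all add: selfadjoint_def)

lemma selfadjoint_funpow_cinner: "selfadjoint A \<Longrightarrow> cinner ((A ^^ n) x) y = cinner x ((A ^^ n) y)"
  by (induction n arbitrary: x) (simp_all add: selfadjoint_cinner funpow_swap1)


text \<open>
  Linear combinations are coded by lists of coefficients and indices, so that no merging of
  repeated indices is needed.
\<close>

definition lcomb :: "('i \<Rightarrow> 'a::chilbert_space) \<Rightarrow> (complex \<times> 'i) list \<Rightarrow> 'a" where
  "lcomb f xs = (\<Sum>(c, i)\<leftarrow>xs. c *\<^sub>C f i)"

lemma lcomb_simps [simp]:
  "lcomb f [] = 0"
  "lcomb f ((c, i) # xs) = c *\<^sub>C f i + lcomb f xs"
  "lcomb f (xs @ ys) = lcomb f xs + lcomb f ys"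
  by (simp_all add: lcomb_def)

lemma lcomb_scale: "lcomb f (map (\<lambda>(c, i). (d * c, i)) xs) = d *\<^sub>C lcomb f xs"
  by (induction xs) (auto simp: scaleC_add_right scaleC_scaleC)

lemma bounded_clinear_lcomb: "bounded_clinear A \<Longrightarrow> A (lcomb f xs) = lcomb (A \<circ> f) xs"
  by (induction xs) (auto simp: bounded_clinear_zero bounded_clinear_add bounded_clinear_scaleC)

lemma cspan_lcomb:
  assumes "v \<in> cspan (f ` I)"
  shows "\<exists>xs. snd ` set xs \<subseteq> I \<and> v = lcomb f xs"
  using assms
proof (induction rule: complex_space.span_induct_alt)
  case base
  then show ?case by (intro exI[of _ "[]"]) simp
next
  case (step c x y)
  then obtain i xs where "x = f i" "i \<in> I" "snd ` set xs \<subseteq> I" "y = lcomb f xs" by blast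
  then show ?case by (intro exI[of _ "(c, i) # xs"]) simp
qed

text \<open>The one inequality serves three times. For the difference of two codings of a vector it
  gives well-definedness on the span, so \<open>f\<close> may be redundant; on the span it is the
  Lipschitz estimate that allows the extension to the closure; in the limit it is the bound on
  \<open>L\<close>.\<close>

lemma bounded_clinear_extension:
  fixes f :: "'i \<Rightarrow> 'a::chilbert_space" and g :: "'i \<Rightarrow> 'b::chilbert_space"
  assumes total: "closure (cspan (f ` I)) = UNIV"
    and bound: "\<And>xs. snd ` set xs \<subseteq> I \<Longrightarrow> norm (lcomb g xs) \<le> M * norm (lcomb f xs)"
  obtains L where "bounded_clinear L" "\<And>i. i \<in> I \<Longrightarrow> L (f i) = g i"
    "\<And>x. norm (L x) \<le> M * norm x"
proof -
  define V where "V = cspan (f ` I)"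
  define r where "r v = (SOME xs. snd ` set xs \<subseteq> I \<and> v = lcomb f xs)" for v
  have r: "snd ` set (r v) \<subseteq> I" "lcomb f (r v) = v" if "v \<in> V" for v
  proof -
    have "snd ` set (r v) \<subseteq> I \<and> v = lcomb f (r v)"
      unfolding r_def by (rule someI_ex[OF cspan_lcomb[OF that[unfolded V_def]]])
    then show "snd ` set (r v) \<subseteq> I" "lcomb f (r v) = v" by (blast, metis)
  qed
  define l where "l v = lcomb g (r v)" for v
  have l: "l v = lcomb g xs" if "v \<in> V" "snd ` set xs \<subseteq> I" "v = lcomb f xs" for v xs
  proof -
    let ?ys = "r v @ map (\<lambda>(c, i). (- 1 * c, i)) xs"
    have "snd ` set ?ys \<subseteq> I" using r(1)[OF that(1)] that(2) by force
    moreover have "lcomb f ?ys = 0" "lcomb g ?ys = l v - lcomb g xs"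
      unfolding lcomb_simps lcomb_scale l_def r(2)[OF that(1)] that(3)[symmetric]
      by (simp_all add: scaleC.minus_left scaleC_one)
    ultimately show ?thesis using bound[of ?ys] by simp
  qed
  have V: "u + v \<in> V" "u - v \<in> V" "c *\<^sub>C v \<in> V" if "u \<in> V" "v \<in> V" for u v c
    using that by (simp_all add: V_def complex_space.span_add complex_space.span_diff complex_space.span_scale)
  have l_add: "l (u + v) = l u + l v" if "u \<in> V" "v \<in> V" for u v
    using l[OF V(1)[OF that], of "r u @ r v"] r[OF that(1)] r[OF that(2)] by (simp add: l_def image_Un)
  have l_scale: "l (c *\<^sub>C u) = c *\<^sub>C l u" if "u \<in> V" for u c
  proof -
    have "snd ` set (map (\<lambda>(d, i). (c * d, i)) (r u)) \<subseteq> I" using r(1)[OF that] by force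
    then show ?thesis
      using l[OF V(3)[OF that that], of "map (\<lambda>(d, i). (c * d, i)) (r u)" c] r(2)[OF that]
      by (simp add: l_def lcomb_scale)
  qed
  have l_bound: "norm (l u) \<le> M * norm u" if "u \<in> V" for u
    using bound[of "r u"] r that by (simp add: l_def)
  have l_diff: "l (u - v) = l u - l v" if "u \<in> V" "v \<in> V" for u v
    using l_add[of "u - v" v] that V by simp
  \<comment> \<open>\<open>M\<close> carries no sign assumption, hence the absolute value in the
    Lipschitz constant.\<close>
  have lip: "dist (l u) (l v) \<le> \<bar>M\<bar> * dist u v" if "u \<in> V" "v \<in> V" for u v
    using l_bound[of "u - v"] that V l_diff[of u v]
    by (smt (verit, best) dist_norm mult_right_mono norm_ge_zero)
  have "uniformly_continuous_on V l"
    by (rule lipschitz_on_uniformly_continuous[of "\<bar>M\<bar>"]) (auto intro!: lipschitz_onI lip)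
  then obtain L where L: "uniformly_continuous_on (closure V) L" "\<And>x. x \<in> V \<Longrightarrow> l x = L x"
    using uniformly_continuous_on_extension_on_closure by metis
  have cont: "continuous_on UNIV L"
    using L(1) total uniformly_continuous_imp_continuous by (auto simp: V_def)
  have LIM: "(\<lambda>n. L (X n)) \<longlonglongrightarrow> L x" if "X \<longlonglongrightarrow> x" for X x
    using cont that by (simp add: continuous_on_eq_continuous_at isCont_tendsto_compose)
  have seq: "\<exists>X. (\<forall>n. X n \<in> V) \<and> X \<longlonglongrightarrow> x" for x
    using total closure_sequential[of x V] by (simp add: V_def)
  have add: "L (x + y) = L x + L y" for x y
  proof -
    obtain X Y where X: "\<And>n. X n \<in> V" "X \<longlonglongrightarrow> x" and Y: "\<And>n. Y n \<in> V" "Y \<longlonglongrightarrow> y"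
      using seq by metis
    have "(\<lambda>n. L (X n + Y n)) \<longlonglongrightarrow> L (x + y)" by (intro LIM tendsto_add X Y)
    moreover have "L (X n + Y n) = L (X n) + L (Y n)" for n
      using L(2)[OF X(1)[of n]] L(2)[OF Y(1)[of n]] L(2)[OF V(1)[OF X(1)[of n] Y(1)[of n]]]
        l_add[OF X(1)[of n] Y(1)[of n]]
      by simp
    ultimately have "(\<lambda>n. L (X n) + L (Y n)) \<longlonglongrightarrow> L (x + y)" by simp
    moreover have "(\<lambda>n. L (X n) + L (Y n)) \<longlonglongrightarrow> L x + L y" by (intro tendsto_add LIM X Y)
    ultimately show ?thesis using LIMSEQ_unique by blast
  qed
  have scale: "L (c *\<^sub>C x) = c *\<^sub>C L x" for c x
  proof -
    obtain X where X: "\<And>n. X n \<in> V" "X \<longlonglongrightarrow> x" using seq by metis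
    have "(\<lambda>n. L (c *\<^sub>C X n)) \<longlonglongrightarrow> L (c *\<^sub>C x)"
      by (intro LIM scaleC.tendsto X tendsto_const)
    moreover have "L (c *\<^sub>C X n) = c *\<^sub>C L (X n)" for n
      using L(2)[OF X(1)[of n]] L(2)[OF V(3)[OF X(1)[of n] X(1)[of n], of c]] l_scale[OF X(1)[of n], of c] by simp
    ultimately have "(\<lambda>n. c *\<^sub>C L (X n)) \<longlonglongrightarrow> L (c *\<^sub>C x)" by simp
    moreover have "(\<lambda>n. c *\<^sub>C L (X n)) \<longlonglongrightarrow> c *\<^sub>C L x"
      by (intro scaleC.tendsto LIM X tendsto_const)
    ultimately show ?thesis using LIMSEQ_unique by blast
  qed
  have bd: "norm (L x) \<le> M * norm x" for x
  proof -
    obtain X where X: "\<And>n. X n \<in> V" "X \<longlonglongrightarrow> x" using seq by metis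
    show ?thesis
    proof (rule LIMSEQ_le)
      show "(\<lambda>n. norm (L (X n))) \<longlonglongrightarrow> norm (L x)" by (intro tendsto_norm LIM X)
      show "(\<lambda>n. M * norm (X n)) \<longlonglongrightarrow> M * norm x" by (intro tendsto_intros X)
    qed (use X l_bound L(2) in auto)
  qed
  show ?thesis
  proof
    show "bounded_clinear L"
      by (rule bounded_clinearI[where K = M]) (use add scale bd in \<open>simp_all add: mult.commute\<close>)
    show "L (f i) = g i" if "i \<in> I" for i
    proof -
      have "f i \<in> V" unfolding V_def using that by (simp add: complex_space.span_base)
      then show ?thesis
        using l[OF \<open>f i \<in> V\<close>, of "[(1, i)]"] that L(2)[OF \<open>f i \<in> V\<close>] by (simp add: scaleC_one)
    qed
  qed (fact bd)
qed

text \<open>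
  Applied to the orbits \<open>s n = A\<^sup>n v\<close> of a symmetric operator \<open>A\<close>, this bounds \<open>A\<close>: iterate \<open>\<parallel>s 1\<parallel>\<^sup>2 = \<langle>s 2, s 0\<rangle> \<le> \<parallel>s 2\<parallel> \<parallel>s 0\<parallel>\<close>.
\<close>

lemma symmetric_orbit_bound:
  fixes s :: "nat \<Rightarrow> 'a::chilbert_space"
  assumes sym: "\<And>m n. cinner (s (Suc m)) (s n) = cinner (s m) (s (Suc n))"
    and growth: "\<And>n. norm (s n) \<le> C * K ^ n" and "K > 0"
  shows "norm (s 1) \<le> K * norm (s 0)"
proof -
  have shift: "cinner (s m) (s n) = cinner (s (m + n)) (s 0)" for m n
    by (induction n arbitrary: m) (simp_all flip: sym)
  have sq: "(norm (s n))\<^sup>2 \<le> norm (s (n + n)) * norm (s 0)" for n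
    using cinner_Cauchy_Schwarz[of "s (n + n)" "s 0"] 
    unfolding shift[symmetric] cinner_self by (simp add: norm_power)
  show ?thesis
  proof (cases "s 0 = 0")
    case True
    then show ?thesis using sq[of 1] by simp
  next
    case False
    then have pos: "norm (s 0) > 0" by simp
    have iter: "(norm (s 1) / norm (s 0)) ^ (2 ^ n) \<le> norm (s (2 ^ n)) / norm (s 0)" for n
    proof (induction n)
      case 0
      then show ?case by simp
    next
      case (Suc n)
      have "(norm (s 1) / norm (s 0)) ^ (2 ^ Suc n) = ((norm (s 1) / norm (s 0)) ^ (2 ^ n))\<^sup>2"
        by (simp add: mult.commute flip: power_mult)
      also have "\<dots> \<le> (norm (s (2 ^ n)) / norm (s 0))\<^sup>2"
        by (intro power_mono Suc) simp
      also have "\<dots> \<le> norm (s (2 ^ Suc n)) / norm (s 0)"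
        using sq[of "2 ^ n"] pos by (simp add: power_divide divide_simps power2_eq_square mult_2)
      finally show ?case .
    qed
    define q where "q = norm (s 1) / norm (s 0) / K"
    have bd: "q ^ (2 ^ n) \<le> C / norm (s 0)" for n
    proof -
      have "q ^ (2 ^ n) = (norm (s 1) / norm (s 0)) ^ (2 ^ n) / K ^ (2 ^ n)"
        by (simp add: q_def power_divide power_mult_distrib)
      also have "\<dots> \<le> norm (s (2 ^ n)) / norm (s 0) / K ^ (2 ^ n)"
        using \<open>K > 0\<close> by (intro divide_right_mono iter) simp
      also have "\<dots> \<le> C * K ^ (2 ^ n) / norm (s 0) / K ^ (2 ^ n)"
        using \<open>K > 0\<close> by (intro divide_right_mono growth) simp_all
      also have "\<dots> = C / norm (s 0)" using \<open>K > 0\<close> by simp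
      finally show ?thesis .
    qed
    have "q \<le> 1"
    proof (rule ccontr)
      assume "\<not> q \<le> 1"
      then obtain n where n: "C / norm (s 0) < q ^ n" by (meson not_le real_arch_pow)
      have "q ^ n \<le> q ^ (2 ^ n)" using \<open>\<not> q \<le> 1\<close> by (intro power_increasing) auto
      then show False using n bd[of n] by simp
    qed
    then show ?thesis using pos \<open>K > 0\<close> by (simp add: q_def divide_simps mult.commute)
  qed
qed


section \<open>Mixed moments\<close>

subsection \<open>Real polynomials in an operator\<close>

text \<open>Horner evaluation. Real coefficients keep \<open>opoly A p\<close> symmetric for
  self-adjoint \<open>A\<close>, and they are enough because the constants subtracted in centring
  are moments of measures on the line.\<close>

definition opoly :: "('a::real_vector \<Rightarrow> 'a) \<Rightarrow> real poly \<Rightarrow> 'a \<Rightarrow> 'a" where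
  "opoly A p = fold_coeffs (\<lambda>c f h. c *\<^sub>R h + A (f h)) p (\<lambda>h. 0)"

lemma opoly_0 [simp]: "opoly A 0 h = 0"
  by (simp add: opoly_def)

context
  fixes A :: "'a::real_vector \<Rightarrow> 'a"
  assumes A: "linear A"
begin

lemma opoly_pCons: "opoly A (pCons c p) h = c *\<^sub>R h + A (opoly A p h)"
  by (cases "p = 0 \<and> c = 0") (auto simp: opoly_def linear_0[OF A] fun_eq_iff)

lemma opoly_1: "opoly A 1 h = h"
  by (simp add: one_pCons opoly_pCons linear_0[OF A])

lemma opoly_X: "opoly A [:0, 1:] h = A h"
  by (simp add: opoly_pCons linear_0[OF A])

lemma linear_opoly: "linear (opoly A p)"
proof (induction p)
  case (pCons c p)
  have "opoly A (pCons c p) = (\<lambda>h. c *\<^sub>R h + A (opoly A p h))" by (rule ext) (rule opoly_pCons)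
  then show ?case
    using pCons A by (simp add: linear_iff scaleR_add_right scaleR_left_commute algebra_simps)
qed (simp add: linear_iff)

lemma opoly_add: "opoly A (p + q) h = opoly A p h + opoly A q h"
  by (induction p q rule: poly_induct2)
    (simp_all add: opoly_pCons linear_add[OF A] scaleR_add_left)

lemma opoly_smult: "opoly A (smult c p) h = c *\<^sub>R opoly A p h"
  by (induction p) (simp_all add: opoly_pCons linear_scale[OF A] scaleR_add_right)

lemma opoly_diff: "opoly A (p - q) h = opoly A p h - opoly A q h"
  using opoly_add[of "p - q" q h] by simp

lemma opoly_mult: "opoly A (p * q) h = opoly A p (opoly A q h)"
  by (induction p) (simp_all add: opoly_add opoly_smult opoly_pCons)

lemma opoly_commute: "opoly A p (A h) = A (opoly A p h)"
  by (induction p) (simp_all add: opoly_pCons linear_0[OF A] linear_add[OF A] linear_scale[OF A])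

lemma opoly_X_power: "opoly A ([:0, 1:] ^ n) h = (A ^^ n) h"
  by (induction n arbitrary: h) (simp_all add: opoly_1 opoly_pCons)

lemma opoly_altdef: "opoly A p h = (\<Sum>i\<le>degree p. coeff p i *\<^sub>R (A ^^ i) h)"
proof (induction p)
  case (pCons c p)
  show ?case
  proof (cases "p = 0")
    case False
    then have "(\<Sum>i\<le>degree (pCons c p). coeff (pCons c p) i *\<^sub>R (A ^^ i) h)
        = c *\<^sub>R h + (\<Sum>i\<le>degree p. coeff p i *\<^sub>R (A ^^ Suc i) h)"
      unfolding degree_pCons_eq[OF False] sum.atMost_Suc_shift by simp
    also have "\<dots> = c *\<^sub>R h + A (\<Sum>i\<le>degree p. coeff p i *\<^sub>R (A ^^ i) h)"
      by (simp add: linear_sum[OF A] linear_scale[OF A])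
    finally show ?thesis using pCons by (simp add: opoly_pCons)
  qed (simp add: opoly_pCons linear_0[OF A])
qed simp

end

lemma bounded_clinear_linear: "bounded_clinear A \<Longrightarrow> linear A"
  by (rule bounded_linear.linear[OF bounded_clinear_bounded_linear])

lemma opoly_in_unital_algebra:
  assumes "bounded_clinear A"
  shows "opoly A p \<in> unital_algebra {A}"
proof (induction p)
  case 0
  have "opoly A 0 = (\<lambda>h. 0 *\<^sub>C id h)" by (rule ext) (simp add: scaleC.zero_left)
  then show ?case by (metis unital_algebra.scale unital_algebra.unit)
next
  case (pCons c p)
  have "opoly A (pCons c p) = (\<lambda>h. complex_of_real c *\<^sub>C id h + (A \<circ> opoly A p) h)"
    by (rule ext) (simp add: opoly_pCons[OF bounded_clinear_linear[OF assms]] scaleR_eq_scaleC)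
  moreover have "(\<lambda>h. complex_of_real c *\<^sub>C id h + (A \<circ> opoly A p) h) \<in> unital_algebra {A}"
    by (intro unital_algebra.add unital_algebra.scale unital_algebra.unit unital_algebra.mult pCons.IH
        unital_algebra.gen) simp
  ultimately show ?case by simp
qed

lemma selfadjoint_opoly:
  assumes "selfadjoint A"
  shows "cinner (opoly A p u) v = cinner u (opoly A p v)"
proof (induction p arbitrary: v)
  case (pCons c p)
  have A: "linear A" using bounded_clinear_linear[OF selfadjoint_bounded_clinear[OF assms]] .
  have "cinner (A (opoly A p u)) v = cinner u (A (opoly A p v))"
    by (simp add: selfadjoint_cinner[OF assms] pCons.IH opoly_commute[OF A])
  then show ?case
    by (simp add: opoly_pCons[OF A] cinner_add_left cinner_add_right cinner.scaleR_left cinner.scaleR_right)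
qed simp

subsection \<open>Free independence determines the mixed moments\<close>

text \<open>Each letter carries a polynomial rather than a power, so that centring a factor and
  merging two neighbours from the same algebra again give lists of this kind.\<close>

fun mixed :: "('a::real_vector \<Rightarrow> 'a) \<Rightarrow> ('a \<Rightarrow> 'a) \<Rightarrow> (bool \<times> real poly) list \<Rightarrow> 'a \<Rightarrow> 'a" where
  "mixed A B [] h = h"
| "mixed A B ((i, p) # cs) h = opoly (if i then A else B) p (mixed A B cs h)"

lemma mixed_append: "mixed A B (us @ vs) h = mixed A B us (mixed A B vs h)"
  by (induction us) auto

lemma linear_mixed: "linear A \<Longrightarrow> linear B \<Longrightarrow> linear (mixed A B cs)"
proof (induction cs)
  case (Cons c cs)
  obtain i p where c: "c = (i, p)" by force
  have "mixed A B (c # cs) = opoly (if i then A else B) p \<circ> mixed A B cs" by (auto simp: c)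
  moreover have "linear (opoly (if i then A else B) p)" using Cons by (simp add: linear_opoly)
  ultimately show ?case using Cons linear_compose by metis
qed (simp add: linear_iff)

lemma free_indep_mixed:
  assumes "free_indep \<xi> A B" "bounded_clinear A" "bounded_clinear B"
    and "cs \<noteq> []" "successively (\<lambda>p q. fst p \<noteq> fst q) cs"
    and "\<forall>(i, p)\<in>set cs. vstate \<xi> (opoly (if i then A else B) p) = 0"
  shows "vstate \<xi> (mixed A B cs) = 0"
proof -
  let ?F = "\<lambda>(i, p). (i :: bool, opoly (if i then A else B) p)"
  have "foldr (\<circ>) (map snd (map ?F cs)) id h = mixed A B cs h" for h
    by (induction cs) (auto simp only: list.map foldr.simps snd_conv comp_apply mixed.simps id_apply case_prod_conv
        split: prod.split)
  then have "foldr (\<circ>) (map snd (map ?F cs)) id = mixed A B cs" by blast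
  moreover have "vstate \<xi> (foldr (\<circ>) (map snd (map ?F cs)) id) = 0"
  proof (rule assms(1)[unfolded free_indep_def, rule_format])
    show "map ?F cs \<noteq> []" using assms(4) by simp
    have "fst (?F p) = fst p" for p by (cases p) simp
    then show "successively (\<lambda>p q. fst p \<noteq> fst q) (map ?F cs)"
      using assms(5) by (simp add: successively_map)
    show "case x of (i, C) \<Rightarrow> C \<in> unital_algebra {if i then A else B} \<and> vstate \<xi> C = 0"
      if "x \<in> set (map ?F cs)" for x
      using that assms(2,3,6) opoly_in_unital_algebra[of A] opoly_in_unital_algebra[of B]
      by (auto split: if_splits) 
  qed
  ultimately show ?thesis by simp
qed

lemma not_successively_split:
  "\<not> successively R cs \<Longrightarrow> \<exists>us x y vs. cs = us @ x # y # vs \<and> \<not> R x y"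
proof (induction cs)
  case (Cons x cs)
  show ?case
  proof (cases "successively R cs")
    case True
    then obtain y vs where "cs = y # vs" "\<not> R x y"
      using Cons.prems by (cases cs) (auto simp: successively_Cons)
    then have "x # cs = [] @ x # y # vs" by simp
    then show ?thesis using \<open>\<not> R x y\<close> by blast
  next
    case False
    then obtain us u y vs where "cs = us @ u # y # vs" "\<not> R u y" using Cons.IH by blast
    then have "x # cs = (x # us) @ u # y # vs" by simp
    then show ?thesis using \<open>\<not> R u y\<close> by blast
  qed
qed simp

text \<open>
  Centring the factors of an alternating product one after the other changes its expectation only
  by expectations of shorter products.
\<close>

lemma free_mixed_moments_unique:
  fixes A B :: "'a::chilbert_space \<Rightarrow> 'a" and A' B' :: "'b::chilbert_space \<Rightarrow> 'b"
  assumes free: "free_indep \<xi> A B" "free_indep \<xi>' A' B'"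
    and bl: "bounded_clinear A" "bounded_clinear B" "bounded_clinear A'" "bounded_clinear B'"
    and m: "\<And>i p. vstate \<xi> (opoly (if i then A else B) p) = complex_of_real (m i p)"
    and m': "\<And>i p. vstate \<xi>' (opoly (if i then A' else B') p) = complex_of_real (m i p)"
    and "norm \<xi> = 1" "norm \<xi>' = 1"
  shows "vstate \<xi> (mixed A B cs) = vstate \<xi>' (mixed A' B' cs)"
proof -
  \<comment> \<open>Both models share the numbers \<open>m i p\<close>, hence the same centred
    polynomials. For the difference \<open>D\<close> the shorter products produced by centring
    vanish by the induction hypothesis.\<close>
  define D where "D cs = vstate \<xi> (mixed A B cs) - vstate \<xi>' (mixed A' B' cs)" for cs
  define centre where "centre = (\<lambda>(i, p). (i, p - [:m i p:]))"
  note lin = bl[THEN bounded_clinear_linear]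
  have lin_mixed: "linear (mixed A B cs)" "linear (mixed A' B' cs)" for cs
    by (simp_all add: linear_mixed lin)
  have unit: "cinner \<xi> \<xi> = 1" "cinner \<xi>' \<xi>' = 1" using assms(9,10) by (simp_all add: cinner_self)
  have const: "opoly (if i then A else B) [:c:] h = c *\<^sub>R h" "opoly (if i then A' else B') [:c:] h' = c *\<^sub>R h'" for i c h h'
    by (simp_all add: opoly_pCons lin linear_0)
  have split: "D (us @ (i, p) # vs) = D (us @ (i, p - [:c:]) # vs) + complex_of_real c * D (us @ vs)" for us i p vs c
  proof -
    have "opoly (if i then A else B) p h = opoly (if i then A else B) (p - [:c:]) h + c *\<^sub>R h"
      "opoly (if i then A' else B') p h' = opoly (if i then A' else B') (p - [:c:]) h' + c *\<^sub>R h'" for h h'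
      using const(1)[of i c h] const(2)[of i c h'] by (simp_all add: opoly_diff lin)
    then show ?thesis
      unfolding D_def vstate_def mixed_append mixed.simps
      by (simp only: linear_add[OF lin_mixed(1)] linear_add[OF lin_mixed(2)] linear_scale[OF lin_mixed(1)]
          linear_scale[OF lin_mixed(2)] cinner_add_left cinner.scaleR_left)
        (simp add: scaleR_conv_of_real algebra_simps)
  qed
  have "D cs = 0"
  proof (induction cs rule: length_induct)
    case (1 cs)
    show ?case
    proof (cases "successively (\<lambda>p q. fst p \<noteq> fst q) cs")
      case False
      then obtain us x y vs where cs: "cs = us @ x # y # vs" "fst x = fst y"
        using not_successively_split by blast
      obtain i p q where xy: "x = (i, p)" "y = (i, q)" using cs(2) by (cases x; cases y) auto
      \<comment> \<open>Neighbours from the same algebra merge into one factor, which shortens the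
        list.\<close>
      have "D cs = D (us @ (i, p * q) # vs)"
        by (simp add: D_def vstate_def cs xy mixed_append opoly_mult lin)
      also have "\<dots> = 0" using 1 by (simp add: cs)
      finally show ?thesis .
    next
      case True
      have step: "D (us @ vs) = D (us @ map centre vs)" if "length us + length vs = length cs" for us vs
        using that
      proof (induction vs arbitrary: us)
        case (Cons x vs)
        obtain i p where x: "x = (i, p)" by force
        have "D (us @ x # vs) = D (us @ centre x # vs) + complex_of_real (m i p) * D (us @ vs)"
          unfolding x centre_def prod.case by (rule split)
        also have "D (us @ vs) = 0" using 1 Cons.prems by simp
        also have "D (us @ centre x # vs) = D ((us @ [centre x]) @ map centre vs)"
          using Cons.IH[of "us @ [centre x]"] Cons.prems by simp
        finally show ?case by simp
      qed simp
      have "D cs = D (map centre cs)" using step[of "[]" cs] by simp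
      also have "\<dots> = 0"
      proof (cases "cs = []")
        case True
        then show ?thesis by (simp add: D_def vstate_def unit)
      next
        case False
        have "fst (centre p) = fst p" for p by (cases p) (simp add: centre_def)
        then have s: "successively (\<lambda>p q. fst p \<noteq> fst q) (map centre cs)"
          using True by (simp add: successively_map)
        have "vstate \<xi> (opoly (if i then A else B) (p - [:m i p:])) = 0"
          "vstate \<xi>' (opoly (if i then A' else B') (p - [:m i p:])) = 0" for i p
          using m[of i p] m'[of i p] const[of i "m i p"]
          by (simp_all add: vstate_def opoly_diff lin cinner.diff_left cinner.scaleR_left unit scaleR_conv_of_real)
        then have "\<forall>(i, p)\<in>set (map centre cs). vstate \<xi> (opoly (if i then A else B) p) = 0"
          "\<forall>(i, p)\<in>set (map centre cs). vstate \<xi>' (opoly (if i then A' else B') p) = 0"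
          by (auto simp: centre_def)
        then show ?thesis
          using free_indep_mixed[OF free(1) bl(1,2) _ s] free_indep_mixed[OF free(2) bl(3,4) _ s] False
          by (simp add: D_def)
      qed
      finally show ?thesis .
    qed
  qed
  then show ?thesis by (simp add: D_def)
qed

lemma free_sum_moments_unique:
  fixes A B :: "'a::chilbert_space \<Rightarrow> 'a" and A' B' :: "'b::chilbert_space \<Rightarrow> 'b"
  assumes free: "free_indep \<xi> A B" "free_indep \<xi>' A' B'"
    and bl: "bounded_clinear A" "bounded_clinear B" "bounded_clinear A'" "bounded_clinear B'"
    and A: "\<And>n. vstate \<xi> (A ^^ n) = complex_of_real (mA n)" "\<And>n. vstate \<xi>' (A' ^^ n) = complex_of_real (mA n)"
    and B: "\<And>n. vstate \<xi> (B ^^ n) = complex_of_real (mB n)" "\<And>n. vstate \<xi>' (B' ^^ n) = complex_of_real (mB n)"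
    and unit: "norm \<xi> = 1" "norm \<xi>' = 1"
  shows "vstate \<xi> ((\<lambda>h. A h + B h) ^^ n) = vstate \<xi>' ((\<lambda>h. A' h + B' h) ^^ n)"
proof -
  note lin = bl[THEN bounded_clinear_linear]
  define m where "m i p = (\<Sum>k\<le>degree p. coeff p k * (if i then mA k else mB k))" for i :: bool and p :: "real poly"
  have m: "vstate \<xi> (opoly (if i then A else B) p) = complex_of_real (m i p)" for i p
    using A(1) B(1) by (cases i) (simp_all add: vstate_def m_def opoly_altdef lin cinner.sum_left
        cinner.scaleR_left scaleR_conv_of_real)
  have m': "vstate \<xi>' (opoly (if i then A' else B') p) = complex_of_real (m i p)" for i p
    using A(2) B(2) by (cases i) (simp_all add: vstate_def m_def opoly_altdef lin cinner.sum_left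
        cinner.scaleR_left scaleR_conv_of_real)
  note eq = free_mixed_moments_unique[OF free bl m m' unit]
  have add: "mixed A B cs (A h + B h) = mixed A B (cs @ [(True, [:0, 1:])]) h + mixed A B (cs @ [(False, [:0, 1:])]) h"
    "mixed A' B' cs (A' h' + B' h') = mixed A' B' (cs @ [(True, [:0, 1:])]) h' + mixed A' B' (cs @ [(False, [:0, 1:])]) h'"
    for cs h h'
    by (simp_all add: mixed_append opoly_X lin linear_add linear_mixed)
  \<comment> \<open>The prefix \<open>cs\<close> is kept general: expanding the leftmost
    \<open>A + B\<close> appends one linear letter to it.\<close>
  have "cinner (mixed A B cs (((\<lambda>h. A h + B h) ^^ n) \<xi>)) \<xi>
      = cinner (mixed A' B' cs (((\<lambda>h. A' h + B' h) ^^ n) \<xi>')) \<xi>'" for cs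
  proof (induction n arbitrary: cs)
    case 0
    then show ?case using eq[of cs] by (simp add: vstate_def)
  next
    case (Suc n)
    then show ?case by (simp add: add cinner_add_left)
  qed
  from this[of "[]"] show ?thesis by (simp add: vstate_def)
qed


subsection \<open>Moments under monotone independence\<close>

lemma funpow_in_unital_algebra: "A \<in> unital_algebra G \<Longrightarrow> A ^^ n \<in> unital_algebra G"
  by (induction n) (auto intro: unital_algebra.unit unital_algebra.mult)

text \<open>The words of (a + b)^n are sorted by the number \<open>j\<close> of letters
  \<open>b\<close> that precede the first \<open>a\<close>, reading from the left; the separate term
  is the word without any \<open>a\<close>.\<close>

lemma funpow_sum_expansion:
  fixes a b :: "'a::chilbert_space \<Rightarrow> 'a"
  assumes "bounded_clinear b"
  defines "S \<equiv> \<lambda>h. a h + b h"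
  shows "(S ^^ n) v = (b ^^ n) v + (\<Sum>j<n. (b ^^ j) (a ((S ^^ (n - 1 - j)) v)))"
proof (induction n)
  case (Suc n)
  have "(S ^^ Suc n) v = a ((S ^^ n) v) + b ((S ^^ n) v)" by (simp add: S_def)
  also have "b ((S ^^ n) v) = b ((b ^^ n) v + (\<Sum>j<n. (b ^^ j) (a ((S ^^ (n - 1 - j)) v))))"
    by (simp only: Suc.IH)
  also have "a ((S ^^ n) v) + b ((b ^^ n) v + (\<Sum>j<n. (b ^^ j) (a ((S ^^ (n - 1 - j)) v))))
      = (b ^^ Suc n) v + (a ((S ^^ n) v) + (\<Sum>j<n. (b ^^ Suc j) (a ((S ^^ (n - Suc j)) v))))"
    using linear_sum[OF bounded_clinear_linear[OF assms(1)]]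
    by (simp add: bounded_clinear_add[OF assms(1)])
  also have "a ((S ^^ n) v) + (\<Sum>j<n. (b ^^ Suc j) (a ((S ^^ (n - Suc j)) v)))
      = (\<Sum>j<Suc n. (b ^^ j) (a ((S ^^ (Suc n - 1 - j)) v)))"
    by (subst sum.lessThan_Suc_shift) simp
  finally show ?case .
qed simp

text \<open>In each term of the preceding expansion the block \<open>b ^^ j\<close> stands between
  two letters \<open>a\<close>, or at the left end if \<open>m = 0\<close>, and may be replaced by
  its expectation. The freed letter \<open>a\<close> then joins the leading power, which is why
  \<open>m\<close> is a parameter: this makes the recursion close.\<close>

lemma monotone_moment_recursion:
  fixes a b :: "'a::chilbert_space \<Rightarrow> 'a"
  assumes mon: "monotone_indep \<xi> a b" and a: "bounded_clinear a" and b: "bounded_clinear b" and "norm \<xi> = 1"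
  defines "S \<equiv> \<lambda>h. a h + b h"
  shows "vstate \<xi> ((a ^^ m) \<circ> (S ^^ n)) = vstate \<xi> (b ^^ n) * vstate \<xi> (a ^^ m)
    + (\<Sum>j<n. vstate \<xi> (b ^^ j) * vstate \<xi> ((a ^^ Suc m) \<circ> (S ^^ (n - 1 - j))))"
proof -
  have unit: "vstate \<xi> (b ^^ 0) = 1" using \<open>norm \<xi> = 1\<close> by (simp add: vstate_def cinner_self)
  have alg: "a \<in> unital_algebra {a, b}" "b \<in> unital_algebra {a, b}" by (auto intro: unital_algebra.gen)
  then have "S \<in> unital_algebra {a, b}" unfolding S_def by (intro unital_algebra.add)
  then have Salg: "S ^^ k \<in> unital_algebra {a, b}" for k by (rule funpow_in_unital_algebra)
  have aalg: "a ^^ k \<in> unital_algebra {a, b}" for k by (rule funpow_in_unital_algebra) (rule alg)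
  have 1: "vstate \<xi> ((a ^^ m) \<circ> (b ^^ j) \<circ> a \<circ> (S ^^ k)) = vstate \<xi> (b ^^ j) * vstate \<xi> ((a ^^ Suc m) \<circ> (S ^^ k))" for j k
  \<comment> \<open>Independence is postulated for positive powers of \<open>b\<close> only.\<close>
  proof (cases "j = 0")
    case True
    then show ?thesis using unit by (simp add: vstate_def funpow_swap1)
  next
    case False
    show ?thesis
    proof (cases m)
      case 0
      have "vstate \<xi> ((b ^^ j) \<circ> a \<circ> (S ^^ k)) = vstate \<xi> (b ^^ j) * vstate \<xi> (a \<circ> (S ^^ k))"
        using mon False Salg alg unfolding monotone_indep_def by (metis One_nat_def Suc_leI neq0_conv)
      then show ?thesis using 0 by (simp add: vstate_def)
    next
      case (Suc l)
      have "vstate \<xi> ((a ^^ l) \<circ> a \<circ> (b ^^ j) \<circ> a \<circ> (S ^^ k))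
          = vstate \<xi> (b ^^ j) * vstate \<xi> ((a ^^ l) \<circ> (a ^^ 2) \<circ> (S ^^ k))"
        using mon False Salg aalg unfolding monotone_indep_def by (metis One_nat_def Suc_leI neq0_conv)
      then show ?thesis using Suc by (simp add: vstate_def numeral_2_eq_2 funpow_swap1)
    qed
  qed
  have 2: "vstate \<xi> ((a ^^ m) \<circ> (b ^^ n)) = vstate \<xi> (b ^^ n) * vstate \<xi> (a ^^ m)"
  proof (cases "n = 0 \<or> m = 0")
    case True
    then show ?thesis using unit by (auto simp: vstate_def)
  next
    case False
    then obtain l where l: "m = Suc l" by (cases m) auto
    have "vstate \<xi> ((a ^^ l) \<circ> a \<circ> (b ^^ n)) = vstate \<xi> (b ^^ n) * vstate \<xi> ((a ^^ l) \<circ> a)"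
      using mon False aalg unfolding monotone_indep_def by (metis One_nat_def Suc_leI neq0_conv)
    then show ?thesis using l by (simp add: vstate_def funpow_swap1)
  qed
  have lin: "linear (a ^^ m)" using bounded_clinear_linear[OF bounded_clinear_funpow[OF a]] .
  have "vstate \<xi> ((a ^^ m) \<circ> (S ^^ n))
      = vstate \<xi> ((a ^^ m) \<circ> (b ^^ n)) + (\<Sum>j<n. vstate \<xi> ((a ^^ m) \<circ> (b ^^ j) \<circ> a \<circ> (S ^^ (n - 1 - j))))"
    unfolding vstate_def comp_apply S_def
    by (subst funpow_sum_expansion[OF b]) (simp add: linear_add[OF lin] linear_sum[OF lin] cinner_add_left cinner.sum_left)
  then show ?thesis unfolding 1 2 .
qed

text \<open>In the equation for \<open>s n 0\<close> the value \<open>\<beta> n\<close> has the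
  coefficient \<open>\<alpha> 0 = 1\<close>, and all other terms involve only earlier
  \<open>\<beta> j\<close> and rows of \<open>s\<close> with smaller first index. An inner induction
  shows that these rows agree for every \<open>m\<close>, as they are computed from \<alpha> and the
  earlier \<open>\<beta> j\<close>.\<close>

lemma monotone_recursion_unique:
  fixes s s' :: "nat \<Rightarrow> nat \<Rightarrow> complex" and \<alpha> \<beta> \<beta>' :: "nat \<Rightarrow> complex"
  assumes s: "\<And>n m. s n m = \<beta> n * \<alpha> m + (\<Sum>j<n. \<beta> j * s (n - 1 - j) (Suc m))"
    and s': "\<And>n m. s' n m = \<beta>' n * \<alpha> m + (\<Sum>j<n. \<beta>' j * s' (n - 1 - j) (Suc m))"
    and "\<alpha> 0 = 1" and eq: "\<And>n. s n 0 = s' n 0"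
  shows "\<beta> n = \<beta>' n"
proof (induction n rule: less_induct)
  case (less n)
  have *: "s k m = s' k m" if "k < n" for k m
    using that
  proof (induction k arbitrary: m rule: less_induct)
    case (less k)
    have "(\<Sum>j<k. \<beta> j * s (k - 1 - j) (Suc m)) = (\<Sum>j<k. \<beta>' j * s' (k - 1 - j) (Suc m))"
      using less \<open>\<And>y. y < n \<Longrightarrow> \<beta> y = \<beta>' y\<close> by (intro sum.cong refl arg_cong2[where f = "(*)"]) auto
    then show ?case using s[of k m] s'[of k m] less.prems \<open>\<And>y. y < n \<Longrightarrow> \<beta> y = \<beta>' y\<close> by simp
  qed
  have "(\<Sum>j<n. \<beta> j * s (n - 1 - j) (Suc 0)) = (\<Sum>j<n. \<beta>' j * s' (n - 1 - j) (Suc 0))"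
    using * less by (intro sum.cong refl arg_cong2[where f = "(*)"]) auto
  then show ?case using s[of n 0] s'[of n 0] eq[of n] \<open>\<alpha> 0 = 1\<close> by simp
qed

text \<open>If G m is the generating function of \<open>s\<close> for fixed \<open>m\<close>, the
  recursion is a Cauchy product: G m = B (\<alpha> m + t G (m + 1)). Iterating from m = 0 leaves the
  remainder (t B)^M G M. For t = 1 / z and G_\<nu>(z) = t B the result reads G_\<rho>(z) = G_\<mu>(1
  / G_\<nu>(z)).\<close>

lemma monotone_recursion_generating_function:
  fixes s :: "nat \<Rightarrow> nat \<Rightarrow> complex" and \<alpha> \<beta> :: "nat \<Rightarrow> complex" and t :: complex
  assumes s: "\<And>n m. s n m = \<beta> n * \<alpha> m + (\<Sum>j<n. \<beta> j * s (n - 1 - j) (Suc m))"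
    and bound: "\<And>n m. cmod (s n m) \<le> L ^ m * L ^ n" "\<And>n. cmod (\<beta> n) \<le> L ^ n" and "L > 0"
    and t: "cmod t * L \<le> 1 / 4"
  defines "B \<equiv> (\<Sum>n. \<beta> n * t ^ n)"
  shows "(\<lambda>m. \<alpha> m * t ^ m * B ^ Suc m) sums (\<Sum>n. s n 0 * t ^ n)"
proof -
  define G where "G m = (\<Sum>n. s n m * t ^ n)" for m
  have geo: "norm (f n * t ^ n) \<le> C * (1 / 4) ^ n" if "\<And>n. cmod (f n) \<le> C * L ^ n" for f :: "nat \<Rightarrow> complex" and C n
  proof -
    have "C \<ge> 0" using order_trans[OF norm_ge_zero that[of 0]] by simp
    have "norm (f n * t ^ n) \<le> (C * L ^ n) * cmod t ^ n"
      unfolding norm_mult norm_power by (intro mult_right_mono that) simp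
    also have "\<dots> = C * (cmod t * L) ^ n" by (simp add: power_mult_distrib)
    also have "\<dots> \<le> C * (1 / 4) ^ n"
      using \<open>C \<ge> 0\<close> \<open>L > 0\<close> t by (intro mult_left_mono power_mono) auto
    finally show ?thesis .
  qed
  have g4: "summable (\<lambda>n. C * (1 / 4) ^ n :: real)" "(\<Sum>n. C * (1 / 4) ^ n :: real) = C * (4 / 3)" for C
    by (simp_all add: summable_mult summable_geometric suminf_mult suminf_geometric)
  have sm: "summable (\<lambda>n. norm (f n * t ^ n))" "norm (\<Sum>n. f n * t ^ n) \<le> C * (4 / 3)"
    if "\<And>n. cmod (f n) \<le> C * L ^ n" for f :: "nat \<Rightarrow> complex" and C
  proof -
    show 1: "summable (\<lambda>n. norm (f n * t ^ n))"
      by (rule summable_comparison_test'[OF g4(1)[of C]]) (simp add: geo[OF that])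
    have "norm (\<Sum>n. f n * t ^ n) \<le> (\<Sum>n. norm (f n * t ^ n))" by (rule summable_norm[OF 1])
    also have "\<dots> \<le> (\<Sum>n. C * (1 / 4) ^ n)" by (intro suminf_le geo[OF that] 1 g4)
    finally show "norm (\<Sum>n. f n * t ^ n) \<le> C * (4 / 3)" by (simp add: g4)
  qed
  note smB = sm[of \<beta> 1, simplified, OF bound(2)] and smG = sm[of "\<lambda>n. s n m" "L ^ m" for m, OF bound(1)]
  have rec: "G m = B * (\<alpha> m + t * G (Suc m))" for m
  proof -
    have "(\<lambda>k. \<Sum>i\<le>k. (\<beta> i * t ^ i) * (s (k - i) (Suc m) * t ^ (k - i))) sums (B * G (Suc m))"
      unfolding B_def G_def by (rule Cauchy_product_sums[OF smB(1) smG(1)])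
    also have "(\<lambda>k. \<Sum>i\<le>k. (\<beta> i * t ^ i) * (s (k - i) (Suc m) * t ^ (k - i)))
        = (\<lambda>k. (\<Sum>i<Suc k. \<beta> i * s (k - i) (Suc m)) * t ^ k)"
      unfolding sum_distrib_right lessThan_Suc_atMost
      by (intro ext sum.cong refl) (simp add: power_add[symmetric] algebra_simps flip: power_add)
    finally have "(\<lambda>k. t * ((\<Sum>i<Suc k. \<beta> i * s (k - i) (Suc m)) * t ^ k)) sums (t * (B * G (Suc m)))"
      by (rule sums_mult)
    then have "(\<lambda>k. (\<Sum>i<Suc k. \<beta> i * s (Suc k - 1 - i) (Suc m)) * t ^ Suc k) sums (t * (B * G (Suc m)))"
      by (simp add: mult_ac)
    then have "(\<lambda>n. (\<Sum>j<n. \<beta> j * s (n - 1 - j) (Suc m)) * t ^ n) sums (t * (B * G (Suc m)))"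
      by (subst (asm) sums_Suc_iff[of "\<lambda>n. (\<Sum>j<n. \<beta> j * s (n - 1 - j) (Suc m)) * t ^ n"]) simp
    moreover have "(\<lambda>n. \<alpha> m * (\<beta> n * t ^ n)) sums (\<alpha> m * B)"
      unfolding B_def by (intro sums_mult summable_sums summable_norm_cancel[OF smB(1)])
    ultimately have "(\<lambda>n. \<alpha> m * (\<beta> n * t ^ n) + (\<Sum>j<n. \<beta> j * s (n - 1 - j) (Suc m)) * t ^ n)
        sums (\<alpha> m * B + t * (B * G (Suc m)))" by (intro sums_add)
    moreover have "(\<lambda>n. \<alpha> m * (\<beta> n * t ^ n) + (\<Sum>j<n. \<beta> j * s (n - 1 - j) (Suc m)) * t ^ n) = (\<lambda>n. s n m * t ^ n)"
    proof
      fix n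
      show "\<alpha> m * (\<beta> n * t ^ n) + (\<Sum>j<n. \<beta> j * s (n - 1 - j) (Suc m)) * t ^ n = s n m * t ^ n"
        by (subst s[of n m]) (simp add: algebra_simps)
    qed
    ultimately show ?thesis unfolding G_def by (simp add: sums_iff algebra_simps)
  qed
  have part: "G 0 = (\<Sum>m<M. \<alpha> m * t ^ m * B ^ Suc m) + (t * B) ^ M * G M" for M
  proof (induction M)
    case (Suc M)
    then show ?case by (simp add: rec[of M] power_mult_distrib algebra_simps)
  qed simp
  \<comment> \<open>1/3 = 1/4 * 4/3: the hypothesis on \<open>t\<close> times the geometric bound 1
    / (1 - 1/4) for \<open>B\<close>. Being below 1, it makes the remainder vanish in spite of the
    growth \<open>L ^ M\<close> of \<open>G M\<close>.\<close>
  have tB: "cmod (t * B) * L \<le> 1 / 3"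
  proof -
    have "cmod (t * B) * L = (cmod t * L) * cmod B" by (simp add: norm_mult)
    also have "\<dots> \<le> (1 / 4) * (4 / 3)" using t smB(2) \<open>L > 0\<close> unfolding B_def by (intro mult_mono) auto
    finally show ?thesis by simp
  qed
  have "(\<lambda>M. (t * B) ^ M * G M) \<longlonglongrightarrow> 0"
  proof (rule Lim_null_comparison)
    show "eventually (\<lambda>M. norm ((t * B) ^ M * G M) \<le> (1 / 3) ^ M * (4 / 3)) sequentially"
    proof (intro always_eventually allI)
      fix M
      have "norm ((t * B) ^ M * G M) \<le> cmod (t * B) ^ M * (L ^ M * (4 / 3))"
        unfolding norm_mult norm_power G_def by (intro mult_left_mono smG) (simp add: zero_le_mult_iff)
      also have "\<dots> = (cmod (t * B) * L) ^ M * (4 / 3)" by (simp add: power_mult_distrib)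
      also have "\<dots> \<le> (1 / 3) ^ M * (4 / 3)"
        using tB \<open>L > 0\<close> by (intro mult_right_mono power_mono) auto
      finally show "norm ((t * B) ^ M * G M) \<le> (1 / 3) ^ M * (4 / 3)" .
    qed
    show "(\<lambda>M. (1 / 3) ^ M * (4 / 3) :: real) \<longlonglongrightarrow> 0"
      by (rule tendsto_mult_left_zero) (simp add: LIMSEQ_realpow_zero)
  qed
  then have "(\<lambda>M. G 0 - (t * B) ^ M * G M) \<longlonglongrightarrow> G 0 - 0" by (intro tendsto_diff tendsto_const)
  moreover have "(\<lambda>M. G 0 - (t * B) ^ M * G M) = (\<lambda>M. \<Sum>m<M. \<alpha> m * t ^ m * B ^ Suc m)"
    using part by (metis add_diff_cancel_right')
  ultimately show ?thesis by (simp add: sums_def G_def)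
qed


section \<open>The moment problem for bounded self-adjoint operators\<close>

text \<open>The falling factorial k (k - 1) ... (k - m + 1). The truncated subtraction is harmless:
  for k < m the factor with i = k is already 0.\<close>

definition falling :: "nat \<Rightarrow> nat \<Rightarrow> real" where
  "falling m k = (\<Prod>i<m. real (k - i))"

lemma falling_Suc: "falling (Suc m) k = real k * falling m (k - 1)"
  unfolding falling_def by (subst prod.lessThan_Suc_shift) simp

text \<open>All factors lie in [0, 1], so the two products differ by at most the sum of the
  \<open>m\<close> differences of factors, each of which is at most m / N.\<close>

lemma falling_approx:
  assumes "k \<le> N" "N > 0"
  shows "\<bar>(real k / real N) ^ m - falling m k / real N ^ m\<bar> \<le> (real m)\<^sup>2 / real N"
proof -
  have "\<bar>(\<Prod>i<m. real k / real N) - (\<Prod>i<m. real (k - i) / real N)\<bar>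
      \<le> (\<Sum>i<m. \<bar>real k / real N - real (k - i) / real N\<bar>)"
    using norm_prod_diff[of "{..<m}" "\<lambda>_. real k / real N" "\<lambda>i. real (k - i) / real N"] assms by simp
  also have "\<dots> \<le> (\<Sum>i<m. real m / real N)"
  proof (rule sum_mono)
    fix i assume "i \<in> {..<m}"
    have "\<bar>real k / real N - real (k - i) / real N\<bar> = (real k - real (k - i)) / real N"
      using assms by (simp add: diff_divide_distrib[symmetric])
    also have "\<dots> \<le> real m / real N"
      using \<open>i \<in> {..<m}\<close> by (intro divide_right_mono) auto
    finally show "\<bar>real k / real N - real (k - i) / real N\<bar> \<le> real m / real N" .
  qed
  also have "\<dots> = (real m)\<^sup>2 / real N" by (simp add: power2_eq_square)
  finally show ?thesis by (simp add: falling_def prod_dividef)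
qed

lemma sum_smult: "(\<Sum>i\<in>A. smult c (f i)) = smult c (\<Sum>i\<in>A. f i)"
  by (induction A rule: infinite_finite_induct) (simp_all add: smult_add_right)

text \<open>Factorial moments of the binomial distribution, as an identity of polynomials. Bernstein
  sums reproduce them exactly, whereas power moments are met only up to O(1 / N); the induction uses
  the absorption identity for binomial coefficients.\<close>

lemma sum_falling_Bernstein:
  fixes X Y :: "real poly"
  assumes "X + Y = 1"
  shows "(\<Sum>k\<le>N. smult (real (N choose k) * falling m k) (X ^ k * Y ^ (N - k))) = smult (falling m N) (X ^ m)"
proof (induction m arbitrary: N)
  case 0
  have "(\<Sum>k\<le>N. smult (real (N choose k)) (X ^ k * Y ^ (N - k))) = (X + Y) ^ N"
    by (subst binomial_ring) (simp add: of_nat_poly mult.assoc)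
  then show ?case by (simp add: falling_def assms)
next
  case (Suc m)
  show ?case
  proof (cases N)
    case 0
    then show ?thesis by (simp add: falling_Suc)
  next
    case (Suc M)
    have "(\<Sum>k\<le>Suc M. smult (real (Suc M choose k) * falling (Suc m) k) (X ^ k * Y ^ (Suc M - k)))
        = (\<Sum>k\<le>M. smult (real (Suc M choose Suc k) * falling (Suc m) (Suc k)) (X ^ Suc k * Y ^ (M - k)))"
      by (subst sum.atMost_Suc_shift) (simp add: falling_Suc)
    also have "\<dots> = (\<Sum>k\<le>M. smult (real (Suc M)) (X * smult (real (M choose k) * falling m k) (X ^ k * Y ^ (M - k))))"
    proof (intro sum.cong refl)
      fix k
      have "real (Suc M choose Suc k) * real (Suc k) = real (Suc M) * real (M choose k)"
        unfolding of_nat_mult[symmetric] by (metis Suc_times_binomial mult.commute)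
      then show "smult (real (Suc M choose Suc k) * falling (Suc m) (Suc k)) (X ^ Suc k * Y ^ (M - k))
          = smult (real (Suc M)) (X * smult (real (M choose k) * falling m k) (X ^ k * Y ^ (M - k)))"
        by (simp add: falling_Suc mult.assoc[symmetric] del: of_nat_Suc)
    qed
    also have "\<dots> = smult (real (Suc M)) (X * (\<Sum>k\<le>M. smult (real (M choose k) * falling m k) (X ^ k * Y ^ (M - k))))"
      by (simp only: sum_distrib_left sum_smult)
    also have "\<dots> = smult (falling (Suc m) (Suc M)) (X ^ Suc m)"
      unfolding Suc.IH by (simp add: falling_Suc)
    finally show ?thesis using Suc by simp
  qed
qed

text \<open>
  The values of \<open>L\<close> on the Bernstein polynomials of degree \<open>N\<close> are the
  weights of a probability measure on the points \<open>k / N\<close>, whose moments approximate those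
  prescribed by \<open>L\<close>; a weak limit point solves the problem.
\<close>

lemma Hausdorff_moment_problem:
  fixes L :: "real poly \<Rightarrow> real"
  assumes add: "\<And>p q. L (p + q) = L p + L q" and smult: "\<And>c p. L (smult c p) = c * L p" and "L 1 = 1"
    and pos: "\<And>k l. 0 \<le> L ([:0, 1:] ^ k * [:1, - 1:] ^ l)"
  obtains \<nu> where "prob_space \<nu>" "sets \<nu> = sets borel" "AE x in \<nu>. x \<in> {0..1}"
    "\<And>p. (\<integral>x. poly p x \<partial>\<nu>) = L p"
proof -
  let ?X = "[:0, 1:] :: real poly" and ?Y = "[:1, - 1:] :: real poly"
  have L0: "L 0 = 0" using smult[of 0 0] by simp
  have L_sum: "L (sum f A) = (\<Sum>i\<in>A. L (f i))" for f :: "nat \<Rightarrow> real poly" and A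
    by (induction A rule: infinite_finite_induct) (simp_all add: L0 add)
  define w where "w N k = (if k \<le> N then real (N choose k) * L (?X ^ k * ?Y ^ (N - k)) else 0)" for N k
  have XY: "?X + ?Y = 1" by (simp add: one_pCons)
  have w_nonneg: "0 \<le> w N k" for N k by (simp add: w_def pos)
  have w_falling: "(\<Sum>k\<le>N. w N k * falling m k) = falling m N * L (?X ^ m)" for N m
  proof -
    have "(\<Sum>k\<le>N. w N k * falling m k) = L (\<Sum>k\<le>N. smult (real (N choose k) * falling m k) (?X ^ k * ?Y ^ (N - k)))"
      unfolding L_sum smult by (intro sum.cong) (simp_all add: w_def)
    then show ?thesis unfolding sum_falling_Bernstein[OF XY] smult .
  qed
  have w_sum: "(\<Sum>k\<le>N. w N k) = 1" for N
    using w_falling[of N 0] \<open>L 1 = 1\<close> by (simp add: falling_def)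
  have w_nn: "(\<integral>\<^sup>+k. ennreal (w N k) \<partial>count_space UNIV) = 1" for N
  proof -
    have "(\<integral>\<^sup>+k. ennreal (w N k) \<partial>count_space UNIV) = (\<Sum>k\<le>N. ennreal (w N k))"
      by (rule nn_integral_count_space') (auto simp: w_def)
    also have "\<dots> = ennreal (\<Sum>k\<le>N. w N k)" by (rule sum_ennreal) (rule w_nonneg)
    finally show ?thesis by (simp add: w_sum)
  qed
  define q where "q N = embed_pmf (w N)" for N
  have q: "pmf (q N) k = w N k" for N k
    unfolding q_def by (rule pmf_embed_pmf[OF w_nonneg w_nn])
  \<comment> \<open>Taking the degree N = \<open>Suc n\<close> keeps the grid k / N free of a
    division by zero.\<close>
  define \<mu> where "\<mu> n = distr (measure_pmf (q (Suc n))) borel (\<lambda>k. real k / real (Suc n))" for n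
  have prob: "real_distribution (\<mu> n)" for n
    unfolding real_distribution_def real_distribution_axioms_def \<mu>_def
    by (auto intro!: prob_space.prob_space_distr prob_space_measure_pmf)
  have supp: "k \<le> Suc n" if "k \<in> set_pmf (q (Suc n))" for k n
    using that by (auto simp: set_pmf_iff q w_def split: if_splits)
  have int: "(\<integral>x. f x \<partial>\<mu> n) = (\<Sum>k\<le>Suc n. w (Suc n) k * f (real k / real (Suc n)))"
    if [measurable]: "f \<in> borel_measurable borel" for f :: "real \<Rightarrow> real" and n
  proof -
    have "(\<integral>x. f x \<partial>\<mu> n) = (\<integral>k. f (real k / real (Suc n)) \<partial>measure_pmf (q (Suc n)))"
      unfolding \<mu>_def by (subst integral_distr) auto
    also have "\<dots> = (\<Sum>k\<le>Suc n. f (real k / real (Suc n)) * pmf (q (Suc n)) k)"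
      by (rule integral_measure_pmf_real) (use supp in auto)
    finally show ?thesis by (simp add: q mult.commute)
  qed
  have "tight \<mu>"
    unfolding tight_def
  proof (intro conjI allI impI prob)
    fix \<epsilon> :: real assume "\<epsilon> > 0"
    \<comment> \<open>The interval is open on the left, so it has to start below a possible atom at
      0.\<close>
    have "measure (\<mu> n) {- 1<..2} = 1" for n
    proof -
      interpret real_distribution "\<mu> n" by (rule prob)
      have "AE k in measure_pmf (q (Suc n)). real k / real (Suc n) \<in> {- 1<..2}"
        unfolding AE_measure_pmf_iff
      proof
        fix k assume "k \<in> set_pmf (q (Suc n))"
        then have "k \<le> Suc n" by (rule supp)
        then have "0 \<le> real k / real (Suc n)" "real k / real (Suc n) \<le> 1" by simp_all
        then show "real k / real (Suc n) \<in> {- 1<..2}" unfolding greaterThanAtMost_iff by linarith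
      qed
      then have "AE x in \<mu> n. x \<in> {- 1<..2}"
        unfolding \<mu>_def by (subst AE_distr_iff) auto
      then show ?thesis by (intro prob_eq_1[THEN iffD2]) auto
    qed
    then show "\<exists>a b. a < b \<and> (\<forall>n. 1 - \<epsilon> < measure (\<mu> n) {a<..b})"
      using \<open>\<epsilon> > 0\<close> by (intro exI[of _ "- 1"] exI[of _ 2]) simp
  qed
  then obtain r M where r: "strict_mono r" "real_distribution M" "weak_conv_m (\<mu> \<circ> r) M"
    using tight_imp_convergent_subsubsequence[of \<mu> id] strict_mono_id by auto
  \<comment> \<open>Powers are unbounded on the line, but weak convergence tests bounded continuous
    functions. \<open>clamp\<close> agrees with the identity on [0, 1], which carries every
    \<open>\<mu> n\<close>; the limit \<open>M\<close> is pushed forward by it, so the support of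
    \<open>M\<close> itself need not be determined.\<close>
  define clamp where "clamp x = max 0 (min 1 x)" for x :: real
  have clamp_cont: "isCont (\<lambda>x. clamp x ^ m) x" for x m
    unfolding clamp_def by (intro continuous_intros)
  have clamp_bd: "norm (clamp x ^ m) \<le> 1" for x m
    by (simp add: clamp_def power_le_one)
  have meas [measurable]: "clamp \<in> borel_measurable borel"
    unfolding clamp_def[abs_def] by measurable
  define E where "E n m = (\<integral>x. clamp x ^ m \<partial>\<mu> n)" for n m
  have E: "\<bar>E n m - L (?X ^ m)\<bar> \<le> (1 + \<bar>L (?X ^ m)\<bar>) * (real m)\<^sup>2 / real (Suc n)" for n m
  proof -
    let ?N = "Suc n"
    have "E n m = (\<Sum>k\<le>?N. w ?N k * (real k / real ?N) ^ m)"
      unfolding E_def by (subst int) (auto intro!: sum.cong simp: clamp_def)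
    moreover have "falling m ?N / real ?N ^ m * L (?X ^ m) = (\<Sum>k\<le>?N. w ?N k * (falling m k / real ?N ^ m))"
      by (simp only: times_divide_eq_right times_divide_eq_left sum_divide_distrib[symmetric] w_falling)
    ultimately have "E n m - falling m ?N / real ?N ^ m * L (?X ^ m)
        = (\<Sum>k\<le>?N. w ?N k * ((real k / real ?N) ^ m - falling m k / real ?N ^ m))"
      by (simp add: sum_subtractf right_diff_distrib del: of_nat_Suc)
    also have "\<bar>\<dots>\<bar> \<le> (\<Sum>k\<le>?N. w ?N k * ((real m)\<^sup>2 / real ?N))"
    proof (intro order_trans[OF sum_abs] sum_mono)
      fix k assume "k \<in> {..?N}"
      then show "\<bar>w ?N k * ((real k / real ?N) ^ m - falling m k / real ?N ^ m)\<bar> \<le> w ?N k * ((real m)\<^sup>2 / real ?N)"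
        unfolding abs_mult abs_of_nonneg[OF w_nonneg] by (intro mult_left_mono falling_approx w_nonneg) auto
    qed
    also have "\<dots> = (real m)\<^sup>2 / real ?N" by (simp only: sum_distrib_right[symmetric] w_sum mult_1)
    finally have 1: "\<bar>E n m - falling m ?N / real ?N ^ m * L (?X ^ m)\<bar> \<le> (real m)\<^sup>2 / real ?N" .
    \<comment> \<open>The case k = N of \<open>falling_approx\<close>: the normalizing factor of the
      exact factorial moments tends to 1 at the same rate.\<close>
    have "\<bar>1 - falling m ?N / real ?N ^ m\<bar> \<le> (real m)\<^sup>2 / real ?N"
      using falling_approx[of ?N ?N m] by simp
    then have "\<bar>L (?X ^ m)\<bar> * \<bar>1 - falling m ?N / real ?N ^ m\<bar> \<le> \<bar>L (?X ^ m)\<bar> * ((real m)\<^sup>2 / real ?N)"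
      by (intro mult_left_mono) simp_all
    then have "\<bar>falling m ?N / real ?N ^ m * L (?X ^ m) - L (?X ^ m)\<bar> \<le> \<bar>L (?X ^ m)\<bar> * ((real m)\<^sup>2 / real ?N)"
      by (simp add: abs_mult[symmetric] algebra_simps abs_minus_commute del: of_nat_Suc)
    then have "\<bar>E n m - L (?X ^ m)\<bar> \<le> (real m)\<^sup>2 / real ?N + \<bar>L (?X ^ m)\<bar> * ((real m)\<^sup>2 / real ?N)"
      using 1 by linarith
    then show ?thesis by (simp add: add_divide_distrib distrib_right del: of_nat_Suc)
  qed
  have E_lim: "(\<lambda>n. E n m) \<longlonglongrightarrow> L (?X ^ m)" for m
  proof -
    have "(\<lambda>n. (1 + \<bar>L (?X ^ m)\<bar>) * (real m)\<^sup>2 / real (Suc n)) \<longlonglongrightarrow> 0"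
      by (rule LIMSEQ_Suc[OF lim_const_over_n])
    then have "(\<lambda>n. E n m - L (?X ^ m)) \<longlonglongrightarrow> 0"
      by (rule Lim_null_comparison[rotated]) (simp add: E del: of_nat_Suc)
    then show ?thesis by (rule LIM_zero_cancel)
  qed
  have mom: "(\<integral>x. clamp x ^ m \<partial>M) = L (?X ^ m)" for m
  proof -
    have "(\<lambda>n. \<integral>x. clamp x ^ m \<partial>((\<mu> \<circ> r) n)) \<longlonglongrightarrow> (\<integral>x. clamp x ^ m \<partial>M)"
      by (rule weak_conv_imp_integral_bdd_continuous_conv[OF _ r(2,3) clamp_cont clamp_bd]) (simp add: prob)
    moreover have "(\<lambda>n. \<integral>x. clamp x ^ m \<partial>((\<mu> \<circ> r) n)) \<longlonglongrightarrow> L (?X ^ m)"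
      using LIMSEQ_subseq_LIMSEQ[OF E_lim r(1), of m] by (simp add: E_def o_def)
    ultimately show ?thesis by (rule LIMSEQ_unique)
  qed
  interpret M: real_distribution M by (rule r)
  define \<nu> where "\<nu> = distr M borel clamp"
  show ?thesis
  proof
    show "prob_space \<nu>" unfolding \<nu>_def by (rule M.prob_space_distr) simp
    show "sets \<nu> = sets borel" by (simp add: \<nu>_def)
    show "AE x in \<nu>. x \<in> {0..1}"
      unfolding \<nu>_def by (subst AE_distr_iff) (auto simp: clamp_def)
    have poly_L: "L p = (\<Sum>i\<le>degree p. coeff p i * L (?X ^ i))" for p
    proof -
      have "p = (\<Sum>i\<le>degree p. smult (coeff p i) (?X ^ i))"
        by (subst poly_as_sum_of_monoms[of p, symmetric]) (simp add: monom_altdef)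
      then have "L p = L (\<Sum>i\<le>degree p. smult (coeff p i) (?X ^ i))" by simp
      then show ?thesis by (simp add: L_sum smult)
    qed
    have integ: "integrable M (\<lambda>x. c * clamp x ^ i)" for c i
      by (rule M.integrable_const_bound[of _ "\<bar>c\<bar>"])
        (use mult_left_mono[OF clamp_bd] in \<open>auto simp: abs_mult\<close>)
    show "(\<integral>x. poly p x \<partial>\<nu>) = L p" for p
    proof -
      have "(\<integral>x. poly p x \<partial>\<nu>) = (\<integral>x. (\<Sum>i\<le>degree p. coeff p i * clamp x ^ i) \<partial>M)"
        unfolding \<nu>_def poly_altdef by (subst integral_distr) simp_all
      also have "\<dots> = (\<Sum>i\<le>degree p. \<integral>x. coeff p i * clamp x ^ i \<partial>M)"
        by (rule Bochner_Integration.integral_sum) (rule integ)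
      also have "\<dots> = (\<Sum>i\<le>degree p. coeff p i * L (?X ^ i))" by (simp add: mom)
      finally show ?thesis by (simp add: poly_L[of p])
    qed
  qed
qed

lemma pcompose_power: "pcompose (p ^ n) q = pcompose p q ^ n"
  for p q :: "real poly"
  by (induction n) (simp_all add: pcompose_1 pcompose_mult)

text \<open>If \<open>K\<close> bounds the quadratic form of \<open>A\<close>, then r(A) = (1 +
  A/K)/2 and s(A) = (1 - A/K)/2 are positive with sum 1. The functional sending p to the expectation
  of p(r(A)) thus satisfies the Hausdorff conditions, and its measure on [0, 1] is carried to
  [-K, K] by y |-> 2 K y - K, the inverse of \<open>r\<close>.\<close>

lemma selfadjoint_has_distribution:
  assumes sa: "selfadjoint A" and "norm \<xi> = 1"
  shows "\<exists>\<rho>. has_distribution \<xi> A \<rho>"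
proof -
  note bl = selfadjoint_bounded_clinear[OF sa]
  note lin = bounded_clinear_linear[OF bl]
  obtain K where K: "K > 0" "\<And>h. norm (A h) \<le> norm h * K"
    using bounded_linear.pos_bounded[OF bounded_clinear_bounded_linear[OF bl]] by blast
  have quad: "\<bar>Re (cinner (A h) h)\<bar> \<le> K * (norm h)\<^sup>2" for h
  proof -
    have "\<bar>Re (cinner (A h) h)\<bar> \<le> cmod (cinner (A h) h)" by (rule abs_Re_le_cmod)
    also have "\<dots> \<le> norm (A h) * norm h" by (rule cinner_Cauchy_Schwarz)
    also have "\<dots> \<le> (norm h * K) * norm h" using K by (intro mult_right_mono) simp_all
    finally show ?thesis by (simp add: power2_eq_square mult_ac)
  qed
  define r where "r = [:1 / 2, 1 / (2 * K):]"
  define s where "s = [:1 / 2, - (1 / (2 * K)):]"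
  have rs: "r + s = 1" by (simp add: r_def s_def one_pCons)
  define L where "L p = Re (cinner (opoly A (pcompose p r) \<xi>) \<xi>)" for p
  have r_pos: "0 \<le> Re (cinner (opoly A r h) h)" and s_pos: "0 \<le> Re (cinner (opoly A s h) h)" for h
  proof -
    have "Re (cinner (opoly A r h) h) = (norm h)\<^sup>2 / 2 + Re (cinner (A h) h) / (2 * K)"
      "Re (cinner (opoly A s h) h) = (norm h)\<^sup>2 / 2 - Re (cinner (A h) h) / (2 * K)"
      by (simp_all add: r_def s_def opoly_pCons lin linear_0 linear_scale cinner_add_left cinner.scaleR_left
          cinner_self cinner.minus_left cinner.diff_left linear_neg)
    moreover have "\<bar>Re (cinner (A h) h) / (2 * K)\<bar> \<le> (norm h)\<^sup>2 / 2"
      using quad[of h] K(1) by (simp add: field_simps)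
    ultimately show "0 \<le> Re (cinner (opoly A r h) h)" "0 \<le> Re (cinner (opoly A s h) h)" by linarith+
  qed
  have sq: "cinner (opoly A (p * p * t) h) h = cinner (opoly A t (opoly A p h)) (opoly A p h)" for p t h
  proof -
    have "cinner (opoly A (p * p * t) h) h = cinner (opoly A (p * (t * p)) h) h" by (simp add: mult_ac)
    then show ?thesis by (simp add: opoly_mult lin selfadjoint_opoly[OF sa])
  qed
  have one_pos: "0 \<le> Re (cinner (opoly A 1 h) h)" for h by (simp add: opoly_1 lin cinner_self)
  have rs_pos: "0 \<le> Re (cinner (opoly A (r * s) h) h)" for h
  proof -
    \<comment> \<open>Multiplying by r + s = 1 writes r s as r^2 s + s^2 r, squares times positive
      operators, so no operator square root is needed.\<close>
    have "r * s = r * s * (r + s)" by (simp add: rs)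
    then have "r * s = r * r * s + s * s * r" by (simp add: algebra_simps)
    then have "cinner (opoly A (r * s) h) h = cinner (opoly A (r * r * s) h) h + cinner (opoly A (s * s * r) h) h"
      by (metis cinner_add_left lin opoly_add)
    then show ?thesis by (simp add: sq r_pos s_pos)
  qed
  have pos: "0 \<le> Re (cinner (opoly A (r ^ k * s ^ l) \<xi>) \<xi>)" for k l
  proof -
    \<comment> \<open>Even powers go into a square; the remaining exponents are 0 or 1, which leaves
      the four cases 1, r, s and r s.\<close>
    have "r ^ k * s ^ l = (r ^ (k div 2) * s ^ (l div 2)) * (r ^ (k div 2) * s ^ (l div 2)) * (r ^ (k mod 2) * s ^ (l mod 2))"
    proof -
      have e: "x ^ k = x ^ (k div 2) * x ^ (k div 2) * x ^ (k mod 2)" for x :: "real poly" and k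
        by (metis mult_2 mult_div_mod_eq power_add)
      show ?thesis by (subst e[of r k], subst e[of s l]) (simp add: mult_ac)
    qed
    moreover have "0 \<le> Re (cinner (opoly A (r ^ (k mod 2) * s ^ (l mod 2)) h) h)" for h
      using r_pos s_pos rs_pos one_pos by (cases "even k"; cases "even l") (simp_all add: even_iff_mod_2_eq_zero odd_iff_mod_2_eq_one)
    ultimately show ?thesis by (simp add: sq)
  qed
  obtain \<nu> where \<nu>: "prob_space \<nu>" "sets \<nu> = sets borel" "AE x in \<nu>. x \<in> {0..1}" "\<And>p. (\<integral>x. poly p x \<partial>\<nu>) = L p"
  proof (rule Hausdorff_moment_problem)
    show "L (p + q) = L p + L q" for p q
      by (simp add: L_def pcompose_add opoly_add lin cinner_add_left)
    show "L (smult c p) = c * L p" for c p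
      by (simp add: L_def pcompose_smult opoly_smult lin cinner.scaleR_left)
    show "L 1 = 1" using \<open>norm \<xi> = 1\<close> by (simp add: L_def pcompose_1 opoly_1 lin cinner_self)
    show "0 \<le> L ([:0, 1:] ^ k * [:1, - 1:] ^ l)" for k l
    proof -
      have "pcompose [:1, - 1:] r = s" by (simp add: pcompose_pCons r_def s_def one_pCons)
      moreover have "pcompose [:0, 1:] r = r" by (simp add: pcompose_pCons)
      ultimately show ?thesis using pos by (simp add: L_def pcompose_mult pcompose_power)
    qed
  qed (rule that)
  interpret \<nu>: prob_space \<nu> by (rule \<nu>)
  define f where "f y = 2 * K * y - K" for y :: real
  have fm [measurable]: "f \<in> borel_measurable borel" unfolding f_def[abs_def] by measurable
  have fm' [measurable]: "f \<in> \<nu> \<rightarrow>\<^sub>M borel" using fm \<nu>(2) measurable_cong_sets by blast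
  define \<rho> where "\<rho> = distr \<nu> borel f"
  have "compactly_supported_prob \<rho>"
    unfolding compactly_supported_prob_def
  proof (intro conjI exI[of _ "{- K..K}"])
    show "prob_space \<rho>" unfolding \<rho>_def by (rule \<nu>.prob_space_distr) simp
    have "AE y in \<nu>. f y \<in> {- K..K}"
      using \<nu>(3)
    proof eventually_elim
      case (elim y)
      then have "0 \<le> 2 * K * y" "2 * K * y \<le> 2 * K * 1"
        using K(1) by (auto intro: mult_nonneg_nonneg mult_left_mono)
      then show ?case by (simp add: f_def)
    qed
    then show "AE x in \<rho>. x \<in> {- K..K}" unfolding \<rho>_def by (subst AE_distr_iff) auto
  qed (simp_all add: \<rho>_def)
  moreover have "complex_of_real (\<integral>x. x ^ n \<partial>\<rho>) = vstate \<xi> (A ^^ n)" for n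
  proof -
    have "(\<integral>x. x ^ n \<partial>\<rho>) = (\<integral>y. poly ([:- K, 2 * K:] ^ n) y \<partial>\<nu>)"
      unfolding \<rho>_def poly_power by (subst integral_distr) (simp_all add: f_def algebra_simps)
    also have "\<dots> = L ([:- K, 2 * K:] ^ n)" by (rule \<nu>)
    also have "pcompose ([:- K, 2 * K:] ^ n) r = [:0, 1:] ^ n"
    proof -
      have "pcompose [:- K, 2 * K:] r = [:0, 1:]" using K(1) by (simp add: pcompose_pCons r_def)
      then show ?thesis by (simp add: pcompose_power)
    qed
    then have "L ([:- K, 2 * K:] ^ n) = Re (cinner ((A ^^ n) \<xi>) \<xi>)"
      by (simp add: L_def opoly_X_power lin)
    finally have "(\<integral>x. x ^ n \<partial>\<rho>) = Re (cinner ((A ^^ n) \<xi>) \<xi>)" .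
    \<comment> \<open>\<open>L\<close> was defined through real parts; self-adjointness shows that
      nothing was lost.\<close>
    moreover have "cinner ((A ^^ n) \<xi>) \<xi> = cnj (cinner ((A ^^ n) \<xi>) \<xi>)"
      using selfadjoint_funpow_cinner[OF sa, of n \<xi> \<xi>] by (metis cinner_commute)
    then have "Im (cinner ((A ^^ n) \<xi>) \<xi>) = 0" by (metis Reals_cnj_iff complex_is_Real_iff)
    ultimately show ?thesis by (simp add: vstate_def complex_eq_iff)
  qed
  ultimately show ?thesis unfolding has_distribution_def by blast
qed


section \<open>Cauchy transforms\<close>

definition upper :: "complex set" where
  "upper = {z. Im z > 0}"

lemma open_upper: "open upper"
  unfolding upper_def by (rule open_halfspace_Im_gt)

lemma convex_upper: "convex upper"
  unfolding upper_def by (rule convex_halfspace_Im_gt)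

lemma Im_le_norm_resolvent: "Im z \<le> cmod (z - complex_of_real x)"
  using abs_Im_le_cmod[of "z - complex_of_real x"] by simp

lemma resolvent_nonzero: "z \<in> upper \<Longrightarrow> z - complex_of_real x \<noteq> 0"
  by (auto simp: upper_def complex_eq_iff)

lemma norm_resolvent_le: "z \<in> upper \<Longrightarrow> cmod (1 / (z - complex_of_real x)) \<le> 1 / Im z"
  using Im_le_norm_resolvent[of z x] by (auto simp: upper_def norm_divide intro!: frac_le)

context
  fixes \<mu> :: "real measure"
  assumes prob: "prob_space \<mu>" and sets: "sets \<mu> = sets borel"
begin

interpretation prob_space \<mu> by (rule prob)

lemma measurable_borel: "f \<in> borel_measurable borel \<Longrightarrow> f \<in> borel_measurable \<mu>"
  using sets measurable_cong_sets by blast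

lemma integrable_resolvent: "z \<in> upper \<Longrightarrow> integrable \<mu> (\<lambda>x. 1 / (z - complex_of_real x))"
  by (rule integrable_const_bound[of _ "1 / Im z"])
    (auto intro!: measurable_borel AE_I2 norm_resolvent_le)

text \<open>The difference quotient of the resolvent minus its derivative is (w - z) / ((w - x) (z -
  x)^2). If |w - z| < Im z / 2, then Im w > Im z / 2, so this is bounded uniformly in
  \<open>x\<close> by a constant times |w - z|, and the estimate may be integrated.\<close>

lemma holomorphic_cauchy_transform: "cauchy_transform \<mu> holomorphic_on upper"
proof (rule holomorphic_onI)
  fix z assume z: "z \<in> upper"
  let ?y = "Im z / 2"
  have y: "?y > 0" using z by (simp add: upper_def)
  define D where "D = (\<integral>x. - (1 / (z - complex_of_real x))\<^sup>2 \<partial>\<mu>)"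
  have intD: "integrable \<mu> (\<lambda>x. - (1 / (z - complex_of_real x))\<^sup>2)"
  proof (rule integrable_const_bound[of _ "(1 / Im z)\<^sup>2"])
    show "AE x in \<mu>. norm (- (1 / (z - complex_of_real x))\<^sup>2) \<le> (1 / Im z)\<^sup>2"
      unfolding norm_minus_cancel norm_power by (intro AE_I2 power_mono norm_resolvent_le z) simp
  qed (auto intro!: measurable_borel)
  have est: "norm ((cauchy_transform \<mu> w - cauchy_transform \<mu> z) / (w - z) - D) \<le> norm (w - z) * (2 / Im z * (1 / Im z)\<^sup>2)"
    if w: "dist w z < ?y" "w \<noteq> z" for w
  proof -
    have Im: "Im w > ?y"
      using abs_Im_le_cmod[of "w - z"] w y by (simp add: dist_norm)
    then have wu: "w \<in> upper" using y by (simp add: upper_def)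
    have "(cauchy_transform \<mu> w - cauchy_transform \<mu> z) / (w - z) - D
        = (\<integral>x. (1 / (w - complex_of_real x) - 1 / (z - complex_of_real x)) / (w - z) - - (1 / (z - complex_of_real x))\<^sup>2 \<partial>\<mu>)"
    proof -
      let ?q = "\<lambda>x. (1 / (w - complex_of_real x) - 1 / (z - complex_of_real x)) / (w - z)"
      have i: "integrable \<mu> (\<lambda>x. 1 / (w - complex_of_real x) - 1 / (z - complex_of_real x))"
        by (intro Bochner_Integration.integrable_diff integrable_resolvent wu z)
      then have "integrable \<mu> ?q" by simp
      then have "(\<integral>x. ?q x - - (1 / (z - complex_of_real x))\<^sup>2 \<partial>\<mu>) = integral\<^sup>L \<mu> ?q - D"
        unfolding D_def by (rule Bochner_Integration.integral_diff) (rule intD)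
      moreover have "integral\<^sup>L \<mu> ?q = (cauchy_transform \<mu> w - cauchy_transform \<mu> z) / (w - z)"
        unfolding cauchy_transform_def
        by (simp only: integral_divide_zero
            Bochner_Integration.integral_diff[OF integrable_resolvent[OF wu] integrable_resolvent[OF z]])
      ultimately show ?thesis by (simp only:)
    qed
    also have "\<dots> = (\<integral>x. (w - z) * (1 / (w - complex_of_real x)) * (1 / (z - complex_of_real x))\<^sup>2 \<partial>\<mu>)"
    proof (rule Bochner_Integration.integral_cong[OF refl])
      fix x
      have "w - complex_of_real x \<noteq> 0" "z - complex_of_real x \<noteq> 0" "w - z \<noteq> 0"
        using resolvent_nonzero wu z w by auto
      then show "(1 / (w - complex_of_real x) - 1 / (z - complex_of_real x)) / (w - z) - - (1 / (z - complex_of_real x))\<^sup>2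
          = (w - z) * (1 / (w - complex_of_real x)) * (1 / (z - complex_of_real x))\<^sup>2"
        by (simp add: divide_simps power2_eq_square) (simp add: algebra_simps)
    qed
    also have "norm \<dots> \<le> (\<integral>x. norm (w - z) * (2 / Im z * (1 / Im z)\<^sup>2) \<partial>\<mu>)"
    proof (rule Bochner_Integration.integral_norm_bound_integral)
      show b: "norm ((w - z) * (1 / (w - complex_of_real x)) * (1 / (z - complex_of_real x))\<^sup>2)
          \<le> norm (w - z) * (2 / Im z * (1 / Im z)\<^sup>2)" for x
      proof -
        have "cmod (1 / (w - complex_of_real x)) \<le> 1 / Im w" by (rule norm_resolvent_le[OF wu])
        also have "\<dots> \<le> 1 / ?y" using Im y by (intro divide_left_mono) auto
        finally have "cmod (1 / (w - complex_of_real x)) \<le> 2 / Im z" by simp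
        moreover have "cmod (1 / (z - complex_of_real x)) ^ 2 \<le> (1 / Im z)\<^sup>2"
          by (intro power_mono norm_resolvent_le z) simp
        moreover have "0 \<le> 2 / Im z" using y by simp
        ultimately show ?thesis unfolding norm_mult norm_power mult.assoc
          by (intro mult_left_mono mult_mono) auto
      qed
      show "integrable \<mu> (\<lambda>x. (w - z) * (1 / (w - complex_of_real x)) * (1 / (z - complex_of_real x))\<^sup>2)"
        by (rule integrable_const_bound[OF AE_I2, OF b]) (auto intro!: measurable_borel)
    qed simp
    finally show ?thesis by (simp add: prob_space)
  qed
  have "((\<lambda>w. norm (w - z) * (2 / Im z * (1 / Im z)\<^sup>2)) \<longlongrightarrow> 0) (at z)"
    using y by (auto intro!: tendsto_eq_intros)
  then have "((\<lambda>w. (cauchy_transform \<mu> w - cauchy_transform \<mu> z) / (w - z) - D) \<longlongrightarrow> 0) (at z)"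
  proof (rule Lim_null_comparison[rotated])
    show "eventually (\<lambda>w. norm ((cauchy_transform \<mu> w - cauchy_transform \<mu> z) / (w - z) - D)
        \<le> norm (w - z) * (2 / Im z * (1 / Im z)\<^sup>2)) (at z)"
      unfolding eventually_at using est y by (intro exI[of _ ?y]) auto
  qed
  then have "(cauchy_transform \<mu> has_field_derivative D) (at z)"
    unfolding has_field_derivative_iff by (rule LIM_zero_cancel)
  then show "cauchy_transform \<mu> field_differentiable at z within upper"
    unfolding field_differentiable_def using has_field_derivative_at_within by blast
qed

lemma Im_resolvent: "Im (1 / (z - complex_of_real x)) = - Im z / (cmod (z - complex_of_real x))\<^sup>2"
  by (simp add: Im_divide cmod_power2)

text \<open>The integrand has a strict sign at every point, so a vanishing integral would contradict
  total mass 1. The strictness makes 1 / G well defined and a map of the upper half plane into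
  itself, so that reciprocal Cauchy transforms can be composed.\<close>

lemma Im_cauchy_transform: "z \<in> upper \<Longrightarrow> Im (cauchy_transform \<mu> z) < 0"
proof -
  assume z: "z \<in> upper"
  have i: "integrable \<mu> (\<lambda>x. - Im (1 / (z - complex_of_real x)))"
    using integrable_resolvent[OF z] by simp
  have pos: "- Im (1 / (z - complex_of_real x)) > 0" for x
    using z resolvent_nonzero[OF z, of x] by (simp only: Im_resolvent) (simp add: upper_def)
  have "(\<integral>x. - Im (1 / (z - complex_of_real x)) \<partial>\<mu>) > 0"
  proof (rule ccontr)
    assume "\<not> ?thesis"
    moreover have "(\<integral>x. - Im (1 / (z - complex_of_real x)) \<partial>\<mu>) \<ge> 0"
      using pos by (intro integral_nonneg_AE AE_I2) (simp add: less_imp_le)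
    ultimately have "(\<integral>x. - Im (1 / (z - complex_of_real x)) \<partial>\<mu>) = 0" by simp
    then have "AE x in \<mu>. - Im (1 / (z - complex_of_real x)) = 0"
      using integral_nonneg_eq_0_iff_AE[OF i] pos by (simp add: less_imp_le)
    then have "AE x in \<mu>. False"
    proof eventually_elim
      case (elim x)
      then show ?case using pos[of x] by simp
    qed
    then show False by simp
  qed
  moreover have "Im (cauchy_transform \<mu> z) = - (\<integral>x. - Im (1 / (z - complex_of_real x)) \<partial>\<mu>)"
    unfolding cauchy_transform_def using integrable_resolvent[OF z] by (simp add: integral_Im)
  ultimately show ?thesis by simp
qed

lemma cauchy_transform_nonzero: "z \<in> upper \<Longrightarrow> cauchy_transform \<mu> z \<noteq> 0"
  using Im_cauchy_transform[of z] by auto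

lemma reciprocal_cauchy_upper: "z \<in> upper \<Longrightarrow> reciprocal_cauchy \<mu> z \<in> upper"
  using Im_cauchy_transform[of z] cauchy_transform_nonzero[of z]
  by (simp add: reciprocal_cauchy_def upper_def Im_divide cmod_power2[symmetric] divide_neg_pos)

lemma holomorphic_reciprocal_cauchy: "reciprocal_cauchy \<mu> holomorphic_on upper"
  unfolding reciprocal_cauchy_def[abs_def]
  by (intro holomorphic_intros holomorphic_cauchy_transform) (simp add: cauchy_transform_nonzero)

lemma cauchy_transform_series:
  assumes R: "AE x in \<mu>. \<bar>x\<bar> \<le> R" and z: "cmod z > R" "R \<ge> 0"
  shows "(\<lambda>n. complex_of_real (\<integral>x. x ^ n \<partial>\<mu>) / z ^ Suc n) sums cauchy_transform \<mu> z"
proof -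
  let ?f = "\<lambda>n x. complex_of_real (x ^ n) / z ^ Suc n"
  have z0: "z \<noteq> 0" using z by auto
  have nf: "norm (?f n x) = \<bar>x\<bar> ^ n / cmod z ^ Suc n" for n x
    by (simp add: norm_divide norm_power power_abs norm_mult)
  have b: "AE x in \<mu>. norm (?f n x) \<le> R ^ n / cmod z ^ Suc n" for n
    using R
  proof eventually_elim
    case (elim x)
    show ?case unfolding nf by (intro divide_right_mono power_mono elim) auto
  qed
  have i: "integrable \<mu> (?f n)" for n
    by (rule integrable_const_bound[OF b]) (auto intro!: measurable_borel)
  have geo: "summable (\<lambda>n. R ^ n / cmod z ^ Suc n)"
  proof -
    have "R / cmod z < 1" using z0 z by (subst divide_less_eq_1_pos) simp_all
    then have "summable (\<lambda>n. (1 / cmod z) * (R / cmod z) ^ n)"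
      using z by (intro summable_mult summable_geometric) simp
    then show ?thesis by (simp add: power_divide)
  qed
  have "(\<lambda>n. integral\<^sup>L \<mu> (?f n)) sums (\<integral>x. (\<Sum>n. ?f n x) \<partial>\<mu>)"
  proof (rule sums_integral[OF i])
    show "AE x in \<mu>. summable (\<lambda>n. norm (?f n x))"
      using R
    proof eventually_elim
      case (elim x)
      show ?case
      proof (rule summable_comparison_test'[OF geo])
        show "norm (norm (?f n x)) \<le> R ^ n / cmod z ^ Suc n" for n
          using divide_right_mono[OF power_mono[OF elim abs_ge_zero, of n], of "cmod z ^ Suc n"]
          by (simp only: nf) simp
      qed
    qed
    have "(\<integral>x. norm (?f n x) \<partial>\<mu>) \<le> R ^ n / cmod z ^ Suc n" for n
    proof -
      have "(\<integral>x. norm (?f n x) \<partial>\<mu>) \<le> (\<integral>x. R ^ n / cmod z ^ Suc n \<partial>\<mu>)"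
        using b[of n] by (intro integral_mono_AE integrable_norm i) auto
      then show ?thesis by (simp add: prob_space)
    qed
    then show "summable (\<lambda>n. \<integral>x. norm (?f n x) \<partial>\<mu>)"
      by (intro summable_comparison_test'[OF geo]) simp
  qed
  also have "(\<integral>x. (\<Sum>n. ?f n x) \<partial>\<mu>) = cauchy_transform \<mu> z"
    unfolding cauchy_transform_def
  proof (rule integral_cong_AE)
    show "AE x in \<mu>. (\<Sum>n. ?f n x) = 1 / (z - complex_of_real x)"
      using R
    proof eventually_elim
      case (elim x)
      have "\<bar>x\<bar> / cmod z < 1" using elim z z0 by (subst divide_less_eq_1_pos) auto
      then have "norm (complex_of_real x / z) < 1" by (simp add: norm_divide)
      then have "(\<lambda>n. (1 / z) * (complex_of_real x / z) ^ n) sums ((1 / z) * (1 / (1 - complex_of_real x / z)))"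
        by (intro sums_mult geometric_sums)
      moreover have "(\<lambda>n. (1 / z) * (complex_of_real x / z) ^ n) = (\<lambda>n. ?f n x)"
        by (simp add: power_divide)
      moreover have "(1 / z) * (1 / (1 - complex_of_real x / z)) = 1 / (z - complex_of_real x)"
        using z0 by (simp add: divide_simps)
      ultimately show ?case by (simp only: sums_iff)
    qed
  next
    have "(\<lambda>x. \<Sum>n. ?f n x) \<in> borel_measurable borel" by measurable
    then show "(\<lambda>x. \<Sum>n. ?f n x) \<in> borel_measurable \<mu>" by (rule measurable_borel)
    show "(\<lambda>x. 1 / (z - complex_of_real x)) \<in> borel_measurable \<mu>" by (rule measurable_borel) measurable
  qed
  also have "(\<lambda>n. integral\<^sup>L \<mu> (?f n)) = (\<lambda>n. complex_of_real (\<integral>x. x ^ n \<partial>\<mu>) / z ^ Suc n)"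
    by (simp only: integral_divide_zero integral_complex_of_real)
  finally show ?thesis .
qed

text \<open>Read for F = 1 / G, this gives |F(z)| >= |z| - R. It keeps F_\<nu>(z) in the region
  where the moment series of G_\<mu> converges.\<close>

lemma norm_cauchy_transform_le:
  assumes R: "AE x in \<mu>. \<bar>x\<bar> \<le> R" and z: "z \<in> upper" "cmod z > R"
  shows "cmod (cauchy_transform \<mu> z) \<le> 1 / (cmod z - R)"
proof -
  have "cmod (cauchy_transform \<mu> z) \<le> (\<integral>x. norm (1 / (z - complex_of_real x)) \<partial>\<mu>)"
    unfolding cauchy_transform_def by (rule integral_norm_bound)
  also have "\<dots> \<le> (\<integral>x. 1 / (cmod z - R) \<partial>\<mu>)"
  proof (rule integral_mono_AE)
    show "AE x in \<mu>. norm (1 / (z - complex_of_real x)) \<le> 1 / (cmod z - R)"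
      using R
    proof eventually_elim
      case (elim x)
      have "cmod z - R \<le> cmod (z - complex_of_real x)"
        using norm_triangle_ineq2[of z "complex_of_real x"] elim by simp
      then show ?case using z by (simp add: norm_divide frac_le)
    qed
  qed (use integrable_norm[OF integrable_resolvent[OF z(1)]] in auto)
  finally show ?thesis by (simp add: prob_space)
qed

end

lemma compactly_supported_bound:
  assumes "compactly_supported_prob \<mu>"
  obtains R where "R > 0" "AE x in \<mu>. \<bar>x\<bar> \<le> R"
proof -
  obtain K where K: "compact K" "AE x in \<mu>. x \<in> K"
    using assms unfolding compactly_supported_prob_def by blast
  then obtain R where R: "R > 0" "\<forall>x\<in>K. norm x \<le> R"
    using compact_imp_bounded bounded_pos by blast
  have "AE x in \<mu>. \<bar>x\<bar> \<le> R" using K(2) by (rule eventually_mono) (use R(2) in auto)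
  then show ?thesis using that R(1) by blast
qed

lemma compactly_supportedD:
  assumes "compactly_supported_prob \<mu>"
  shows "prob_space \<mu>" "sets \<mu> = sets borel"
  using assms unfolding compactly_supported_prob_def by auto


subsection \<open>The Cauchy transform determines the measure\<close>

text \<open>
  The function \<open>x \<mapsto> - Im G(x + iy)\<close> is the convolution of the measure with a Poisson kernel; its Fourier
  transform is the characteristic function times that of the Poisson kernel, and the latter is
  nonzero when the width \<open>y\<close> of the kernel is small.
\<close>

definition Poisson_kernel :: "real \<Rightarrow> real \<Rightarrow> real" where
  "Poisson_kernel y x = y / (x\<^sup>2 + y\<^sup>2)"

lemma Im_resolvent_Poisson: "Im (1 / (Complex x y - complex_of_real u)) = - Poisson_kernel y (x - u)"
  by (simp add: Im_divide Poisson_kernel_def)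

lemma integrable_inverse_square: "integrable lborel (\<lambda>x :: real. inverse (1 + x\<^sup>2))"
  and integral_inverse_square: "(\<integral>x. inverse (1 + x\<^sup>2) \<partial>lborel) = pi"
  using integrable_inverse_1_plus_square LBINT_inverse_1_plus_square
  by (simp_all add: set_integrable_def interval_lebesgue_integral_def set_lebesgue_integral_def)

lemma Poisson_kernel_scale: "y > 0 \<Longrightarrow> y * Poisson_kernel y (y * s) = inverse (1 + s\<^sup>2)"
proof -
  assume y: "y > 0"
  have "(y * s)\<^sup>2 + y\<^sup>2 = (y * y) * (1 + s\<^sup>2)" by (simp add: power2_eq_square algebra_simps)
  then have "y * Poisson_kernel y (y * s) = (y * y) / ((y * y) * (1 + s\<^sup>2))"
    by (simp add: Poisson_kernel_def)
  then show ?thesis using y by (simp add: inverse_eq_divide)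
qed

lemma integrable_Poisson_kernel: "y > 0 \<Longrightarrow> integrable lborel (Poisson_kernel y)"
proof -
  assume y: "y > 0"
  have "integrable lborel (\<lambda>s. inverse (1 + s\<^sup>2) / y)" using integrable_inverse_square by simp
  moreover have "inverse (1 + s\<^sup>2) / y = Poisson_kernel y (0 + y * s)" for s
    using Poisson_kernel_scale[OF y, of s] y by (simp add: nonzero_divide_eq_eq mult.commute)
  ultimately have "integrable lborel (\<lambda>s. Poisson_kernel y (0 + y * s))" by simp
  then show ?thesis using lborel_integrable_real_affine_iff[of y "Poisson_kernel y" 0] y by simp
qed

lemma Poisson_kernel_nonneg: "y > 0 \<Longrightarrow> 0 \<le> Poisson_kernel y x"
  by (simp add: Poisson_kernel_def)

definition Poisson_Fourier :: "real \<Rightarrow> real \<Rightarrow> complex" where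
  "Poisson_Fourier y t = (\<integral>x. Poisson_kernel y x *\<^sub>R iexp (t * x) \<partial>lborel)"

text \<open>After the substitution x = y s only the limit y -> 0 is taken. By dominated convergence
  it is pi, the kernel having no factor 1 / pi, so the closed form pi exp (- y |t|) is not computed.
  The width may depend on \<open>t\<close>, since characteristic functions are compared one
  \<open>t\<close> at a time.\<close>

lemma Poisson_Fourier_nonzero: "\<exists>y>0. Poisson_Fourier y t \<noteq> 0"
proof -
  have eq: "Poisson_Fourier y t = (\<integral>s. inverse (1 + s\<^sup>2) *\<^sub>R iexp (t * (y * s)) \<partial>lborel)" if "y > 0" for y
  proof -
    have "Poisson_Fourier y t = \<bar>y\<bar> *\<^sub>R (\<integral>s. Poisson_kernel y (0 + y * s) *\<^sub>R iexp (t * (0 + y * s)) \<partial>lborel)"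
      unfolding Poisson_Fourier_def using that by (intro lborel_integral_real_affine) simp
    also have "\<dots> = (\<integral>s. (y * Poisson_kernel y (y * s)) *\<^sub>R iexp (t * (y * s)) \<partial>lborel)"
      using that by (simp flip: integral_scaleR_right)
    finally show ?thesis by (simp add: Poisson_kernel_scale[OF that])
  qed
  let ?y = "\<lambda>n. inverse (real (Suc n))"
  have "(\<lambda>n. \<integral>s. inverse (1 + s\<^sup>2) *\<^sub>R iexp (t * (?y n * s)) \<partial>lborel)
      \<longlonglongrightarrow> (\<integral>s. inverse (1 + s\<^sup>2) *\<^sub>R iexp (t * (0 * s)) \<partial>lborel)"
  proof (rule integral_dominated_convergence[where w = "\<lambda>s. inverse (1 + s\<^sup>2)"])
    show "AE s in lborel. (\<lambda>n. inverse (1 + s\<^sup>2) *\<^sub>R iexp (t * (?y n * s))) \<longlonglongrightarrow> inverse (1 + s\<^sup>2) *\<^sub>R iexp (t * (0 * s))"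
      by (intro AE_I2 tendsto_intros LIMSEQ_inverse_real_of_nat)
    show "AE s in lborel. norm (inverse (1 + s\<^sup>2) *\<^sub>R iexp (t * (?y n * s))) \<le> inverse (1 + s\<^sup>2)" for n
      by (intro AE_I2) (simp add: norm_exp_i_times)
  qed (auto simp: integrable_inverse_square)
  then have "(\<lambda>n. Poisson_Fourier (?y n) t) \<longlonglongrightarrow> complex_of_real pi"
    using integral_inverse_square integral_complex_of_real[of lborel "\<lambda>s. inverse (1 + s\<^sup>2)"]
    by (simp add: eq scaleR_conv_of_real)
  then have "eventually (\<lambda>n. Poisson_Fourier (?y n) t \<noteq> 0) sequentially"
    by (rule tendsto_imp_eventually_ne) simp
  then obtain n where "Poisson_Fourier (?y n) t \<noteq> 0"
    using eventually_happens' sequentially_bot by blast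
  then show ?thesis by (intro exI[of _ "?y n"]) simp
qed

lemma Fourier_cauchy_transform:
  assumes prob: "prob_space \<mu>" and sets: "sets \<mu> = sets borel" and "y > 0"
  shows "(\<integral>x. (- Im (cauchy_transform \<mu> (Complex x y))) *\<^sub>R iexp (t * x) \<partial>lborel) = char \<mu> t * Poisson_Fourier y t"
proof -
  interpret prob_space \<mu> by (rule prob)
  interpret pair_sigma_finite lborel \<mu> by unfold_locales
  note [measurable_cong] = sets
  have Pk [measurable]: "Poisson_kernel y \<in> borel_measurable borel"
    unfolding Poisson_kernel_def[abs_def] by measurable
  have up: "Complex x y \<in> upper" for x using \<open>y > 0\<close> by (simp add: upper_def)
  let ?F = "\<lambda>x u. Poisson_kernel y (x - u) *\<^sub>R iexp (t * x)"
  have "(- Im (cauchy_transform \<mu> (Complex x y))) *\<^sub>R iexp (t * x) = (\<integral>u. ?F x u \<partial>\<mu>)" for x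
  proof -
    have "- Im (cauchy_transform \<mu> (Complex x y)) = (\<integral>u. Poisson_kernel y (x - u) \<partial>\<mu>)"
      unfolding cauchy_transform_def using integrable_resolvent[OF prob sets up[of x]]
      by (simp add: Im_resolvent_Poisson flip: integral_Im)
    moreover have "integrable \<mu> (\<lambda>u. Poisson_kernel y (x - u))"
      using integrable_Im[OF integrable_resolvent[OF prob sets up[of x]]] by (simp add: Im_resolvent_Poisson)
    ultimately show ?thesis by simp
  qed
  then have "(\<integral>x. (- Im (cauchy_transform \<mu> (Complex x y))) *\<^sub>R iexp (t * x) \<partial>lborel)
      = (\<integral>x. (\<integral>u. ?F x u \<partial>\<mu>) \<partial>lborel)" by simp
  also have "\<dots> = (\<integral>u. (\<integral>x. ?F x u \<partial>lborel) \<partial>\<mu>)"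
  proof (rule Fubini_integral[symmetric])
    have shift: "(\<integral>x. norm (?F x u) \<partial>lborel) = (\<integral>x. Poisson_kernel y x \<partial>lborel)"
      and int: "integrable lborel (\<lambda>x. ?F x u)" for u
    proof -
      have "integrable lborel (\<lambda>x. Poisson_kernel y (- u + 1 * x))"
        using lborel_integrable_real_affine_iff[of 1 "Poisson_kernel y" "- u"] integrable_Poisson_kernel[OF \<open>y > 0\<close>] by simp
      then have i: "integrable lborel (\<lambda>x. Poisson_kernel y (x - u))" by simp
      then show "integrable lborel (\<lambda>x. ?F x u)"
        by (rule Bochner_Integration.integrable_bound) (auto simp: norm_exp_i_times Poisson_kernel_nonneg \<open>y > 0\<close>)
      have "(\<integral>x. Poisson_kernel y x \<partial>lborel) = \<bar>1\<bar> *\<^sub>R (\<integral>x. Poisson_kernel y (- u + 1 * x) \<partial>lborel)"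
        by (rule lborel_integral_real_affine) simp
      then show "(\<integral>x. norm (?F x u) \<partial>lborel) = (\<integral>x. Poisson_kernel y x \<partial>lborel)"
        by (simp add: norm_exp_i_times Poisson_kernel_nonneg \<open>y > 0\<close>)
    qed
    interpret P: pair_sigma_finite \<mu> lborel by unfold_locales
    have "integrable (\<mu> \<Otimes>\<^sub>M lborel) (\<lambda>(u, x). ?F x u)"
    proof (rule P.Fubini_integrable)
      show "(\<lambda>(u, x). ?F x u) \<in> borel_measurable (\<mu> \<Otimes>\<^sub>M lborel)" by measurable
      show "integrable \<mu> (\<lambda>u. \<integral>x. norm (case (u, x) of (u, x) \<Rightarrow> ?F x u) \<partial>lborel)"
        by (simp only: prod.case shift) simp
      show "AE u in \<mu>. integrable lborel (\<lambda>x. case (u, x) of (u, x) \<Rightarrow> ?F x u)"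
        using int by simp
    qed
    then show "integrable (lborel \<Otimes>\<^sub>M \<mu>) (\<lambda>(x, u). ?F x u)"
      by (subst integrable_product_swap_iff[symmetric]) (simp add: case_prod_unfold)
  qed
  also have "\<dots> = (\<integral>u. iexp (t * u) * Poisson_Fourier y t \<partial>\<mu>)"
  proof (rule Bochner_Integration.integral_cong[OF refl])
    fix u
    \<comment> \<open>The translation by \<open>u\<close> separates the variables.\<close>
    have "(\<integral>x. ?F x u \<partial>lborel) = \<bar>1\<bar> *\<^sub>R (\<integral>x. ?F (u + 1 * x) u \<partial>lborel)"
      by (rule lborel_integral_real_affine) simp
    also have "\<dots> = (\<integral>x. iexp (t * u) * (Poisson_kernel y x *\<^sub>R iexp (t * x)) \<partial>lborel)"
      by (simp add: distrib_left exp_add)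
    also have "\<dots> = iexp (t * u) * Poisson_Fourier y t"
      unfolding Poisson_Fourier_def by (rule integral_mult_right_zero)
    finally show "(\<integral>x. ?F x u \<partial>lborel) = iexp (t * u) * Poisson_Fourier y t" .
  qed
  also have "\<dots> = char \<mu> t * Poisson_Fourier y t"
    by (simp add: char_def)
  finally show ?thesis .
qed

lemma cauchy_transform_inject:
  assumes "prob_space \<mu>" "sets \<mu> = sets borel" "prob_space \<nu>" "sets \<nu> = sets borel"
    and eq: "\<And>z. z \<in> upper \<Longrightarrow> cauchy_transform \<mu> z = cauchy_transform \<nu> z"
  shows "\<mu> = \<nu>"
proof (rule Levy_uniqueness)
  show "real_distribution \<mu>" "real_distribution \<nu>"
    using assms by (simp_all add: real_distribution_def real_distribution_axioms_def sets_eq_imp_space_eq[of _ borel])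
  show "char \<mu> = char \<nu>"
  proof
    fix t
    obtain y where y: "y > 0" "Poisson_Fourier y t \<noteq> 0" using Poisson_Fourier_nonzero by blast
    have "cauchy_transform \<mu> (Complex x y) = cauchy_transform \<nu> (Complex x y)" for x
      by (rule eq) (simp add: upper_def y)
    then have "char \<mu> t * Poisson_Fourier y t = char \<nu> t * Poisson_Fourier y t"
      using Fourier_cauchy_transform[OF assms(1,2) y(1), of t] Fourier_cauchy_transform[OF assms(3,4) y(1), of t] by simp
    then show "char \<mu> t = char \<nu> t" using y(2) by simp
  qed
qed

lemma upper_continuation:
  assumes "f holomorphic_on upper" "g holomorphic_on upper"
    and eq: "\<And>z. Im z > R \<Longrightarrow> f z = g z" and "R \<ge> 0" and z: "z \<in> upper"
  shows "f z = g z"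
proof (rule analytic_continuation_open[OF _ open_upper _ convex_connected[OF convex_upper] _ assms(1,2) _ z])
  show "open {z. Im z > R}" by (rule open_halfspace_Im_gt)
  have "Complex 0 (R + 1) \<in> {z. Im z > R}" by simp
  then show "{z. Im z > R} \<noteq> {}" by blast
  show "{z. Im z > R} \<subseteq> upper" using \<open>R \<ge> 0\<close> by (auto simp: upper_def)
qed (use eq in auto)

text \<open>Compact support makes the moments the Laurent coefficients of G at infinity; the
  identity theorem carries the equality to the whole upper half plane.\<close>

lemma moments_inject:
  assumes \<mu>: "compactly_supported_prob \<mu>" and \<nu>: "compactly_supported_prob \<nu>"
    and eq: "\<And>n. (\<integral>x. x ^ n \<partial>\<mu>) = (\<integral>x. x ^ n \<partial>\<nu>)"
  shows "\<mu> = \<nu>"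
proof (rule cauchy_transform_inject[OF compactly_supportedD[OF \<mu>] compactly_supportedD[OF \<nu>]])
  obtain R1 where R1: "R1 > 0" "AE x in \<mu>. \<bar>x\<bar> \<le> R1" using compactly_supported_bound[OF \<mu>] by blast
  obtain R2 where R2: "R2 > 0" "AE x in \<nu>. \<bar>x\<bar> \<le> R2" using compactly_supported_bound[OF \<nu>] by blast
  fix z assume "z \<in> upper"
  then show "cauchy_transform \<mu> z = cauchy_transform \<nu> z"
  proof (rule upper_continuation[rotated -1])
    fix z assume z: "Im z > max R1 R2"
    then have "cmod z > R1" "cmod z > R2" using abs_Im_le_cmod[of z] by auto
    then have "(\<lambda>n. complex_of_real (\<integral>x. x ^ n \<partial>\<mu>) / z ^ Suc n) sums cauchy_transform \<mu> z"
      "(\<lambda>n. complex_of_real (\<integral>x. x ^ n \<partial>\<mu>) / z ^ Suc n) sums cauchy_transform \<nu> z"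
      using cauchy_transform_series[OF compactly_supportedD[OF \<mu>] R1(2), of z]
        cauchy_transform_series[OF compactly_supportedD[OF \<nu>] R2(2), of z] R1 R2 by (simp_all add: eq)
    then show "cauchy_transform \<mu> z = cauchy_transform \<nu> z" by (rule sums_unique2)
  qed (use holomorphic_cauchy_transform[OF compactly_supportedD[OF \<mu>]]
      holomorphic_cauchy_transform[OF compactly_supportedD[OF \<nu>]] R1 in auto)
qed

lemma has_distribution_unique:
  "has_distribution \<xi> A \<mu> \<Longrightarrow> has_distribution \<eta> B \<nu> \<Longrightarrow> (\<And>n. vstate \<xi> (A ^^ n) = vstate \<eta> (B ^^ n)) \<Longrightarrow> \<mu> = \<nu>"
  unfolding has_distribution_def by (intro moments_inject) (auto simp flip: of_real_eq_iff[where 'a = complex])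


section \<open>The free product space\<close>

declare One_nat_def [simp del] \<comment> \<open>keeps the indices 1 and 2 of the two spaces in numeral form\<close>

text \<open>Inner products of combinations depend only on the Gram matrix of the families. Norms are
  compared through it without any linear independence.\<close>

lemma lcomb_cinner_cong:
  assumes "\<And>i j. i \<in> snd ` set xs \<Longrightarrow> j \<in> snd ` set ys \<Longrightarrow> cinner (f i) (g j) = cinner (f' i) (g' j)"
  shows "cinner (lcomb f xs) (lcomb g ys) = cinner (lcomb f' xs) (lcomb g' ys)"
proof -
  have *: "cinner (f i) (lcomb g zs) = cinner (f' i) (lcomb g' zs)"
    if "i \<in> snd ` set xs" "set zs \<subseteq> set ys" for i zs
    using that(2)
  proof (induction zs)
    case (Cons z zs)
    obtain c j where z: "z = (c, j)" by force
    have "j \<in> snd ` set ys" using Cons.prems z by force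
    then show ?case
      using Cons assms[OF that(1)] by (simp add: z cinner_add_right cinner_scaleC_right)
  qed simp
  have "cinner (lcomb f zs) (lcomb g ys) = cinner (lcomb f' zs) (lcomb g' ys)"
    if "set zs \<subseteq> set xs" for zs
    using that
  proof (induction zs)
    case (Cons z zs)
    obtain c i where z: "z = (c, i)" by force
    have "i \<in> snd ` set xs" using Cons.prems z by force
    then show ?case
      using Cons *[of i ys] by (simp add: z cinner_add_left cinner_scaleC_left)
  qed simp
  then show ?thesis by blast
qed

lemma word_cinner_nonzero: "word_cinner v w \<noteq> 0 \<Longrightarrow> map letter_index v = map letter_index w"
  by (induction v w rule: word_cinner.induct) auto

text \<open>If \<open>T w\<close> is read as h tensor \<open>T u\<close> with \<open>h\<close> in
  the space of index \<open>j\<close>, then \<open>depth j w\<close> is the length of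
  \<open>u\<close>: a leading letter from that space is absorbed into \<open>h\<close>. For n >= 1,
  P_j(n) is thus the projection onto the words of depth n - 1.\<close>

definition depth :: "nat \<Rightarrow> ('a + 'b) list \<Rightarrow> nat" where
  "depth j w = (if w \<noteq> [] \<and> letter_index (hd w) = j then length w - 1 else length w)"

lemma depth_index_cong: "map letter_index v = map letter_index w \<Longrightarrow> depth j v = depth j w"
  by (cases v; cases w) (auto simp: depth_def dest: map_eq_imp_length_eq)

section \<open>Exchange of the two spaces\<close>

definition flip :: "'a + 'b \<Rightarrow> 'b + 'a" where
  "flip = case_sum Inr Inl"

lemma flip_simps [simp]: "flip (Inl x) = Inr x" "flip (Inr y) = Inl y" "flip (flip u) = u"
  by (auto simp: flip_def split: sum.split)

lemma flip_flip [simp]: "flip \<circ> flip = id"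
  by (simp add: fun_eq_iff)

lemma map_flip_flip: "map flip (map flip w) = w"
  by simp

lemma letter_index_flip [simp]: "letter_index (flip u) = other_index (letter_index u)"
  by (cases u) simp_all

lemma letter_index_range: "letter_index u = 1 \<or> letter_index u = 2"
  by (cases u) simp_all

lemma word_cinner_flip: "word_cinner (map flip v) (map flip w) = word_cinner v w"
  by (induction v w rule: word_cinner.induct) auto

lemma reduced_words_flip:
  fixes \<xi>1 :: "'a::chilbert_space" and \<xi>2 :: "'b::chilbert_space"
  shows "map flip w \<in> reduced_words \<xi>2 \<xi>1 \<longleftrightarrow> w \<in> reduced_words \<xi>1 \<xi>2"
proof -
  have *: "(letter_index (flip u) = letter_index (flip v)) = (letter_index u = letter_index v)"
    for u v :: "'a + 'b"
    by (cases u; cases v) auto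
  have **: "(case flip u of Inl h \<Rightarrow> cinner h \<xi>2 = 0 | Inr h \<Rightarrow> cinner h \<xi>1 = 0) =
      (case u of Inl h \<Rightarrow> cinner h \<xi>1 = 0 | Inr h \<Rightarrow> cinner h \<xi>2 = 0)" for u
    by (cases u) auto
  show ?thesis
    unfolding reduced_words_def by (simp add: successively_map * ** del: letter_index_flip)
qed

lemma words_not_from_flip:
  fixes \<xi>1 :: "'a::chilbert_space" and \<xi>2 :: "'b::chilbert_space"
  assumes "j = 1 \<or> j = 2"
  shows "map flip w \<in> words_not_from \<xi>2 \<xi>1 j \<longleftrightarrow> w \<in> words_not_from \<xi>1 \<xi>2 (other_index j)"
proof -
  have "(letter_index (flip u) \<noteq> j) = (letter_index u \<noteq> other_index j)" for u :: "'a + 'b"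
    using assms by (cases u) auto
  then show ?thesis
    by (cases w) (simp_all add: words_not_from_def flip: reduced_words_flip[of _ \<xi>2 \<xi>1] del: letter_index_flip)
qed

lemma level_flip:
  assumes "j = 1 \<or> j = 2"
  shows "level \<xi>2 \<xi>1 (\<lambda>w. T (map flip w)) n j = level \<xi>1 \<xi>2 T n (other_index j)"
proof -
  have "{w \<in> words_not_from \<xi>2 \<xi>1 j. length w = n}
      = map flip ` {w \<in> words_not_from \<xi>1 \<xi>2 (other_index j). length w = n}" (is "?A = ?B")
  proof
    show "?A \<subseteq> ?B"
    proof
      fix w assume "w \<in> ?A"
      then show "w \<in> ?B"
        using words_not_from_flip[OF assms, of "map flip w" \<xi>2 \<xi>1]
        by (intro image_eqI[of _ _ "map flip w"]) simp_all
    qed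
    show "?B \<subseteq> ?A" using words_not_from_flip[OF assms] by auto
  qed
  then have "(\<lambda>w. T (map flip w)) ` {w \<in> words_not_from \<xi>2 \<xi>1 j. length w = n}
      = T ` {w \<in> words_not_from \<xi>1 \<xi>2 (other_index j). length w = n}"
    by (simp add: image_image o_def)
  then show ?thesis by (simp add: level_def)
qed

lemma level_proj_flip:
  assumes "j = 1 \<or> j = 2"
  shows "level_proj \<xi>2 \<xi>1 (\<lambda>w. T (map flip w)) j n = level_proj \<xi>1 \<xi>2 T (other_index j) n"
  using assms by (elim disjE) (simp_all add: level_proj_def level_flip)

lemma compress_flip:
  assumes "j = 1 \<or> j = 2"
  shows "compress \<xi>2 \<xi>1 (\<lambda>w. T (map flip w)) j X n = compress \<xi>1 \<xi>2 T (other_index j) X n"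
  by (simp add: compress_def level_proj_flip[OF assms])

lemma left_tensor_flip:
  "left_tensor Inl \<xi> (\<lambda>w. T (map flip w)) h w = left_tensor Inr \<xi> T h (map flip w)"
  "left_tensor Inr \<eta> (\<lambda>w. T (map flip w)) k w = left_tensor Inl \<eta> T k (map flip w)"
  by (simp_all add: left_tensor_def)

lemma Ball_words_not_from_flip:
  assumes "j = 1 \<or> j = 2"
  shows "(\<forall>w\<in>words_not_from \<xi>2 \<xi>1 j. P (map flip w)) \<longleftrightarrow> (\<forall>w\<in>words_not_from \<xi>1 \<xi>2 (other_index j). P w)"
proof (intro iffI ballI)
  fix w assume *: "\<forall>w\<in>words_not_from \<xi>2 \<xi>1 j. P (map flip w)" "w \<in> words_not_from \<xi>1 \<xi>2 (other_index j)"
  then have "P (map flip (map flip w))"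
    using words_not_from_flip[OF assms, of w \<xi>2 \<xi>1] by blast
  then show "P w" by simp
next
  fix w assume *: "\<forall>w\<in>words_not_from \<xi>1 \<xi>2 (other_index j). P w" "w \<in> words_not_from \<xi>2 \<xi>1 j"
  then show "P (map flip w)" using words_not_from_flip[OF assms, of "map flip w" \<xi>2 \<xi>1] by simp
qed

lemma lambda_flip:
  fixes \<xi>1 :: "'a::chilbert_space" and \<xi>2 :: "'b::chilbert_space"
    and T :: "('a + 'b) list \<Rightarrow> 'c::chilbert_space"
  shows
  "lambda1 \<xi>2 \<xi>1 (\<lambda>w. T (map flip w)) = lambda2 \<xi>1 \<xi>2 T"
  "lambda2 \<xi>2 \<xi>1 (\<lambda>w. T (map flip w)) = lambda1 \<xi>1 \<xi>2 T"
proof -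
  have "(\<forall>w\<in>words_not_from \<xi>2 \<xi>1 1. P (map flip w)) = (\<forall>w\<in>words_not_from \<xi>1 \<xi>2 2. P w)"
    "(\<forall>w\<in>words_not_from \<xi>2 \<xi>1 2. P (map flip w)) = (\<forall>w\<in>words_not_from \<xi>1 \<xi>2 1. P w)" for P
    using Ball_words_not_from_flip[of 1 \<xi>2 \<xi>1 P] Ball_words_not_from_flip[of 2 \<xi>2 \<xi>1 P] by (simp_all add: One_nat_def)
  note * = this
  show "lambda1 \<xi>2 \<xi>1 (\<lambda>w. T (map flip w)) = lambda2 \<xi>1 \<xi>2 T"
  proof
    fix x
    have "(\<forall>w\<in>words_not_from \<xi>2 \<xi>1 1. L (left_tensor Inl \<xi>2 (\<lambda>w. T (map flip w)) h w)
          = left_tensor Inl \<xi>2 (\<lambda>w. T (map flip w)) (x h) w) =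
        (\<forall>w\<in>words_not_from \<xi>1 \<xi>2 2. L (left_tensor Inr \<xi>2 T h w) = left_tensor Inr \<xi>2 T (x h) w)" for L :: "'c \<Rightarrow> 'c" and h
      unfolding left_tensor_flip
      by (rule *(1)[of "\<lambda>w. L (left_tensor Inr \<xi>2 T h w) = left_tensor Inr \<xi>2 T (x h) w"])
    then show "lambda1 \<xi>2 \<xi>1 (\<lambda>w. T (map flip w)) x = lambda2 \<xi>1 \<xi>2 T x"
      unfolding lambda1_def lambda2_def by simp
  qed
  show "lambda2 \<xi>2 \<xi>1 (\<lambda>w. T (map flip w)) = lambda1 \<xi>1 \<xi>2 T"
  proof
    fix x
    have "(\<forall>w\<in>words_not_from \<xi>2 \<xi>1 2. L (left_tensor Inr \<xi>1 (\<lambda>w. T (map flip w)) h w)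
          = left_tensor Inr \<xi>1 (\<lambda>w. T (map flip w)) (x h) w) =
        (\<forall>w\<in>words_not_from \<xi>1 \<xi>2 1. L (left_tensor Inl \<xi>1 T h w) = left_tensor Inl \<xi>1 T (x h) w)" for L :: "'c \<Rightarrow> 'c" and h
      unfolding left_tensor_flip
      by (rule *(2)[of "\<lambda>w. L (left_tensor Inl \<xi>1 T h w) = left_tensor Inl \<xi>1 T (x h) w"])
    then show "lambda2 \<xi>2 \<xi>1 (\<lambda>w. T (map flip w)) x = lambda1 \<xi>1 \<xi>2 T x"
      unfolding lambda1_def lambda2_def by simp
  qed
qed

section \<open>Tensor identification, representations and level projections\<close>

locale free_product =
  fixes \<xi>1 :: "'a::chilbert_space" and \<xi>2 :: "'b::chilbert_space"
    and T :: "('a + 'b) list \<Rightarrow> 'h::chilbert_space"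
  assumes free_product: "is_free_product \<xi>1 \<xi>2 T"
begin

abbreviation RW :: "('a + 'b) list set" where "RW \<equiv> reduced_words \<xi>1 \<xi>2"
abbreviation WN :: "nat \<Rightarrow> ('a + 'b) list set" where "WN \<equiv> words_not_from \<xi>1 \<xi>2"
abbreviation lt1 :: "'a \<Rightarrow> ('a + 'b) list \<Rightarrow> 'h" where "lt1 \<equiv> left_tensor Inl \<xi>1 T"
abbreviation lt2 :: "'b \<Rightarrow> ('a + 'b) list \<Rightarrow> 'h" where "lt2 \<equiv> left_tensor Inr \<xi>2 T"
abbreviation \<Omega> :: 'h where "\<Omega> \<equiv> T []"

lemma cinner_unit: "cinner \<xi>1 \<xi>1 = 1" "cinner \<xi>2 \<xi>2 = 1"
  using free_product by (simp_all add: is_free_product_def cinner_self)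

lemma cinner_T: "v \<in> RW \<Longrightarrow> w \<in> RW \<Longrightarrow> cinner (T v) (T w) = word_cinner v w"
  using free_product by (simp add: is_free_product_def)

lemma total: "closure (cspan (T ` RW)) = UNIV"
  using free_product by (simp add: is_free_product_def)

lemma swap: "free_product \<xi>2 \<xi>1 (\<lambda>w. T (map flip w))"
proof
  have "w \<in> reduced_words \<xi>2 \<xi>1 \<longleftrightarrow> map flip w \<in> RW" for w
    by (metis map_flip_flip reduced_words_flip)
  then have "reduced_words \<xi>2 \<xi>1 = map flip ` RW"
    by (metis (no_types, lifting) image_iff map_flip_flip subsetI subset_antisym)
  then have "(\<lambda>w. T (map flip w)) ` reduced_words \<xi>2 \<xi>1 = T ` RW"
    by (simp add: image_image o_def)
  then show "is_free_product \<xi>2 \<xi>1 (\<lambda>w. T (map flip w))"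
    using free_product \<open>\<And>w. w \<in> reduced_words \<xi>2 \<xi>1 \<longleftrightarrow> map flip w \<in> RW\<close>
    by (simp add: is_free_product_def word_cinner_flip)
qed

lemma RW_Nil [simp]: "[] \<in> RW"
  by (simp add: reduced_words_def)

lemma WN_Nil [simp]: "[] \<in> WN j"
  by (simp add: words_not_from_def)

lemma WN_RW: "w \<in> WN j \<Longrightarrow> w \<in> RW"
  by (simp add: words_not_from_def)

lemma RW_Cons:
  "Inl h # w \<in> RW \<longleftrightarrow> cinner h \<xi>1 = 0 \<and> w \<in> WN 1"
  "Inr k # w \<in> RW \<longleftrightarrow> cinner k \<xi>2 = 0 \<and> w \<in> WN 2"
  by (auto simp: reduced_words_def words_not_from_def successively_Cons)

lemma WN_Cons:
  "Inl h # w \<in> WN j \<longleftrightarrow> Inl h # w \<in> RW \<and> j \<noteq> 1"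
  "Inr k # w \<in> WN j \<longleftrightarrow> Inr k # w \<in> RW \<and> j \<noteq> 2"
  by (auto simp: words_not_from_def)

lemma RW_cases1:
  assumes "w \<in> RW"
  obtains "w \<in> WN 1" | h u where "w = Inl h # u" "u \<in> WN 1" "cinner h \<xi>1 = 0"
proof (cases w)
  case (Cons x u)
  then show ?thesis using assms that RW_Cons WN_Cons by (cases x) auto
qed (use that in simp)

lemma centre_orth: "cinner (h - cinner h \<xi>1 *\<^sub>C \<xi>1) \<xi>1 = 0"
  by (simp add: cinner.diff_left cinner_scaleC_left cinner_unit)

lemma word_cinner_WN1:
  assumes "w \<in> WN 1"
  shows "word_cinner (Inl g # v) w = 0" "word_cinner w (Inl g # v) = 0"
  using assms by (cases w; cases "hd w"; simp add: words_not_from_def)+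

text \<open>Multilinearity of \<open>T\<close> is not an axiom; as here, it is read off inner
  products: a word with a zero letter has norm 0.\<close>

lemma T_zero: "w \<in> WN 1 \<Longrightarrow> T (Inl 0 # w) = 0"
  using cinner_T[of "Inl 0 # w" "Inl 0 # w"] by (simp add: RW_Cons)

lemma lt1_orth: "cinner h \<xi>1 = 0 \<Longrightarrow> w \<in> WN 1 \<Longrightarrow> lt1 h w = T (Inl h # w)"
  by (simp add: left_tensor_def scaleC.zero_left)

lemma lt1_unit: "w \<in> WN 1 \<Longrightarrow> lt1 \<xi>1 w = T w"
  by (simp add: left_tensor_def cinner_unit scaleC_one T_zero)

text \<open>This says that the identification of h tensor \<open>T w\<close> with a vector of the
  free product is isometric. The two summands of \<open>lt1\<close> are orthogonal because one word
  starts in the first space and the other does not, and \<open>g\<close> and \<open>h\<close> split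
  orthogonally along \<xi>1.\<close>

lemma cinner_lt1:
  assumes "v \<in> WN 1" "w \<in> WN 1"
  shows "cinner (lt1 g v) (lt1 h w) = cinner g h * word_cinner v w"
proof -
  have "cinner (lt1 g v) (lt1 h w)
      = (cinner (g - cinner g \<xi>1 *\<^sub>C \<xi>1) (h - cinner h \<xi>1 *\<^sub>C \<xi>1) + cinner g \<xi>1 * cnj (cinner h \<xi>1)) * word_cinner v w"
    using assms by (simp add: left_tensor_def cinner_add_left cinner_add_right cinner_scaleC_left
        cinner_scaleC_right cinner_T RW_Cons centre_orth WN_RW word_cinner_WN1 algebra_simps)
  also have "cinner (g - cinner g \<xi>1 *\<^sub>C \<xi>1) (h - cinner h \<xi>1 *\<^sub>C \<xi>1) + cinner g \<xi>1 * cnj (cinner h \<xi>1) = cinner g h"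
    by (simp add: cinner.diff_left cinner.diff_right cinner_scaleC_left cinner_scaleC_right cinner_unit
        cinner_commute[of \<xi>1 h])
  finally show ?thesis .
qed

lemma norm_lt1: "w \<in> WN 1 \<Longrightarrow> norm (lt1 h w) = norm h * norm (T w)"
proof -
  assume w: "w \<in> WN 1"
  have "complex_of_real ((norm (lt1 h w))\<^sup>2) = complex_of_real ((norm h * norm (T w))\<^sup>2)"
    unfolding power_mult_distrib of_real_mult cinner_self[symmetric] cinner_lt1[OF w w]
    by (simp only: cinner_T[OF WN_RW[OF w] WN_RW[OF w]])
  then have "(norm (lt1 h w))\<^sup>2 = (norm h * norm (T w))\<^sup>2" using of_real_eq_iff by blast
  then show ?thesis by (simp add: power2_eq_iff_nonneg)
qed

text \<open>The defect is orthogonal to every \<open>lt1 k w\<close>, and it is itself a combination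
  of such vectors.\<close>

lemma lt1_lincomb:
  assumes "w \<in> WN 1"
  shows "lt1 (c *\<^sub>C g + h) w = c *\<^sub>C lt1 g w + lt1 h w"
proof -
  define d where "d = lt1 (c *\<^sub>C g + h) w - (c *\<^sub>C lt1 g w + lt1 h w)"
  have "cinner d (lt1 k w) = 0" for k
    using assms by (simp add: d_def cinner.diff_left cinner_add_left cinner_scaleC_left cinner_lt1 algebra_simps)
  then have "cinner d d = 0"
    by (subst (2) d_def) (simp add: cinner.diff_right cinner_add_right cinner_scaleC_right)
  then show ?thesis by (simp add: d_def)
qed

lemma lt1_add: "w \<in> WN 1 \<Longrightarrow> lt1 (g + h) w = lt1 g w + lt1 h w"
  using lt1_lincomb[of w 1 g h] by (simp add: scaleC_one)

lemma lt1_scale: "w \<in> WN 1 \<Longrightarrow> lt1 (c *\<^sub>C g) w = c *\<^sub>C lt1 g w"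
  using lt1_lincomb[of w c g 0] lt1_lincomb[of w 1 0 0] by (simp add: scaleC_one)

lemma T_in_lt1: "w \<in> RW \<Longrightarrow> \<exists>h u. u \<in> WN 1 \<and> T w = lt1 h u"
  by (elim RW_cases1) (metis lt1_unit, metis lt1_orth)

lemma total_lt1: "closure (cspan ((\<lambda>(h, w). lt1 h w) ` (UNIV \<times> WN 1))) = UNIV"
proof -
  have "T ` RW \<subseteq> (\<lambda>(h, w). lt1 h w) ` (UNIV \<times> WN 1)"
    using T_in_lt1 by fastforce
  then show ?thesis
    using total closure_mono[OF complex_space.span_mono] by blast
qed

lemma lambda1_unique:
  assumes "bounded_clinear L" "bounded_clinear L'"
    and "\<And>h w. w \<in> WN 1 \<Longrightarrow> L (lt1 h w) = L' (lt1 h w)"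
  shows "L = L'"
  by (rule bounded_clinear_eqI_total[OF assms(1,2) total_lt1]) (use assms(3) in auto)

text \<open>\<open>lambda1\<close> is a definite description, so a bounded operator acting as
  \<open>x\<close> on the first factor must be produced. On a fixed finite combination the vectors
  with \<open>x ^^ n\<close> in the first factor form a symmetric orbit growing at most like C K^n,
  where C depends on the combination; \<open>symmetric_orbit_bound\<close> removes C.\<close>

lemma lambda1:
  assumes "selfadjoint x"
  shows "bounded_clinear (lambda1 \<xi>1 \<xi>2 T x)"
    and "w \<in> WN 1 \<Longrightarrow> lambda1 \<xi>1 \<xi>2 T x (lt1 h w) = lt1 (x h) w"
proof -
  have "bounded_linear x"
    using assms bounded_clinear_bounded_linear selfadjoint_bounded_clinear by blast
  then obtain K where K: "K > 0" "\<And>h. norm (x h) \<le> norm h * K"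
    using bounded_linear.pos_bounded by blast
  have Kn: "norm ((x ^^ n) h) \<le> norm h * K ^ n" for n h
  proof (induction n)
    case (Suc n)
    have "norm (x ((x ^^ n) h)) \<le> norm ((x ^^ n) h) * K" by (rule K)
    also have "\<dots> \<le> (norm h * K ^ n) * K" using K(1) by (intro mult_right_mono Suc) simp
    finally show ?case by (simp add: mult_ac)
  qed simp
  let ?s = "\<lambda>xs n. lcomb (\<lambda>(h, w). lt1 ((x ^^ n) h) w) xs"
  have bound: "norm (?s xs 1) \<le> K * norm (?s xs 0)" if "snd ` set xs \<subseteq> UNIV \<times> WN 1" for xs
  proof -
    have "\<exists>C. \<forall>n. norm (?s xs n) \<le> C * K ^ n"
      using that
    proof (induction xs)
      case (Cons y ys)
      then obtain C where C: "\<And>n. norm (?s ys n) \<le> C * K ^ n" by auto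
      obtain c h w where y: "y = (c, h, w)" by (metis prod_cases3)
      have "w \<in> WN 1" using Cons.prems y by auto
      have "norm (?s (y # ys) n) \<le> (cmod c * (norm h * norm (T w)) + C) * K ^ n" for n
      proof -
        have "norm (?s (y # ys) n) \<le> norm (c *\<^sub>C lt1 ((x ^^ n) h) w) + norm (?s ys n)"
          unfolding y lcomb_simps prod.case by (rule norm_triangle_ineq)
        also have "norm (c *\<^sub>C lt1 ((x ^^ n) h) w) = cmod c * (norm ((x ^^ n) h) * norm (T w))"
          by (simp add: norm_scaleC norm_lt1 \<open>w \<in> WN 1\<close>)
        also have "\<dots> \<le> cmod c * ((norm h * K ^ n) * norm (T w))"
          by (intro mult_left_mono mult_right_mono Kn) simp_all
        finally show ?thesis using C[of n] by (simp add: algebra_simps)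
      qed
      then show ?case by blast
    qed (intro exI[of _ 0], simp)
    then obtain C where C: "\<And>n. norm (?s xs n) \<le> C * K ^ n" by blast
    show ?thesis
    proof (rule symmetric_orbit_bound[OF _ C K(1)])
      show "cinner (?s xs (Suc m)) (?s xs n) = cinner (?s xs m) (?s xs (Suc n))" for m n
      proof (rule lcomb_cinner_cong)
        fix i j assume "i \<in> snd ` set xs" "j \<in> snd ` set xs"
        then have "i \<in> UNIV \<times> WN 1" "j \<in> UNIV \<times> WN 1" using that by blast+
        then obtain g v h w where "i = (g, v)" "j = (h, w)" "v \<in> WN 1" "w \<in> WN 1"
          by (elim SigmaE) blast
        then show "cinner ((\<lambda>(h, w). lt1 ((x ^^ Suc m) h) w) i) ((\<lambda>(h, w). lt1 ((x ^^ n) h) w) j)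
            = cinner ((\<lambda>(h, w). lt1 ((x ^^ m) h) w) i) ((\<lambda>(h, w). lt1 ((x ^^ Suc n) h) w) j)"
          by (simp add: cinner_lt1 selfadjoint_cinner[OF assms])
      qed
    qed
  qed
  have bd: "norm (lcomb (\<lambda>(h, w). lt1 (x h) w) xs) \<le> K * norm (lcomb (\<lambda>(h, w). lt1 h w) xs)"
    if "snd ` set xs \<subseteq> UNIV \<times> WN 1" for xs
    using bound[OF that] by (simp add: One_nat_def)
  obtain L where L: "bounded_clinear L"
    "\<And>i. i \<in> UNIV \<times> WN 1 \<Longrightarrow> L ((\<lambda>(h, w). lt1 h w) i) = (\<lambda>(h, w). lt1 (x h) w) i"
    by (rule bounded_clinear_extension[OF total_lt1, of "\<lambda>(h, w). lt1 (x h) w" K], erule bd) (rule that)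
  then have L': "L (lt1 h w) = lt1 (x h) w" if "w \<in> WN 1" for h w
    using L(2)[of "(h, w)"] that by simp
  have "lambda1 \<xi>1 \<xi>2 T x = L"
    unfolding lambda1_def
  proof (rule the_equality)
    fix L'' assume "bounded_clinear L'' \<and> (\<forall>h. \<forall>w\<in>WN 1. L'' (lt1 h w) = lt1 (x h) w)"
    then show "L'' = L"
      by (intro lambda1_unique) (simp_all add: L L')
  qed (use L L' in blast)
  then show "bounded_clinear (lambda1 \<xi>1 \<xi>2 T x)"
    and "w \<in> WN 1 \<Longrightarrow> lambda1 \<xi>1 \<xi>2 T x (lt1 h w) = lt1 (x h) w"
    using L(1) L' by simp_all
qed

lemma selfadjoint_lambda1:
  assumes "selfadjoint x"
  shows "selfadjoint (lambda1 \<xi>1 \<xi>2 T x)"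
  by (rule selfadjointI_total[OF lambda1(1)[OF assms] total_lt1])
    (auto simp: lambda1(2)[OF assms] cinner_lt1 selfadjoint_cinner[OF assms])

text \<open>The whole algebra of X_1 acts on the first factor alone. Keeping \<open>c\<close> as a
  bare function spares a second induction over the algebra of \<open>x\<close>.\<close>

lemma lambda1_alg:
  assumes "selfadjoint x" "C \<in> unital_algebra {lambda1 \<xi>1 \<xi>2 T x}"
  shows "\<exists>c. \<forall>h. \<forall>w\<in>WN 1. C (lt1 h w) = lt1 (c h) w"
  using assms(2)
proof induction
  case unit
  then show ?case by (intro exI[of _ id]) simp
next
  case (gen A)
  then show ?case using lambda1(2)[OF assms(1)] by (intro exI[of _ x]) simp
next
  case (add A B)
  then obtain c d where "\<forall>h. \<forall>w\<in>WN 1. A (lt1 h w) = lt1 (c h) w" "\<forall>h. \<forall>w\<in>WN 1. B (lt1 h w) = lt1 (d h) w"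
    by blast
  then show ?case by (intro exI[of _ "\<lambda>h. c h + d h"]) (simp add: lt1_add)
next
  case (scale A c)
  then obtain d where "\<forall>h. \<forall>w\<in>WN 1. A (lt1 h w) = lt1 (d h) w" by blast
  then show ?case by (intro exI[of _ "\<lambda>h. c *\<^sub>C d h"]) (simp add: lt1_scale)
next
  case (mult A B)
  then obtain c d where "\<forall>h. \<forall>w\<in>WN 1. A (lt1 h w) = lt1 (c h) w" "\<forall>h. \<forall>w\<in>WN 1. B (lt1 h w) = lt1 (d h) w"
    by blast
  then show ?case by (intro exI[of _ "\<lambda>h. c (d h)"]) simp
qed

lemma vacuum: "cinner \<Omega> \<Omega> = 1" "norm \<Omega> = 1"
proof -
  show "cinner \<Omega> \<Omega> = 1" using cinner_T[of "[]" "[]"] by simp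
  then have "complex_of_real ((norm \<Omega>)\<^sup>2) = complex_of_real 1" by (simp add: cinner_self)
  then have "(norm \<Omega>)\<^sup>2 = 1" using of_real_eq_iff by blast
  then show "norm \<Omega> = 1" using norm_ge_zero[of \<Omega>] by (simp add: power2_eq_1_iff)
qed

lemma cinner_T_vacuum: "w \<in> RW \<Longrightarrow> cinner (T w) \<Omega> = (if w = [] then 1 else 0)"
  using cinner_T[of w "[]"] by (cases w; cases "hd w") auto

lemma cinner_lt1_vacuum: "cinner (lt1 h []) \<Omega> = cinner h \<xi>1"
  using cinner_lt1[of "[]" "[]" h \<xi>1] lt1_unit[of "[]"] by simp

text \<open>The mechanism of freeness: on a word not starting in the first space, \<open>C\<close>
  puts \<open>c \<xi>1\<close> into the first factor, and the vanishing expectation makes this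
  vector orthogonal to \<xi>1, so the word simply grows by one letter.\<close>

lemma lambda1_alg_word:
  assumes "selfadjoint x" "C \<in> unital_algebra {lambda1 \<xi>1 \<xi>2 T x}" "vstate \<Omega> C = 0" "w \<in> WN 1"
  shows "\<exists>h. Inl h # w \<in> RW \<and> C (T w) = T (Inl h # w)"
proof -
  obtain c where c: "\<And>h w. w \<in> WN 1 \<Longrightarrow> C (lt1 h w) = lt1 (c h) w"
    using lambda1_alg[OF assms(1,2)] by blast
  have "C \<Omega> = lt1 (c \<xi>1) []" using c[of "[]" \<xi>1] by (simp add: lt1_unit)
  then have "cinner (c \<xi>1) \<xi>1 = 0" using assms(3) by (simp add: vstate_def cinner_lt1_vacuum)
  then show ?thesis
    using c[of w \<xi>1] assms(4) by (intro exI[of _ "c \<xi>1"]) (simp add: lt1_unit lt1_orth RW_Cons)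
qed

lemma vstate_lambda1_funpow:
  assumes "selfadjoint x"
  shows "vstate \<Omega> (lambda1 \<xi>1 \<xi>2 T x ^^ n) = vstate \<xi>1 (x ^^ n)"
proof -
  have "(lambda1 \<xi>1 \<xi>2 T x ^^ n) \<Omega> = lt1 ((x ^^ n) \<xi>1) []"
    by (induction n) (simp_all add: lt1_unit lambda1(2)[OF assms])
  then show ?thesis by (simp add: vstate_def cinner_lt1_vacuum)
qed

text \<open>The words inside and outside \<open>A\<close> span orthogonal subspaces. By Pythagoras,
  dropping the outside terms of a combination is contractive, hence extends to a bounded operator,
  which is the orthogonal projection onto the closed span.\<close>

lemma word_projection:
  assumes "A \<subseteq> RW" and orth: "\<forall>v\<in>A. \<forall>w\<in>RW - A. word_cinner v w = 0"
  obtains P where "bounded_clinear P"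
    "\<And>w. w \<in> RW \<Longrightarrow> P (T w) = (if w \<in> A then T w else 0)"
    "\<And>x. P x \<in> closure (cspan (T ` A))"
    "\<And>x s. s \<in> closure (cspan (T ` A)) \<Longrightarrow> cinner (x - P x) s = 0"
    "\<And>s. s \<in> closure (cspan (T ` A)) \<Longrightarrow> P s = s"
proof -
  define g where "g w = (if w \<in> A then T w else 0)" for w
  define g' where "g' w = (if w \<in> A then 0 else T w)" for w
  have orth': "cinner (g' v) (g w) = 0" if "v \<in> RW" "w \<in> RW" for v w
  proof -
    have "cinner (T v) (T w) = 0" if "w \<in> A" "v \<notin> A"
      using orth that \<open>v \<in> RW\<close> \<open>w \<in> RW\<close> cinner_T[of w v] cinner_commute[of "T v" "T w"] by simp
    then show ?thesis by (simp add: g_def g'_def)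
  qed
  have "norm (lcomb g xs) \<le> 1 * norm (lcomb T xs)" if "snd ` set xs \<subseteq> RW" for xs
  proof -
    have "cinner (lcomb g' xs) (lcomb g xs) = cinner (lcomb (\<lambda>_. 0) xs) (lcomb (\<lambda>_. 0 :: 'h) xs)"
      by (rule lcomb_cinner_cong) (metis cinner_zero_left orth' subsetD that)
    also have "lcomb (\<lambda>_. 0 :: 'h) xs = 0" by (induction xs) auto
    finally have "(norm (lcomb g' xs + lcomb g xs))\<^sup>2 = (norm (lcomb g' xs))\<^sup>2 + (norm (lcomb g xs))\<^sup>2"
      by (intro Pythagoras) simp
    moreover have "lcomb g' xs + lcomb g xs = lcomb T xs"
      by (induction xs) (auto simp: g_def g'_def algebra_simps)
    ultimately have "(norm (lcomb g xs))\<^sup>2 \<le> (norm (lcomb T xs))\<^sup>2" by simp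
    then show ?thesis by (simp add: power2_le_iff_abs_le)
  qed
  then obtain P where P: "bounded_clinear P" "\<And>w. w \<in> RW \<Longrightarrow> P (T w) = g w"
    using bounded_clinear_extension[OF total] by metis
  have range: "L x \<in> closure (cspan (T ` B))"
    if L: "bounded_clinear L" and "\<And>w. w \<in> RW \<Longrightarrow> L (T w) \<in> cspan (T ` B)" for L B x
  proof -
    have "L x \<in> cspan (T ` B)" if "x \<in> cspan (T ` RW)" for x
      using that
    proof (induction rule: complex_space.span_induct_alt)
      case (step c x y)
      then show ?case
        using \<open>\<And>w. w \<in> RW \<Longrightarrow> L (T w) \<in> cspan (T ` B)\<close>
        by (auto simp: bounded_clinear_add[OF L] bounded_clinear_scaleC[OF L]
            intro!: complex_space.span_add complex_space.span_scale)
    qed (simp add: bounded_clinear_zero[OF L] complex_space.span_zero)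
    then have "L ` closure (cspan (T ` RW)) \<subseteq> closure (cspan (T ` B))"
      using closure_subset by (intro image_closure_subset bounded_clinear_continuous_on[OF L]) blast+
    then show ?thesis by (auto simp: total)
  qed
  have ran: "P x \<in> closure (cspan (T ` A))" for x
    by (rule range[OF P(1)]) (auto simp: P(2) g_def complex_space.span_zero intro: complex_space.span_base)
  have compl: "x - P x \<in> closure (cspan (T ` (RW - A)))" for x
    by (rule range[OF bounded_clinear_minus[OF bounded_clinear_id P(1)]])
      (auto simp: P(2) g_def complex_space.span_zero intro: complex_space.span_base)
  show ?thesis
  proof
    show "P (T w) = (if w \<in> A then T w else 0)" if "w \<in> RW" for w
      using P(2)[OF that] by (simp add: g_def)
    show "cinner (x - P x) s = 0" if "s \<in> closure (cspan (T ` A))" for x s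
    proof (rule cinner_eq_0_closure_cspan[OF _ compl that])
      fix u v assume "u \<in> T ` (RW - A)" "v \<in> T ` A"
      then show "cinner u v = 0" using orth' \<open>A \<subseteq> RW\<close> by (auto simp: g_def g'_def)
          (metis (full_types) subsetD)
    qed
    show "P s = s" if "s \<in> closure (cspan (T ` A))" for s
    proof -
      have "P s - s = 0"
        by (rule bounded_clinear_eq_0_on_closure_cspan[OF bounded_clinear_minus[OF P(1) bounded_clinear_id] _ that])
          (use P(2) \<open>A \<subseteq> RW\<close> in \<open>auto simp: g_def\<close>)
      then show ?thesis by simp
    qed
  qed (fact P(1) ran)+
qed

text \<open>The range consists of words of length n - 1 not starting in the space \<open>j\<close>
  and of words of length \<open>n\<close> starting in it, that is, of the words of depth n - 1.
  Words of different length are orthogonal, so the projection is the sum of two word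
  projections.\<close>

lemma level_proj:
  assumes j: "j = 1 \<or> j = 2" and "n \<ge> 1"
  shows "bounded_clinear (level_proj \<xi>1 \<xi>2 T j n)"
    and "w \<in> RW \<Longrightarrow> level_proj \<xi>1 \<xi>2 T j n (T w) = (if depth j w = n - 1 then T w else 0)"
proof -
  define A1 where "A1 = {w \<in> WN j. length w = n - 1}"
  define A2 where "A2 = {w \<in> WN (other_index j). length w = n}"
  have orth: "\<forall>v\<in>{w \<in> WN i. length w = m}. \<forall>w\<in>RW - {w \<in> WN i. length w = m}. word_cinner v w = 0" for i m
  proof (intro ballI, rule ccontr)
    fix v w assume that: "v \<in> {w \<in> WN i. length w = m}" "w \<in> RW - {w \<in> WN i. length w = m}"
    assume "word_cinner v w \<noteq> 0"
    then have "map letter_index v = map letter_index w" by (rule word_cinner_nonzero)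
    then have "length v = length w" "v \<noteq> [] \<Longrightarrow> letter_index (hd v) = letter_index (hd w)"
      by (metis length_map, metis list.map_disc_iff list.map_sel(1))
    then show False using that by (auto simp: words_not_from_def)
  qed
  have sub: "{w \<in> WN i. length w = m} \<subseteq> RW" for i m by (auto simp: WN_RW)
  obtain P1 where P1: "bounded_clinear P1" 
    "\<And>w. w \<in> RW \<Longrightarrow> P1 (T w) = (if w \<in> A1 then T w else 0)"
    "\<And>x. P1 x \<in> closure (cspan (T ` A1))"
    "\<And>x s. s \<in> closure (cspan (T ` A1)) \<Longrightarrow> cinner (x - P1 x) s = 0"
    "\<And>s. s \<in> closure (cspan (T ` A1)) \<Longrightarrow> P1 s = s"
    by (rule word_projection[OF sub[of "j" "n - 1"] orth[of "j" "n - 1"], folded A1_def]) (rule that)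
  obtain P2 where P2: "bounded_clinear P2" 
    "\<And>w. w \<in> RW \<Longrightarrow> P2 (T w) = (if w \<in> A2 then T w else 0)"
    "\<And>x. P2 x \<in> closure (cspan (T ` A2))"
    "\<And>x s. s \<in> closure (cspan (T ` A2)) \<Longrightarrow> cinner (x - P2 x) s = 0"
    "\<And>s. s \<in> closure (cspan (T ` A2)) \<Longrightarrow> P2 s = s"
    by (rule word_projection[OF sub[of "other_index j" "n"] orth[of "other_index j" "n"], folded A2_def]) (rule that)
  have cross: "cinner u v = 0" if "u \<in> closure (cspan (T ` A1))" "v \<in> closure (cspan (T ` A2))" for u v
  proof (rule cinner_eq_0_closure_cspan[OF _ that])
    fix u v assume "u \<in> T ` A1" "v \<in> T ` A2"
    then obtain a b where ab: "u = T a" "v = T b" "a \<in> RW" "b \<in> RW" "length a = n - 1" "length b = n"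
      by (auto simp: A1_def A2_def WN_RW)
    have "word_cinner a b = 0"
    proof (rule ccontr)
      assume "word_cinner a b \<noteq> 0"
      then have "length a = length b" using word_cinner_nonzero map_eq_imp_length_eq by blast
      then show False using ab \<open>n \<ge> 1\<close> by simp
    qed
    then show "cinner u v = 0" using ab cinner_T by simp
  qed
  have cross': "cinner v u = 0" if "u \<in> closure (cspan (T ` A1))" "v \<in> closure (cspan (T ` A2))" for u v
    using cross[OF that] by (metis cinner_commute complex_cnj_zero)
  have eq: "level_proj \<xi>1 \<xi>2 T j n = (\<lambda>x. P1 x + P2 x)"
  proof
    fix x
    have lev: "level \<xi>1 \<xi>2 T (n - 1) j = closure (cspan (T ` A1))"
      "level \<xi>1 \<xi>2 T n (other_index j) = closure (cspan (T ` A2))"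
      by (simp_all add: level_def A1_def A2_def)
    show "level_proj \<xi>1 \<xi>2 T j n x = P1 x + P2 x"
      unfolding level_proj_def lev
    proof (rule orth_proj_eqI)
      show "P1 x + P2 x \<in> {u + v |u v. u \<in> closure (cspan (T ` A1)) \<and> v \<in> closure (cspan (T ` A2))}"
        using P1(3) P2(3) by blast
      show "cinner (x - (P1 x + P2 x)) s = 0"
        if "s \<in> {u + v |u v. u \<in> closure (cspan (T ` A1)) \<and> v \<in> closure (cspan (T ` A2))}" for s
      proof -
        obtain u v where s: "s = u + v" and u: "u \<in> closure (cspan (T ` A1))" and v: "v \<in> closure (cspan (T ` A2))"
          using \<open>s \<in> _\<close> by blast
        have "cinner (x - P1 x) u = 0" "cinner (x - P2 x) v = 0" "cinner (P2 x) u = 0" "cinner (P1 x) v = 0"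
          using P1(4)[OF u] P2(4)[OF v] cross'[OF u P2(3)] cross[OF P1(3) v] by blast+
        then show ?thesis
          unfolding s cinner_add_right by (simp add: cinner.diff_left cinner_add_left)
      qed
      show "s - s' \<in> {u + v |u v. u \<in> closure (cspan (T ` A1)) \<and> v \<in> closure (cspan (T ` A2))}"
        if "s \<in> {u + v |u v. u \<in> closure (cspan (T ` A1)) \<and> v \<in> closure (cspan (T ` A2))}"
          "s' \<in> {u + v |u v. u \<in> closure (cspan (T ` A1)) \<and> v \<in> closure (cspan (T ` A2))}" for s s'
      proof -
        obtain u v u' v' where s: "s = u + v" "s' = u' + v'"
          and uv: "u \<in> closure (cspan (T ` A1))" "v \<in> closure (cspan (T ` A2))"
            "u' \<in> closure (cspan (T ` A1))" "v' \<in> closure (cspan (T ` A2))"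
          using \<open>s \<in> _\<close> \<open>s' \<in> _\<close> by blast
        have "u - u' = P1 (u - u')" "v - v' = P2 (v - v')"
          using uv by (simp_all add: bounded_clinear_diff[OF P1(1)] bounded_clinear_diff[OF P2(1)] P1(5) P2(5))
        then have "u - u' \<in> closure (cspan (T ` A1))" "v - v' \<in> closure (cspan (T ` A2))"
          using P1(3) P2(3) by metis+
        moreover have "s - s' = (u - u') + (v - v')" by (simp add: s)
        ultimately show ?thesis by blast
      qed
    qed
  qed
  show "bounded_clinear (level_proj \<xi>1 \<xi>2 T j n)"
    unfolding eq by (rule bounded_clinear_plus[OF P1(1) P2(1)])
  show "level_proj \<xi>1 \<xi>2 T j n (T w) = (if depth j w = n - 1 then T w else 0)" if "w \<in> RW"
  proof -
    have len: "w \<noteq> [] \<Longrightarrow> length w \<ge> 1" by (cases w) simp_all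
    have "(w \<in> A1 \<or> w \<in> A2) \<longleftrightarrow> depth j w = n - 1" "\<not> (w \<in> A1 \<and> w \<in> A2)"
      using that \<open>n \<ge> 1\<close> j letter_index_range[of "hd w"] len
      by (auto simp: A1_def A2_def depth_def words_not_from_def)
    then show ?thesis using that by (auto simp: eq P1(2) P2(2))
  qed
qed

text \<open>Both words in h tensor \<open>T w\<close> have depth \<open>length w\<close>, so the
  level projection ignores the first factor. It therefore commutes with X_1, and compressing only
  selects a level.\<close>

lemma level_proj_lt1:
  assumes "w \<in> WN 1" "n \<ge> 1"
  shows "level_proj \<xi>1 \<xi>2 T 1 n (lt1 h w) = (if length w = n - 1 then lt1 h w else 0)"
proof -
  have "depth 1 w = length w" using assms(1) by (auto simp: depth_def words_not_from_def)
  moreover have "depth 1 (Inl g # w) = length w" for g by (simp add: depth_def)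
  moreover have "bounded_clinear (level_proj \<xi>1 \<xi>2 T 1 n)" using assms by (intro level_proj) simp_all
  ultimately show ?thesis
    using assms unfolding left_tensor_def
    by (simp add: level_proj(2) bounded_clinear_add bounded_clinear_scaleC RW_Cons centre_orth WN_RW)
qed

lemma compress_lambda1_lt1:
  assumes "selfadjoint x" "w \<in> WN 1" "n \<ge> 1"
  shows "compress \<xi>1 \<xi>2 T 1 (lambda1 \<xi>1 \<xi>2 T x) n (lt1 h w) = (if length w = n - 1 then lt1 (x h) w else 0)"
proof -
  have "bounded_clinear (lambda1 \<xi>1 \<xi>2 T x)" "bounded_clinear (level_proj \<xi>1 \<xi>2 T 1 n)"
    using assms lambda1 level_proj by simp_all
  then show ?thesis
    using assms by (simp add: compress_def level_proj_lt1 lambda1(2) bounded_clinear_zero)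
qed

lemma WN_flip: "map flip w \<in> words_not_from \<xi>2 \<xi>1 1 \<longleftrightarrow> w \<in> WN 2"
  using words_not_from_flip[of 1 w \<xi>2 \<xi>1] by simp

lemma lt2_unit: "w \<in> WN 2 \<Longrightarrow> lt2 \<xi>2 w = T w"
  using free_product.lt1_unit[OF swap, of "map flip w"] by (simp add: left_tensor_flip WN_flip)

lemma lt2_orth: "cinner h \<xi>2 = 0 \<Longrightarrow> w \<in> WN 2 \<Longrightarrow> lt2 h w = T (Inr h # w)"
  using free_product.lt1_orth[OF swap, of h "map flip w"] by (simp add: left_tensor_flip WN_flip)

lemma lambda2:
  assumes "selfadjoint x"
  shows "bounded_clinear (lambda2 \<xi>1 \<xi>2 T x)"
    and "w \<in> WN 2 \<Longrightarrow> lambda2 \<xi>1 \<xi>2 T x (lt2 h w) = lt2 (x h) w"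
  using free_product.lambda1(1)[OF swap assms] free_product.lambda1(2)[OF swap assms, of "map flip w"]
  by (simp_all add: left_tensor_flip WN_flip lambda_flip)

lemma selfadjoint_lambda2: "selfadjoint x \<Longrightarrow> selfadjoint (lambda2 \<xi>1 \<xi>2 T x)"
  using free_product.selfadjoint_lambda1[OF swap] by (simp add: lambda_flip)

lemma vstate_lambda2_funpow:
  "selfadjoint x \<Longrightarrow> vstate \<Omega> (lambda2 \<xi>1 \<xi>2 T x ^^ n) = vstate \<xi>2 (x ^^ n)"
  using free_product.vstate_lambda1_funpow[OF swap] by (simp add: lambda_flip)

lemma lambda2_alg_word:
  assumes "selfadjoint x" "C \<in> unital_algebra {lambda2 \<xi>1 \<xi>2 T x}" "vstate \<Omega> C = 0" "w \<in> WN 2"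
  shows "\<exists>h. Inr h # w \<in> RW \<and> C (T w) = T (Inr h # w)"
proof -
  obtain h where "Inl h # map flip w \<in> reduced_words \<xi>2 \<xi>1"
    "C (T (map flip (map flip w))) = T (map flip (Inl h # map flip w))"
    using free_product.lambda1_alg_word[OF swap assms(1), of C "map flip w"] assms
    unfolding lambda_flip WN_flip by auto
  then show ?thesis using reduced_words_flip[of "Inr h # w" \<xi>2 \<xi>1] by (intro exI[of _ h]) simp
qed

lemma compress_lambda2_lt2:
  assumes "selfadjoint x" "w \<in> WN 2" "n \<ge> 1"
  shows "compress \<xi>1 \<xi>2 T 2 (lambda2 \<xi>1 \<xi>2 T x) n (lt2 h w) = (if length w = n - 1 then lt2 (x h) w else 0)"
  using free_product.compress_lambda1_lt1[OF swap assms(1), of "map flip w" n] assms(2,3)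
  by (simp add: left_tensor_flip WN_flip lambda_flip compress_flip)

text \<open>By induction the product of centred factors maps the vacuum to a single nonempty word,
  whose first letter lies in the space of the leftmost factor; such a word is orthogonal to the
  vacuum.\<close>

lemma free_indep_lambda:
  assumes "selfadjoint x1" "selfadjoint x2"
  shows "free_indep \<Omega> (lambda1 \<xi>1 \<xi>2 T x1) (lambda2 \<xi>1 \<xi>2 T x2)"
  unfolding free_indep_def
proof (intro allI impI)
  let ?A = "lambda1 \<xi>1 \<xi>2 T x1" and ?B = "lambda2 \<xi>1 \<xi>2 T x2"
  fix cs :: "(bool \<times> ('h \<Rightarrow> 'h)) list"
  assume "cs \<noteq> []" "successively (\<lambda>p q. fst p \<noteq> fst q) cs"
    "\<forall>(i, C)\<in>set cs. C \<in> unital_algebra {if i then ?A else ?B} \<and> vstate \<Omega> C = 0"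
  then have "\<exists>w\<in>RW. w \<noteq> [] \<and> letter_index (hd w) = (if fst (hd cs) then 1 else 2) \<and>
      foldr (\<circ>) (map snd cs) id \<Omega> = T w"
  proof (induction cs)
    case (Cons p cs)
    obtain i C where p: "p = (i, C)" by force
    have C: "C \<in> unital_algebra {if i then ?A else ?B}" "vstate \<Omega> C = 0"
      using Cons.prems(3) p by auto
    obtain w where w: "w \<in> WN (if i then 1 else 2)" "foldr (\<circ>) (map snd cs) id \<Omega> = T w"
    proof (cases "cs = []")
      case True
      then show ?thesis using that[of "[]"] by simp
    next
      case False
      then have "i \<noteq> fst (hd cs)" "successively (\<lambda>p q. fst p \<noteq> fst q) cs"
        using Cons.prems(2) p by (auto simp: successively_Cons)
      then obtain w where "w \<in> RW" "letter_index (hd w) = (if fst (hd cs) then 1 else 2)" "w \<noteq> []"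
        "foldr (\<circ>) (map snd cs) id \<Omega> = T w"
        using Cons.IH[OF False] Cons.prems(3) by (metis (no_types, lifting) list.set_intros(2))
      then show ?thesis
        using \<open>i \<noteq> fst (hd cs)\<close> by (intro that[of w]) (auto simp: words_not_from_def)
    qed
    have fold: "foldr (\<circ>) (map snd (p # cs)) id \<Omega> = C (T w)"
      unfolding p w(2)[symmetric] by (simp only: list.map foldr.simps snd_conv comp_apply)
    show ?case
    proof (cases i)
      case True
      then obtain h where "Inl h # w \<in> RW" "C (T w) = T (Inl h # w)"
        using lambda1_alg_word[OF assms(1), of C w] C w(1) by auto
      then show ?thesis unfolding fold using True by (intro bexI[of _ "Inl h # w"]) (simp_all add: p)
    next
      case False
      then obtain h where "Inr h # w \<in> RW" "C (T w) = T (Inr h # w)"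
        using lambda2_alg_word[OF assms(2), of C w] C w(1) by auto
      then show ?thesis unfolding fold using False by (intro bexI[of _ "Inr h # w"]) (simp_all add: p)
    qed
  qed simp
  then obtain w where "w \<in> RW" "w \<noteq> []" "foldr (\<circ>) (map snd cs) id \<Omega> = T w" by blast
  then show "vstate \<Omega> (foldr (\<circ>) (map snd cs) id) = 0"
    by (simp add: vstate_def cinner_T_vacuum)
qed

end


section \<open>The compression X_2(1), the remainder Z_2 and appended letters\<close>

locale free_product_pair = free_product \<xi>1 \<xi>2 T
  for \<xi>1 :: "'a::chilbert_space" and \<xi>2 :: "'b::chilbert_space"
    and T :: "('a + 'b) list \<Rightarrow> 'h::chilbert_space" +
  fixes x1 :: "'a \<Rightarrow> 'a" and x2 :: "'b \<Rightarrow> 'b"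
  assumes selfadjoint: "selfadjoint x1" "selfadjoint x2"
begin

abbreviation X1 :: "'h \<Rightarrow> 'h" where "X1 \<equiv> lambda1 \<xi>1 \<xi>2 T x1"
abbreviation X2 :: "'h \<Rightarrow> 'h" where "X2 \<equiv> lambda2 \<xi>1 \<xi>2 T x2"
abbreviation P :: "'h \<Rightarrow> 'h" where "P \<equiv> level_proj \<xi>1 \<xi>2 T 2 1"
definition a :: "'h \<Rightarrow> 'h" where "a = compress \<xi>1 \<xi>2 T 2 X2 1"
definition b :: "'h \<Rightarrow> 'h" where "b h = X1 h + X2 h - a h"

lemma swap_pair: "free_product_pair \<xi>2 \<xi>1 (\<lambda>w. T (map flip w)) x2 x1"
  by (intro free_product_pair.intro swap free_product_pair_axioms.intro selfadjoint)

lemmas X1 = lambda1[OF selfadjoint(1)]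
lemmas X2 = lambda2[OF selfadjoint(2)]

lemma P_bounded_clinear: "bounded_clinear P"
  and P_T: "w \<in> RW \<Longrightarrow> P (T w) = (if depth 2 w = 0 then T w else 0)"
  using level_proj(1)[of 2 1] level_proj(2)[of 2 1 w] by simp_all

lemma a_eq: "a h = P (X2 (P h))"
  by (simp add: a_def compress_def)

lemma bounded_clinear_compress: 
  "j = 1 \<or> j = 2 \<Longrightarrow> n \<ge> 1 \<Longrightarrow> bounded_clinear X \<Longrightarrow> bounded_clinear (compress \<xi>1 \<xi>2 T j X n)"
  unfolding compress_def by (intro bounded_clinear_comp level_proj)

lemma a_bounded_clinear: "bounded_clinear a"
  unfolding a_def by (intro bounded_clinear_compress X2) simp_all

lemma b_bounded_clinear: "bounded_clinear b"
  unfolding b_def[abs_def] by (intro bounded_clinear_minus bounded_clinear_plus X1 X2 a_bounded_clinear)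

lemma P_selfadjoint: "cinner (P u) v = cinner u (P v)"
proof -
  have "selfadjoint P"
  proof (rule selfadjointI_total[OF P_bounded_clinear total])
    fix x y assume "x \<in> T ` RW" "y \<in> T ` RW"
    then obtain v w where vw: "v \<in> RW" "x = T v" "w \<in> RW" "y = T w" by blast
    have "word_cinner v w = 0 \<or> depth 2 v = depth 2 w"
      using word_cinner_nonzero depth_index_cong by blast
    then show "cinner (P x) y = cinner x (P y)"
      using vw by (auto simp: P_T cinner_T)
  qed
  then show ?thesis by (rule selfadjoint_cinner)
qed

lemma P_idem: "P (P h) = P h"
proof -
  have "P \<circ> P = P"
    by (rule bounded_clinear_eqI_total[OF bounded_clinear_comp[OF P_bounded_clinear P_bounded_clinear]
          P_bounded_clinear total]) (auto simp: P_T bounded_clinear_zero[OF P_bounded_clinear])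
  then show ?thesis by (metis comp_apply)
qed

lemma P_vacuum: "P \<Omega> = \<Omega>"
  using P_T[of "[]"] by (simp add: depth_def)

lemma a_selfadjoint: "selfadjoint a"
  unfolding selfadjoint_def
  using a_bounded_clinear selfadjoint_cinner[OF selfadjoint_lambda2[OF selfadjoint(2)]]
  by (simp add: a_eq P_selfadjoint)

lemma b_selfadjoint: "selfadjoint b"
  unfolding selfadjoint_def
  using b_bounded_clinear selfadjoint_cinner[OF selfadjoint_lambda2[OF selfadjoint(2)]]
    selfadjoint_cinner[OF selfadjoint_lambda1[OF selfadjoint(1)]] selfadjoint_cinner[OF a_selfadjoint]
  by (simp add: b_def cinner_add_left cinner_add_right cinner.diff_left cinner.diff_right)

lemma RW_cases2:
  assumes "w \<in> RW"
  obtains "w \<in> WN 2" | h u where "w = Inr h # u" "u \<in> WN 2" "cinner h \<xi>2 = 0"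
proof (cases w)
  case (Cons x u)
  then show ?thesis using assms that RW_Cons WN_Cons by (cases x) auto
qed (use that in simp)

lemma X1_T:
  "w \<in> WN 1 \<Longrightarrow> X1 (T w) = lt1 (x1 \<xi>1) w"
  "u \<in> WN 1 \<Longrightarrow> cinner h \<xi>1 = 0 \<Longrightarrow> X1 (T (Inl h # u)) = lt1 (x1 h) u"
  by (simp_all add: X1 flip: lt1_unit lt1_orth)

lemma X2_T:
  "w \<in> WN 2 \<Longrightarrow> X2 (T w) = lt2 (x2 \<xi>2) w"
  "u \<in> WN 2 \<Longrightarrow> cinner h \<xi>2 = 0 \<Longrightarrow> X2 (T (Inr h # u)) = lt2 (x2 h) u"
  by (simp_all add: X2 flip: lt2_unit lt2_orth)

lemma a_lt2: "w \<in> WN 2 \<Longrightarrow> a (lt2 h w) = (if w = [] then lt2 (x2 h) w else 0)"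
  unfolding a_def by (simp add: compress_lambda2_lt2[OF selfadjoint(2)])

lemma a_T:
  "w \<in> WN 2 \<Longrightarrow> a (T w) = (if w = [] then lt2 (x2 \<xi>2) w else 0)"
  "u \<in> WN 2 \<Longrightarrow> cinner h \<xi>2 = 0 \<Longrightarrow> a (T (Inr h # u)) = (if u = [] then lt2 (x2 h) u else 0)"
  by (simp_all add: a_lt2 flip: lt2_unit lt2_orth)

lemma vstate_a_funpow: "vstate \<Omega> (a ^^ n) = vstate \<xi>2 (x2 ^^ n)"
proof -
  have "(a ^^ n) \<Omega> = lt2 ((x2 ^^ n) \<xi>2) []"
    by (induction n) (simp_all add: lt2_unit a_lt2)
  moreover have "cinner (lt2 h []) \<Omega> = cinner h \<xi>2" for h
    using free_product.cinner_lt1_vacuum[OF swap, of h] by (simp add: left_tensor_flip)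
  ultimately show ?thesis by (simp add: vstate_def)
qed


text \<open>
  The span of the words of \<open>K\<close> contains the vacuum and is invariant under \<open>b\<close>. On it, \<open>b\<close> agrees with the
  series defining the s-free convolution, and \<open>b\<close> commutes with appending a last letter from the
  second space; the latter evaluates the compression of \<open>b ^^ n\<close> by \<open>P\<close>.
\<close>

definition K :: "('a + 'b) list set" where
  "K = {w \<in> RW. w = [] \<or> (\<exists>g. last w = Inl g)}"

text \<open>A relation between vectors with a common coding replaces the map that appends the
  letter. Concatenating codings makes it stable under linear operations, and neither
  well-definedness nor boundedness of that map has to be shown.\<close>

definition append_rel :: "'b \<Rightarrow> 'h \<Rightarrow> 'h \<Rightarrow> bool" where
  "append_rel k u u' \<longleftrightarrow> (\<exists>xs. snd ` set xs \<subseteq> K \<and> u = lcomb T xs \<and> u' = lcomb (\<lambda>w. T (w @ [Inr k])) xs)"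

lemma append_rel_add:
  assumes "append_rel k u u'" "append_rel k v v'"
  shows "append_rel k (u + v) (u' + v')"
proof -
  obtain xs ys where "snd ` set xs \<subseteq> K" "u = lcomb T xs" "u' = lcomb (\<lambda>w. T (w @ [Inr k])) xs"
    "snd ` set ys \<subseteq> K" "v = lcomb T ys" "v' = lcomb (\<lambda>w. T (w @ [Inr k])) ys"
    using assms unfolding append_rel_def by blast
  then show ?thesis unfolding append_rel_def by (intro exI[of _ "xs @ ys"]) (auto simp: image_Un)
qed

lemma append_rel_scale:
  assumes "append_rel k u u'"
  shows "append_rel k (c *\<^sub>C u) (c *\<^sub>C u')"
proof -
  obtain xs where "snd ` set xs \<subseteq> K" "u = lcomb T xs" "u' = lcomb (\<lambda>w. T (w @ [Inr k])) xs"
    using assms unfolding append_rel_def by blast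
  moreover have "snd ` set (map (\<lambda>(d, i). (c * d, i)) xs) = snd ` set xs" by force
  ultimately show ?thesis
    unfolding append_rel_def by (intro exI[of _ "map (\<lambda>(d, i). (c * d, i)) xs"]) (simp add: lcomb_scale)
qed

lemma append_rel_T: "w \<in> K \<Longrightarrow> append_rel k (T w) (T (w @ [Inr k]))"
  unfolding append_rel_def by (intro exI[of _ "[(1, w)]"]) (simp add: scaleC_one)

lemma append_rel_zero: "append_rel k 0 0"
  unfolding append_rel_def by (intro exI[of _ "[]"]) simp

lemma append_rel_map:
  assumes "bounded_clinear A" "\<And>w. w \<in> K \<Longrightarrow> append_rel k (A (T w)) (A (T (w @ [Inr k])))"
    and "append_rel k u u'"
  shows "append_rel k (A u) (A u')"
proof -
  obtain xs where "snd ` set xs \<subseteq> K" "u = lcomb T xs" "u' = lcomb (\<lambda>w. T (w @ [Inr k])) xs"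
    using assms unfolding append_rel_def by blast
  then show ?thesis
    unfolding \<open>u = _\<close> \<open>u' = _\<close> using \<open>snd ` set xs \<subseteq> K\<close>
  proof (induction xs arbitrary: u u')
    case Nil
    then show ?case by (simp add: bounded_clinear_zero[OF assms(1)] append_rel_zero)
  next
    case (Cons p xs)
    obtain c w where "p = (c, w)" by force
    then show ?case using Cons
      by (auto simp: bounded_clinear_add[OF assms(1)] bounded_clinear_scaleC[OF assms(1)]
          intro!: append_rel_add append_rel_scale assms(2))
  qed
qed

text \<open>For \<open>w = []\<close> and \<open>k\<close> orthogonal to \<xi>2 the second
  equivalence fails: the single letter \<open>Inr k\<close> ends in the second space.\<close>

lemma K_Cons: "Inl h # w \<in> K \<longleftrightarrow> cinner h \<xi>1 = 0 \<and> w \<in> K \<inter> WN 1"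
  "w \<noteq> [] \<Longrightarrow> Inr k # w \<in> K \<longleftrightarrow> cinner k \<xi>2 = 0 \<and> w \<in> K \<inter> WN 2"
  by (auto simp: K_def RW_Cons words_not_from_def)

lemma K_RW: "w \<in> K \<Longrightarrow> w \<in> RW"
  by (simp add: K_def)

lemma K_append:
  assumes "w \<in> K" "cinner k \<xi>2 = 0"
  shows "w @ [Inr k] \<in> RW"
  using assms by (auto simp: K_def reduced_words_def successively_append_iff)

lemma K_append_WN:
  assumes "w \<in> K" "cinner k \<xi>2 = 0"
  shows "w \<in> WN 1 \<Longrightarrow> w @ [Inr k] \<in> WN 1" "w \<in> WN 2 \<Longrightarrow> w \<noteq> [] \<Longrightarrow> w @ [Inr k] \<in> WN 2"
  using K_append[OF assms] by (cases w; auto simp: words_not_from_def)+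

lemma append_rel_lt1:
  assumes "w \<in> K" "w \<in> WN 1" "cinner k \<xi>2 = 0"
  shows "append_rel k (lt1 h w) (lt1 h (w @ [Inr k]))"
  using append_rel_add[OF append_rel_T[of "Inl (h - cinner h \<xi>1 *\<^sub>C \<xi>1) # w" k]
      append_rel_scale[OF append_rel_T[OF assms(1), of k], of "cinner h \<xi>1"]] assms
  by (simp add: left_tensor_def K_Cons centre_orth)

lemma centre_orth2: "cinner (h - cinner h \<xi>2 *\<^sub>C \<xi>2) \<xi>2 = 0"
  by (simp add: cinner.diff_left cinner_scaleC_left cinner_unit)

lemma append_rel_lt2:
  assumes "w \<in> K" "w \<in> WN 2" "w \<noteq> []" "cinner k \<xi>2 = 0"
  shows "append_rel k (lt2 h w) (lt2 h (w @ [Inr k]))"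
  using append_rel_add[OF append_rel_T[of "Inr (h - cinner h \<xi>2 *\<^sub>C \<xi>2) # w" k]
      append_rel_scale[OF append_rel_T[OF assms(1), of k], of "cinner h \<xi>2"]] assms
  by (simp add: left_tensor_def K_Cons centre_orth2)

lemma K_cases1:
  assumes "w \<in> K"
  obtains "w \<in> WN 1" | h u where "w = Inl h # u" "u \<in> K" "u \<in> WN 1" "cinner h \<xi>1 = 0"
  using RW_cases1[OF K_RW[OF assms]] K_Cons(1) assms by (metis IntD1)

lemma K_cases2:
  assumes "w \<in> K" "w \<noteq> []"
  obtains "w \<in> WN 2" | h u where "w = Inr h # u" "u \<in> K" "u \<in> WN 2" "u \<noteq> []" "cinner h \<xi>2 = 0"
proof (rule RW_cases2[OF K_RW[OF assms(1)]])
  fix h u assume *: "w = Inr h # u" "u \<in> WN 2" "cinner h \<xi>2 = 0"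
  then have "u \<noteq> []" using assms(1) by (auto simp: K_def)
  then show thesis using that(2)[of h u] * K_Cons(2) assms(1) by blast
qed (rule that(1))

lemma append_rel_X1:
  assumes "w \<in> K" and k: "cinner k \<xi>2 = 0"
  shows "append_rel k (X1 (T w)) (X1 (T (w @ [Inr k])))"
  using assms(1)
proof (rule K_cases1)
  assume "w \<in> WN 1"
  then show ?thesis using K_append_WN(1)[OF assms] append_rel_lt1[OF assms(1) _ k] by (simp add: X1_T)
next
  fix h u assume *: "w = Inl h # u" "u \<in> K" "u \<in> WN 1" "cinner h \<xi>1 = 0"
  then show ?thesis using K_append_WN(1)[OF *(2) k] append_rel_lt1[OF *(2) _ k] by (simp add: X1_T)
qed

text \<open>For the empty word both vectors vanish, since \<open>a\<close> coincides with X_2 on the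
  vacuum and on single letters of the second space. Otherwise \<open>a\<close> gives 0 and X_2 only
  touches the first factor, which a nonempty word separates from the appended letter.\<close>

lemma append_rel_X2_a:
  assumes "w \<in> K" and k: "cinner k \<xi>2 = 0"
  shows "append_rel k (X2 (T w) - a (T w)) (X2 (T (w @ [Inr k])) - a (T (w @ [Inr k])))"
proof (cases "w = []")
  case True
  then show ?thesis using k by (simp add: X2_T a_T append_rel_zero)
next
  case False
  show ?thesis using assms(1) False
  proof (rule K_cases2)
    assume "w \<in> WN 2"
    then show ?thesis
      using K_append_WN(2)[OF assms _ False] append_rel_lt2[OF assms(1) _ False k] False by (simp add: X2_T a_T)
  next
    fix h u assume *: "w = Inr h # u" "u \<in> K" "u \<in> WN 2" "u \<noteq> []" "cinner h \<xi>2 = 0"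
    then show ?thesis
      using K_append_WN(2)[OF *(2) k] append_rel_lt2[OF *(2) _ *(4) k] by (simp add: X2_T a_T)
  qed
qed

lemma append_rel_b_funpow:
  assumes k: "cinner k \<xi>2 = 0"
  shows "append_rel k ((b ^^ n) \<Omega>) ((b ^^ n) (T [Inr k]))"
proof (induction n)
  case 0
  show ?case using append_rel_T[of "[]" k] by (simp add: K_def)
next
  case (Suc n)
  have "append_rel k (b (T w)) (b (T (w @ [Inr k])))" if "w \<in> K" for w
    using append_rel_add[OF append_rel_X1[OF that k] append_rel_X2_a[OF that k]]
    by (simp add: b_def algebra_simps)
  then show ?case using append_rel_map[OF b_bounded_clinear _ Suc] by simp
qed

text \<open>The words of depth 0 for index 2 are the empty word and the single letters of the second
  space. The only one in \<open>K\<close> is the empty word, and \<open>w @ [Inr k]\<close> is one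
  only for \<open>w = []\<close>; so \<open>P\<close> sees just the vacuum coefficient of
  \<open>u\<close>.\<close>

lemma append_rel_P:
  assumes "append_rel k u u'" and k: "cinner k \<xi>2 = 0"
  shows "P u = cinner u \<Omega> *\<^sub>C \<Omega>" "P u' = cinner u \<Omega> *\<^sub>C T [Inr k]"
proof -
  obtain xs where xs: "snd ` set xs \<subseteq> K" "u = lcomb T xs" "u' = lcomb (\<lambda>w. T (w @ [Inr k])) xs"
    using assms unfolding append_rel_def by blast
  have 1: "P (T w) = cinner (T w) \<Omega> *\<^sub>C \<Omega>" if "w \<in> K" for w
  proof (cases w)
    case Nil
    then show ?thesis by (simp add: P_vacuum vacuum scaleC_one)
  next
    case (Cons y v)
    then have "depth 2 w \<noteq> 0" using that by (cases v) (auto simp: depth_def K_def)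
    moreover have "w \<noteq> []" using Cons by simp
    ultimately show ?thesis
      by (simp add: P_T[OF K_RW[OF that]] cinner_T_vacuum[OF K_RW[OF that]] scaleC.zero_left)
  qed
  have 2: "P (T (w @ [Inr k])) = cinner (T w) \<Omega> *\<^sub>C T [Inr k]" if "w \<in> K" for w
  proof (cases w)
    case Nil
    have "[Inr k] \<in> RW" using k by (simp add: RW_Cons)
    then show ?thesis using Nil by (simp add: P_T depth_def vacuum scaleC_one)
  next
    case (Cons y v)
    then have "depth 2 (w @ [Inr k]) \<noteq> 0" by (simp add: depth_def)
    moreover have "w \<noteq> []" using Cons by simp
    ultimately show ?thesis
      by (simp add: P_T[OF K_append[OF that k]] cinner_T_vacuum[OF K_RW[OF that]] scaleC.zero_left)
  qed
  have "P (lcomb T xs) = cinner (lcomb T xs) \<Omega> *\<^sub>C \<Omega> \<and>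
      P (lcomb (\<lambda>w. T (w @ [Inr k])) xs) = cinner (lcomb T xs) \<Omega> *\<^sub>C T [Inr k]"
    using xs(1)
  proof (induction xs)
    case Nil
    then show ?case by (simp add: bounded_clinear_zero[OF P_bounded_clinear] scaleC.zero_left)
  next
    case (Cons p xs)
    obtain c w where p: "p = (c, w)" by force
    then have "w \<in> K" using Cons.prems by simp
    then show ?case using Cons 1 2 p
      by (simp add: bounded_clinear_add[OF P_bounded_clinear] bounded_clinear_scaleC[OF P_bounded_clinear]
          cinner_add_left cinner_scaleC_left scaleC_add_left scaleC_scaleC)
  qed
  then show "P u = cinner u \<Omega> *\<^sub>C \<Omega>" "P u' = cinner u \<Omega> *\<^sub>C T [Inr k]" using xs by simp_all
qed

lemma P_b_funpow_P:
  assumes "v \<in> cspan (T ` RW)"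
  shows "P ((b ^^ n) (P v)) = vstate \<Omega> (b ^^ n) *\<^sub>C P v"
proof -
  note lin = bounded_clinear_add[OF P_bounded_clinear] bounded_clinear_scaleC[OF P_bounded_clinear]
    bounded_clinear_zero[OF P_bounded_clinear]
    bounded_clinear_add[OF bounded_clinear_funpow[OF b_bounded_clinear]]
    bounded_clinear_scaleC[OF bounded_clinear_funpow[OF b_bounded_clinear]]
    bounded_clinear_zero[OF bounded_clinear_funpow[OF b_bounded_clinear]]
  have T: "P ((b ^^ n) (P (T w))) = vstate \<Omega> (b ^^ n) *\<^sub>C P (T w)" if w: "w \<in> RW" for w
  proof (cases "depth 2 w = 0")
    case True
    then consider "w = []" | k where "w = [Inr k]" "cinner k \<xi>2 = 0"
      using w by (cases w; cases "hd w") (auto simp: depth_def RW_Cons split: if_splits)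
    then show ?thesis
    proof cases
      case 1
      then show ?thesis
        \<comment> \<open>Only the vacuum side of the relation is used here; the letter 0 is an
          admissible choice.\<close>
        using append_rel_P(1)[OF append_rel_b_funpow, of 0 n] P_vacuum by (simp add: vstate_def)
    next
      case 2
      then show ?thesis
        using append_rel_P(2)[OF append_rel_b_funpow, of k n] that True by (simp add: vstate_def P_T)
    qed
  qed (simp add: P_T that lin)
  show ?thesis
    using assms
  proof (induction rule: complex_space.span_induct_alt)
    case (step c x y)
    then show ?case using T by (auto simp: lin scaleC_add_right scaleC_scaleC mult.commute)
  qed (simp add: lin)
qed

section \<open>Invariance of the span of words, and monotone independence\<close>

lemma preserves_words:
  assumes "bounded_clinear A" "\<And>w. w \<in> RW \<Longrightarrow> A (T w) \<in> cspan (T ` RW)" "v \<in> cspan (T ` RW)"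
  shows "A v \<in> cspan (T ` RW)"
  using assms(3)
proof (induction rule: complex_space.span_induct_alt)
  case (step c x y)
  then show ?case
    using assms(2) by (auto simp: bounded_clinear_add[OF assms(1)] bounded_clinear_scaleC[OF assms(1)]
        intro!: complex_space.span_add complex_space.span_scale)
qed (simp add: bounded_clinear_zero[OF assms(1)] complex_space.span_zero)

lemma T_cspan: "w \<in> RW \<Longrightarrow> T w \<in> cspan (T ` RW)"
  by (simp add: complex_space.span_base)

lemma lt_cspan:
  "w \<in> WN 1 \<Longrightarrow> lt1 h w \<in> cspan (T ` RW)" "w \<in> WN 2 \<Longrightarrow> lt2 k w \<in> cspan (T ` RW)"
  unfolding left_tensor_def
  by (intro complex_space.span_add complex_space.span_scale T_cspan;
      simp add: RW_Cons centre_orth centre_orth2 WN_RW)+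

lemma X1_cspan: "v \<in> cspan (T ` RW) \<Longrightarrow> X1 v \<in> cspan (T ` RW)"
  by (erule preserves_words[OF X1(1), rotated], erule RW_cases1) (auto simp: X1_T lt_cspan)

lemma X2_cspan: "v \<in> cspan (T ` RW) \<Longrightarrow> X2 v \<in> cspan (T ` RW)"
  by (erule preserves_words[OF X2(1), rotated], erule RW_cases2) (auto simp: X2_T lt_cspan)

lemma P_cspan: "v \<in> cspan (T ` RW) \<Longrightarrow> P v \<in> cspan (T ` RW)"
  by (erule preserves_words[OF P_bounded_clinear, rotated]) (auto simp: P_T T_cspan complex_space.span_zero)

lemma a_cspan: "v \<in> cspan (T ` RW) \<Longrightarrow> a v \<in> cspan (T ` RW)"
  by (simp add: a_eq P_cspan X2_cspan)

lemma b_cspan: "v \<in> cspan (T ` RW) \<Longrightarrow> b v \<in> cspan (T ` RW)"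
  by (simp add: b_def a_cspan X1_cspan X2_cspan complex_space.span_add complex_space.span_diff)

lemma alg_cspan:
  assumes "C \<in> unital_algebra {a, b}" "v \<in> cspan (T ` RW)"
  shows "C v \<in> cspan (T ` RW)"
  using assms
  by (induction arbitrary: v)
    (auto intro: a_cspan b_cspan complex_space.span_add complex_space.span_scale)

lemma a_b_funpow_a:
  assumes "v \<in> cspan (T ` RW)"
  shows "a ((b ^^ n) (a v)) = vstate \<Omega> (b ^^ n) *\<^sub>C a (a v)"
proof -
  have "a ((b ^^ n) (a v)) = P (X2 (P ((b ^^ n) (P (X2 (P v))))))" by (simp add: a_eq)
  also have "\<dots> = vstate \<Omega> (b ^^ n) *\<^sub>C P (X2 (P (X2 (P v))))"
    by (simp add: P_b_funpow_P X2_cspan P_cspan assms bounded_clinear_scaleC[OF X2(1)]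
        bounded_clinear_scaleC[OF P_bounded_clinear])
  also have "\<dots> = vstate \<Omega> (b ^^ n) *\<^sub>C a (a v)" by (simp add: a_eq P_idem)
  finally show ?thesis .
qed

lemma monotone_indep_ab: "monotone_indep \<Omega> a b"
  unfolding monotone_indep_def
proof (intro allI impI ballI conjI)
  fix n w w1 w2
  assume w: "w \<in> unital_algebra {a, b}" and w1: "w1 \<in> unital_algebra {a, b}" and w2: "w2 \<in> unital_algebra {a, b}"
  have lin: "bounded_clinear C" if "C \<in> unital_algebra {a, b}" for C
    by (rule bounded_clinear_unital_algebra[OF _ that]) (use a_bounded_clinear b_bounded_clinear in blast)
  have \<Omega>: "\<Omega> \<in> cspan (T ` RW)" by (simp add: T_cspan)
  show "vstate \<Omega> (w1 \<circ> a \<circ> (b ^^ n) \<circ> a \<circ> w2) = vstate \<Omega> (b ^^ n) * vstate \<Omega> (w1 \<circ> (a ^^ 2) \<circ> w2)"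
    using a_b_funpow_a[OF alg_cspan[OF w2 \<Omega>], of n]
    by (simp add: vstate_def bounded_clinear_scaleC[OF lin[OF w1]] cinner_scaleC_left numeral_2_eq_2)
  have "a ((b ^^ n) \<Omega>) = vstate \<Omega> (b ^^ n) *\<^sub>C a \<Omega>"
  proof -
    have "a ((b ^^ n) \<Omega>) = P (X2 (P ((b ^^ n) (P \<Omega>))))" by (simp add: a_eq P_vacuum)
    also have "\<dots> = vstate \<Omega> (b ^^ n) *\<^sub>C P (X2 (P \<Omega>))"
      by (simp only: P_b_funpow_P[OF \<Omega>] bounded_clinear_scaleC[OF X2(1)] bounded_clinear_scaleC[OF P_bounded_clinear])
    finally show ?thesis by (simp add: a_eq)
  qed
  then show "vstate \<Omega> (w \<circ> a \<circ> (b ^^ n)) = vstate \<Omega> (b ^^ n) * vstate \<Omega> (w \<circ> a)"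
    by (simp add: vstate_def bounded_clinear_scaleC[OF lin[OF w]] cinner_scaleC_left)
  have "cinner ((b ^^ n) (a v)) \<Omega> = vstate \<Omega> (b ^^ n) * cinner (a v) \<Omega>" if "v \<in> cspan (T ` RW)" for v
  proof -
    \<comment> \<open>The self-adjoint \<open>P\<close> fixes the vacuum, so it can be inserted to
      the left of \<open>b ^^ n\<close>.\<close>
    have "cinner ((b ^^ n) (a v)) \<Omega> = cinner (P ((b ^^ n) (P (X2 (P v))))) \<Omega>"
      by (subst P_selfadjoint) (simp add: a_eq P_vacuum)
    also have "\<dots> = vstate \<Omega> (b ^^ n) * cinner (a v) \<Omega>"
      by (simp add: P_b_funpow_P X2_cspan P_cspan that cinner_scaleC_left a_eq)
    finally show ?thesis .
  qed
  then show "vstate \<Omega> ((b ^^ n) \<circ> a \<circ> w) = vstate \<Omega> (b ^^ n) * vstate \<Omega> (a \<circ> w)"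
    using alg_cspan[OF w \<Omega>] by (simp add: vstate_def)
qed

section \<open>Agreement of Z_2 with the s-free series\<close>

lemma alternating_parity:
  "successively (\<lambda>u v. letter_index u \<noteq> letter_index v) w \<Longrightarrow> w \<noteq> [] \<Longrightarrow> last w = Inl g \<Longrightarrow>
    odd (length w) \<longleftrightarrow> letter_index (hd w) = 1"
proof (induction w)
  case (Cons u w)
  show ?case
  proof (cases "w = []")
    case False
    then have "odd (length w) \<longleftrightarrow> letter_index (hd w) = 1" "letter_index u \<noteq> letter_index (hd w)"
      using Cons by (auto simp: successively_Cons)
    then show ?thesis
      using letter_index_range[of u] letter_index_range[of "hd w"] by auto
  qed (use Cons in simp)
qed simp

text \<open>Words of \<open>K\<close> end in the first space, so the first letter fixes the parity
  of the length. This is why the s-free series consists of the odd levels of X_1 and the even levels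
  of X_2.\<close>

lemma K_parity:
  assumes "w \<in> K"
  shows "w \<in> WN 1 \<Longrightarrow> even (length w)" "w \<in> WN 2 \<Longrightarrow> w \<noteq> [] \<Longrightarrow> odd (length w)"
proof -
  have *: "odd (length w) \<longleftrightarrow> letter_index (hd w) = 1" if "w \<noteq> []"
    using alternating_parity[of w] assms that by (auto simp: K_def reduced_words_def)
  show "w \<in> WN 1 \<Longrightarrow> even (length w)" using * by (cases "w = []") (auto simp: words_not_from_def)
  show "w \<in> WN 2 \<Longrightarrow> w \<noteq> [] \<Longrightarrow> odd (length w)"
    using * letter_index_range[of "hd w"] by (auto simp: words_not_from_def)
qed

lemma sums_compress_X1:
  assumes "w \<in> K"
  shows "(\<lambda>r. compress \<xi>1 \<xi>2 T 1 X1 (2 * r + 1) (T w)) sums X1 (T w)"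
proof -
  have *: "(\<lambda>r. compress \<xi>1 \<xi>2 T 1 X1 (2 * r + 1) (lt1 h u)) sums X1 (lt1 h u)" if "u \<in> K" "u \<in> WN 1" for h u
  proof -
    \<comment> \<open>Level 2 r + 1 selects length 2 r; as the length of \<open>u\<close> is even,
      exactly one level acts on this vector.\<close>
    have "(length u = 2 * r) = (r = length u div 2)" for r
      using K_parity(1)[OF that] by auto
    then have "(\<lambda>r. compress \<xi>1 \<xi>2 T 1 X1 (2 * r + 1) (lt1 h u))
        = (\<lambda>r. if r = length u div 2 then lt1 (x1 h) u else 0)"
      using that by (simp add: compress_lambda1_lt1[OF selfadjoint(1)])
    then show ?thesis using sums_single[of "length u div 2" "\<lambda>_. lt1 (x1 h) u"] that by (simp add: X1)
  qed
  show ?thesis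
    using assms
  proof (rule K_cases1)
    assume "w \<in> WN 1"
    then show ?thesis using *[OF assms, of \<xi>1] by (simp add: lt1_unit)
  next
    fix h u assume "w = Inl h # u" "u \<in> K" "u \<in> WN 1" "cinner h \<xi>1 = 0"
    then show ?thesis using *[of u h] by (simp add: lt1_orth)
  qed
qed

lemma sums_compress_X2:
  assumes "w \<in> K"
  shows "(\<lambda>r. compress \<xi>1 \<xi>2 T 2 X2 (2 * (r + 1)) (T w)) sums (X2 (T w) - a (T w))"
proof (cases "w = []")
  case True
  \<comment> \<open>The even levels select odd lengths, so all of them annihilate the vacuum; the
    missing level 1 is \<open>a\<close>.\<close>
  have "compress \<xi>1 \<xi>2 T 2 X2 (2 * (r + 1)) (T []) = 0" for r
    using compress_lambda2_lt2[OF selfadjoint(2), of "[]" "2 * (r + 1)" \<xi>2] by (simp add: lt2_unit)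
  then show ?thesis using True by (simp add: X2_T a_T)
next
  case False
  have *: "(\<lambda>r. compress \<xi>1 \<xi>2 T 2 X2 (2 * (r + 1)) (lt2 h u)) sums (X2 (lt2 h u) - a (lt2 h u))"
    if "u \<in> K" "u \<in> WN 2" "u \<noteq> []" for h u
  proof -
    have "(length u = 2 * (r + 1) - 1) = (r = length u div 2)" for r
      using K_parity(2)[OF that] by (auto elim!: oddE)
    then have "(\<lambda>r. compress \<xi>1 \<xi>2 T 2 X2 (2 * (r + 1)) (lt2 h u))
        = (\<lambda>r. if r = length u div 2 then lt2 (x2 h) u else 0)"
      using that by (simp add: compress_lambda2_lt2[OF selfadjoint(2)])
    then show ?thesis
      using sums_single[of "length u div 2" "\<lambda>_. lt2 (x2 h) u"] that by (simp add: X2 a_lt2)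
  qed
  show ?thesis
    using assms False
  proof (rule K_cases2)
    assume "w \<in> WN 2"
    then show ?thesis using *[OF assms _ False, of \<xi>2] by (simp add: lt2_unit)
  next
    fix h u assume "w = Inr h # u" "u \<in> K" "u \<in> WN 2" "u \<noteq> []" "cinner h \<xi>2 = 0"
    then show ?thesis using *[of u h] by (simp add: lt2_orth)
  qed
qed

text \<open>On a single word of \<open>K\<close> each series has at most one nonzero term. Linearity
  covers finite combinations, and the vacuum orbit of \<open>b\<close> stays within these.\<close>

lemma s_free_sum_eq_b:
  assumes "snd ` set xs \<subseteq> K"
  shows "s_free_sum \<xi>1 \<xi>2 T x1 x2 (lcomb T xs) = b (lcomb T xs)"
proof -
  have *: "(\<lambda>r. C r (lcomb T xs)) sums D (lcomb T xs)"
    if C: "\<And>r. bounded_clinear (C r)" and D: "bounded_clinear D"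
      and "\<And>w. w \<in> K \<Longrightarrow> (\<lambda>r. C r (T w)) sums D (T w)" for C :: "nat \<Rightarrow> 'h \<Rightarrow> 'h" and D
    using assms
  proof (induction xs)
    case Nil
    then show ?case by (simp add: bounded_clinear_zero[OF C] bounded_clinear_zero[OF D])
  next
    case (Cons p xs)
    obtain c w where p: "p = (c, w)" by force
    then have "w \<in> K" using Cons.prems by simp
    then have "(\<lambda>r. c *\<^sub>C C r (T w) + C r (lcomb T xs)) sums (c *\<^sub>C D (T w) + D (lcomb T xs))"
      using Cons that(3) by (intro sums_add bounded_linear.sums[OF scaleC.bounded_linear_right]) simp_all
    then show ?case
      by (simp add: p bounded_clinear_add[OF C] bounded_clinear_scaleC[OF C]
          bounded_clinear_add[OF D] bounded_clinear_scaleC[OF D])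
  qed
  have "(\<lambda>r. compress \<xi>1 \<xi>2 T 1 X1 (2 * r + 1) (lcomb T xs)) sums X1 (lcomb T xs)"
    by (rule *[of "\<lambda>r. compress \<xi>1 \<xi>2 T 1 X1 (2 * r + 1)" X1])
      (simp_all add: bounded_clinear_compress X1(1) sums_compress_X1[simplified])
  moreover have "(\<lambda>r. compress \<xi>1 \<xi>2 T 2 X2 (2 * (r + 1)) (lcomb T xs)) sums (X2 (lcomb T xs) - a (lcomb T xs))"
    by (rule *[of "\<lambda>r. compress \<xi>1 \<xi>2 T 2 X2 (2 * (r + 1))" "\<lambda>h. X2 h - a h"])
      (simp_all add: bounded_clinear_compress bounded_clinear_minus a_bounded_clinear X2(1) sums_compress_X2[simplified])
  ultimately show ?thesis
    unfolding s_free_sum_def b_def by (simp add: sums_iff)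
qed

lemma vstate_s_free_sum: "vstate \<Omega> (s_free_sum \<xi>1 \<xi>2 T x1 x2 ^^ n) = vstate \<Omega> (b ^^ n)"
proof -
  have "(s_free_sum \<xi>1 \<xi>2 T x1 x2 ^^ n) \<Omega> = (b ^^ n) \<Omega>"
  proof (induction n)
    case (Suc n)
    obtain xs where "snd ` set xs \<subseteq> K" "(b ^^ n) \<Omega> = lcomb T xs"
      using append_rel_b_funpow[of 0 n] unfolding append_rel_def by auto
    then show ?case using Suc s_free_sum_eq_b by simp
  qed simp
  then show ?thesis by (simp add: vstate_def)
qed

end


section \<open>Models on the separable Hilbert space\<close>

subsection \<open>The standard basis\<close>

lift_definition delta :: "nat \<Rightarrow> ell2" is "\<lambda>k n. if n = k then 1 else 0"
proof -
  fix k :: nat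
  have "(\<lambda>n. (cmod (if n = k then 1 else 0))\<^sup>2) = (\<lambda>n. if n = k then 1 else 0)"
    by auto
  then show "summable (\<lambda>n. (cmod (if n = k then 1 else 0))\<^sup>2)"
    by (simp add: summable_If_finite_set[of "{k}", simplified])
qed

lemma cinner_delta: "cinner x (delta k) = Rep_ell2 x k"
proof transfer
  fix f :: "nat \<Rightarrow> complex" and k
  have "(\<lambda>n. f n * cnj (if n = k then 1 else 0)) = (\<lambda>n. if n = k then f n else 0)" by auto
  then show "(\<Sum>n. f n * cnj (if n = k then 1 else 0)) = f k"
    using sums_single[of k f] by (simp add: sums_iff)
qed

lemma cinner_delta_delta: "cinner (delta j) (delta k) = (if j = k then 1 else 0)"
  by (simp add: cinner_delta delta.rep_eq)

lemma norm_delta: "norm (delta k) = 1"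
proof -
  have "complex_of_real ((norm (delta k))\<^sup>2) = complex_of_real 1"
    unfolding cinner_self[symmetric] by (simp add: cinner_delta_delta)
  then have "(norm (delta k))\<^sup>2 = 1" using of_real_eq_iff by blast
  then show ?thesis using norm_ge_zero[of "delta k"] by (simp add: power2_eq_1_iff)
qed

lemma norm_ell2_square: "(norm x)\<^sup>2 = (\<Sum>n. (cmod (Rep_ell2 x n))\<^sup>2)"
  by (simp add: norm_ell2.rep_eq suminf_nonneg ell2_summable)

lemma ell2_eqI: "(\<And>n. Rep_ell2 x n = Rep_ell2 y n) \<Longrightarrow> x = y"
  by (simp add: Rep_ell2_inject[symmetric] fun_eq_iff)

lemma Rep_ell2_sum: "Rep_ell2 (\<Sum>k\<in>A. f k) n = (\<Sum>k\<in>A. Rep_ell2 (f k) n)"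
  by (induction A rule: infinite_finite_induct) (simp_all add: zero_ell2.rep_eq plus_ell2.rep_eq)

lemma total_delta: "closure (cspan (range delta)) = UNIV"
proof -
  have "x \<in> closure (cspan (range delta))" for x
  proof -
    define s where "s N = (\<Sum>k<N. Rep_ell2 x k *\<^sub>C delta k)" for N
    have s: "s N \<in> cspan (range delta)" for N
      unfolding s_def by (intro complex_space.span_sum complex_space.span_scale complex_space.span_base) auto
    have Rs: "Rep_ell2 (s N) n = (if n < N then Rep_ell2 x n else 0)" for N n
    proof -
      have "Rep_ell2 (s N) n = (\<Sum>k<N. if n = k then Rep_ell2 x k else 0)"
        unfolding s_def Rep_ell2_sum
        by (intro sum.cong) (auto simp: scaleC_ell2.rep_eq delta.rep_eq)
      then show ?thesis by simp
    qed
    let ?g = "\<lambda>n. (cmod (Rep_ell2 x n))\<^sup>2"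
    have nrm: "(norm (x - s N))\<^sup>2 = (norm x)\<^sup>2 - (\<Sum>n<N. ?g n)" for N
    proof -
      have "(\<lambda>n. ?g n - (if n \<in> {..<N} then ?g n else 0)) sums ((norm x)\<^sup>2 - (\<Sum>n<N. ?g n))"
        unfolding norm_ell2_square by (intro sums_diff summable_sums ell2_summable sums_If_finite_set) simp
      moreover have "(\<lambda>n. ?g n - (if n \<in> {..<N} then ?g n else 0)) = (\<lambda>n. (cmod (Rep_ell2 (x - s N) n))\<^sup>2)"
        by (auto simp: minus_ell2.rep_eq Rs)
      ultimately show ?thesis by (simp add: norm_ell2_square[of "x - s N"] sums_iff)
    qed
    have "(\<lambda>N. (norm x)\<^sup>2 - (\<Sum>n<N. ?g n)) \<longlonglongrightarrow> (norm x)\<^sup>2 - (norm x)\<^sup>2"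
      unfolding norm_ell2_square by (intro tendsto_diff tendsto_const summable_LIMSEQ ell2_summable)
    then have "(\<lambda>N. sqrt ((norm (x - s N))\<^sup>2)) \<longlonglongrightarrow> sqrt 0"
      unfolding nrm by (intro tendsto_real_sqrt) simp
    then have "(\<lambda>N. norm (s N - x)) \<longlonglongrightarrow> 0" by (simp add: norm_minus_commute)
    then have "s \<longlonglongrightarrow> x" by (simp add: tendsto_norm_zero_iff LIM_zero_iff)
    then show ?thesis using s closure_sequential by blast
  qed
  then show ?thesis by blast
qed


subsection \<open>Transfer of a self-adjoint operator\<close>

function gram_schmidt :: "(nat \<Rightarrow> 'a::chilbert_space) \<Rightarrow> nat \<Rightarrow> 'a" where
  "gram_schmidt v n = (let g = v n - (\<Sum>k<n. cinner (v n) (gram_schmidt v k) *\<^sub>C gram_schmidt v k)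
     in inverse (norm g) *\<^sub>R g)"
  by pat_completeness auto
termination by (relation "inv_image less_than snd") auto

declare gram_schmidt.simps [simp del]

text \<open>A vector depending on its predecessors leads to \<open>e n = 0\<close>, since \<open>inverse 0 = 0\<close>.\<close>

lemma gram_schmidt_orth:
  fixes v :: "nat \<Rightarrow> 'a::chilbert_space"
  defines "e \<equiv> gram_schmidt v"
  shows "m \<noteq> n \<Longrightarrow> cinner (e m) (e n) = 0"
    and "e n = 0 \<or> cinner (e n) (e n) = 1"
    and "v n \<in> cspan (range e)"
proof -
  define g where "g n = v n - (\<Sum>k<n. cinner (v n) (e k) *\<^sub>C e k)" for n
  have e: "e n = inverse (norm (g n)) *\<^sub>R g n" for n
    unfolding e_def g_def by (subst gram_schmidt.simps) (simp add: Let_def)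
  show 1: "e n = 0 \<or> cinner (e n) (e n) = 1" for n
    by (cases "g n = 0") (simp_all add: e cinner.scaleR_left cinner.scaleR_right cinner_self
        scaleR_conv_of_real power2_eq_square)
  have lt: "m < n \<Longrightarrow> cinner (e n) (e m) = 0" for m n
  proof (induction n arbitrary: m rule: less_induct)
    case (less n)
    have "cinner (e k) (e m) = 0" if "k < n" "k \<noteq> m" for k
    proof (cases k m rule: linorder_cases)
      case less
      then have "cinner (e m) (e k) = 0" using less.IH[of m k] less.prems by simp
      then show ?thesis using less by (metis cinner_commute complex_cnj_zero nat_neq_iff)
    next
      case greater
      then show ?thesis using less.IH[of k m] that by simp
    qed (use that in simp)
    then have "(\<Sum>k<n. cinner (v n) (e k) * cinner (e k) (e m))
        = (\<Sum>k<n. if k = m then cinner (v n) (e k) * cinner (e m) (e m) else 0)"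
      by (intro sum.cong) auto
    then have "cinner (g n) (e m) = cinner (v n) (e m) - cinner (v n) (e m) * cinner (e m) (e m)"
      using less.prems by (simp add: g_def cinner.diff_left cinner.sum_left cinner_scaleC_left)
    also have "\<dots> = 0" using 1[of m] by auto
    finally show ?case by (simp add: e cinner.scaleR_left)
  qed
  show "m \<noteq> n \<Longrightarrow> cinner (e m) (e n) = 0" for m n
    using lt[of m n] lt[of n m] by (metis cinner_commute complex_cnj_zero nat_neq_iff)
  have "g n = norm (g n) *\<^sub>R e n" by (cases "g n = 0") (simp_all add: e)
  then have "v n = complex_of_real (norm (g n)) *\<^sub>C e n + (\<Sum>k<n. cinner (v n) (e k) *\<^sub>C e k)"
    by (simp add: g_def scaleR_eq_scaleC[symmetric])
  then show "v n \<in> cspan (range e)"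
    by (metis (no_types, lifting) complex_space.span_add complex_space.span_base complex_space.span_scale
        complex_space.span_sum rangeI)
qed

lemma Bessel:
  fixes e :: "nat \<Rightarrow> 'a::chilbert_space"
  assumes "\<And>m n. m \<noteq> n \<Longrightarrow> cinner (e m) (e n) = 0" "\<And>n. e n = 0 \<or> cinner (e n) (e n) = 1"
  shows "(\<Sum>n<N. (cmod (cinner h (e n)))\<^sup>2) \<le> (norm h)\<^sup>2"
proof -
  define s where "s = (\<Sum>n<N. cinner h (e n) *\<^sub>C e n)"
  have "cinner (h - s) (e j) = 0" if "j < N" for j
  proof -
    have "cinner s (e j) = (\<Sum>n<N. if n = j then cinner h (e n) * cinner (e j) (e j) else 0)"
      unfolding s_def cinner.sum_left cinner_scaleC_left using assms(1) by (intro sum.cong) auto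
    then have "cinner s (e j) = cinner h (e j) * cinner (e j) (e j)" using that by simp
    then show ?thesis using assms(2)[of j] by (auto simp: cinner.diff_left)
  qed
  then have orth: "cinner (h - s) s = 0"
    by (subst (2) s_def) (simp add: cinner.sum_right cinner_scaleC_right)
  have "complex_of_real ((norm s)\<^sup>2) = cinner h s"
    unfolding cinner_self[symmetric] using orth by (simp add: cinner.diff_left)
  also have "\<dots> = complex_of_real (\<Sum>n<N. (cmod (cinner h (e n)))\<^sup>2)"
    by (simp add: s_def cinner.sum_right cinner_scaleC_right complex_norm_square mult.commute del: of_real_power)
  finally have "(norm s)\<^sup>2 = (\<Sum>n<N. (cmod (cinner h (e n)))\<^sup>2)" using of_real_eq_iff by blast
  moreover have "(norm h)\<^sup>2 = (norm (h - s))\<^sup>2 + (norm s)\<^sup>2"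
    using Pythagoras[OF orth] by simp
  ultimately show ?thesis by simp
qed

lemma ell2_realization:
  fixes x :: "'a::chilbert_space \<Rightarrow> 'a"
  assumes sa: "selfadjoint x" and "norm \<xi> = 1"
  obtains x' where "selfadjoint x'" "\<And>n. vstate (delta 0) (x' ^^ n) = vstate \<xi> (x ^^ n)"
proof -
  define v where "v n = (x ^^ n) \<xi>" for n
  define e where "e = gram_schmidt v"
  have e: "\<And>m n. m \<noteq> n \<Longrightarrow> cinner (e m) (e n) = 0" "\<And>n. e n = 0 \<or> cinner (e n) (e n) = 1"
    and v: "\<And>n. v n \<in> cspan (range e)"
    using gram_schmidt_orth unfolding e_def by blast+
  have "e 0 = \<xi>"
    by (simp add: e_def gram_schmidt.simps[of v 0] v_def Let_def \<open>norm \<xi> = 1\<close>)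
  have bes: "(\<Sum>n<N. (cmod (cinner h (e n)))\<^sup>2) \<le> (norm h)\<^sup>2" for N h
    by (rule Bessel) (use e in auto)
  define U where "U h = Abs_ell2 (\<lambda>n. cinner h (e n))" for h
  have RU: "Rep_ell2 (U h) n = cinner h (e n)" for h n
  proof -
    have "summable (\<lambda>n. (cmod (cinner h (e n)))\<^sup>2)"
      by (rule summableI_nonneg_bounded[where x = "(norm h)\<^sup>2"]) (auto intro: bes)
    then show ?thesis by (simp add: U_def Abs_ell2_inverse)
  qed
  have U: "bounded_clinear U"
  proof (rule bounded_clinearI[where K = 1])
    show "U (g + h) = U g + U h" for g h
      by (rule ell2_eqI) (simp add: RU plus_ell2.rep_eq cinner_add_left)
    show "U (c *\<^sub>C h) = c *\<^sub>C U h" for c h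
      by (rule ell2_eqI) (simp add: RU scaleC_ell2.rep_eq cinner_scaleC_left)
    show "norm (U h) \<le> norm h * 1" for h
    proof -
      have "(norm (U h))\<^sup>2 \<le> (norm h)\<^sup>2"
        unfolding norm_ell2_square
        by (rule suminf_le_const[OF ell2_summable]) (simp add: RU bes)
      then show ?thesis by (simp add: power2_le_iff_abs_le)
    qed
  qed
  have Ue: "U (e n) = (if e n = 0 then 0 else delta n)" for n
    by (rule ell2_eqI) (use e in \<open>auto simp: RU zero_ell2.rep_eq delta.rep_eq\<close>)
  \<comment> \<open>Sending \<open>delta n\<close> to \<open>e n\<close> is isometric on the indices
    with nonzero \<open>e n\<close> and 0 on the rest; splitting into \<open>d\<close> and
    \<open>d'\<close> reduces the bound to Pythagoras.\<close>
  have contr: "norm (lcomb e xs) \<le> norm (lcomb delta xs)" for xs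
  proof -
    define d where "d n = (if e n = 0 then 0 else delta n)" for n
    define d' where "d' n = (if e n = 0 then delta n else 0)" for n
    have "cinner (lcomb d' xs) (lcomb d xs) = cinner (lcomb (\<lambda>_. 0 :: ell2) xs) (lcomb (\<lambda>_. 0) xs)"
      by (rule lcomb_cinner_cong) (auto simp: d_def d'_def cinner_delta_delta)
    also have "lcomb (\<lambda>_. 0 :: ell2) xs = 0" by (induction xs) auto
    finally have "(norm (lcomb d' xs + lcomb d xs))\<^sup>2 = (norm (lcomb d' xs))\<^sup>2 + (norm (lcomb d xs))\<^sup>2"
      by (intro Pythagoras) simp
    moreover have "lcomb d' xs + lcomb d xs = lcomb delta xs"
      by (induction xs) (auto simp: d_def d'_def algebra_simps)
    ultimately have "(norm (lcomb d xs))\<^sup>2 \<le> (norm (lcomb delta xs))\<^sup>2" by simp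
    moreover have "cinner (lcomb e xs) (lcomb e xs) = cinner (lcomb d xs) (lcomb d xs)"
      by (rule lcomb_cinner_cong) (use e in \<open>auto simp: d_def cinner_delta_delta\<close>)
    then have "complex_of_real ((norm (lcomb e xs))\<^sup>2) = complex_of_real ((norm (lcomb d xs))\<^sup>2)"
      by (simp only: cinner_self)
    then have "(norm (lcomb e xs))\<^sup>2 = (norm (lcomb d xs))\<^sup>2" using of_real_eq_iff by blast
    ultimately show ?thesis by (simp add: power2_le_iff_abs_le)
  qed
  have x: "bounded_clinear x" using sa by (rule selfadjoint_bounded_clinear)
  have Ux: "bounded_clinear (U \<circ> x)" using bounded_clinear_comp[OF U x] .
  then obtain C where C: "C > 0" "\<And>h. norm ((U \<circ> x) h) \<le> norm h * C"
    using bounded_linear.pos_bounded[OF bounded_clinear_bounded_linear[OF Ux]] by blast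
  have bound: "norm (lcomb (U \<circ> x \<circ> e) xs) \<le> C * norm (lcomb delta xs)" for xs
  proof -
    have "norm (lcomb (U \<circ> x \<circ> e) xs) = norm ((U \<circ> x) (lcomb e xs))"
      by (simp only: bounded_clinear_lcomb[OF Ux])
    also have "\<dots> \<le> C * norm (lcomb e xs)" using C(2)[of "lcomb e xs"] by (simp only: mult.commute)
    also have "\<dots> \<le> C * norm (lcomb delta xs)" using C(1) contr by (intro mult_left_mono) simp_all
    finally show ?thesis .
  qed
  obtain x' where x': "bounded_clinear x'" "\<And>n. n \<in> UNIV \<Longrightarrow> x' (delta n) = (U \<circ> x \<circ> e) n"
    by (rule bounded_clinear_extension[OF total_delta, of "U \<circ> x \<circ> e" C], rule bound) (rule that)
  have int: "x' (U u) = U (x u)" if "u \<in> cspan (range e)" for u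
    using that
  proof (induction rule: complex_space.span_induct_alt)
    case base
    then show ?case by (simp add: bounded_clinear_zero[OF U] bounded_clinear_zero[OF x'(1)] bounded_clinear_zero[OF x])
  next
    case (step c u w)
    then obtain n where "u = e n" by blast
    then have "x' (U u) = U (x u)"
      by (simp add: Ue x'(2) bounded_clinear_zero[OF U] bounded_clinear_zero[OF x'(1)] bounded_clinear_zero[OF x])
    then show ?case using step
      by (simp add: bounded_clinear_add[OF U] bounded_clinear_add[OF x'(1)] bounded_clinear_add[OF x]
          bounded_clinear_scaleC[OF U] bounded_clinear_scaleC[OF x'(1)] bounded_clinear_scaleC[OF x])
  qed
  show ?thesis
  proof
    show "selfadjoint x'"
    proof (rule selfadjointI_total[OF x'(1) total_delta])
      have "cinner (x' (delta m)) (delta n) = cinner (x (e m)) (e n)" for m n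
        by (simp add: cinner_delta x'(2) RU)
      then have "cinner (x' (delta m)) (delta n) = cinner (delta m) (x' (delta n))" for m n
        using selfadjoint_cinner[OF sa] by (metis cinner_commute)
      then show "cinner (x' u) w = cinner u (x' w)" if "u \<in> range delta" "w \<in> range delta" for u w
        using that by blast
    qed
    have d0: "delta 0 = U (v 0)"
    proof -
      have "e 0 \<noteq> 0" using \<open>e 0 = \<xi>\<close> \<open>norm \<xi> = 1\<close> by auto
      then show ?thesis using Ue[of 0] by (simp add: v_def \<open>e 0 = \<xi>\<close>)
    qed
    have "(x' ^^ n) (delta 0) = U (v n)" for n
    proof (induction n)
      case (Suc n)
      then show ?case using int[OF v[of n]] by (simp add: v_def)
    qed (simp add: d0)
    then show "vstate (delta 0) (x' ^^ n) = vstate \<xi> (x ^^ n)" for n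
      by (simp add: vstate_def cinner_delta RU \<open>e 0 = \<xi>\<close>) (simp add: v_def)
  qed
qed


subsection \<open>The free product of two copies of \<open>ell2\<close>\<close>

text \<open>
  The letter \<open>Inl k\<close> of an index word stands for the basis vector \<open>delta (Suc k)\<close> of the first
  space, which is orthogonal to \<open>delta 0\<close>.
\<close>

fun word_coeff :: "(ell2 + ell2) list \<Rightarrow> (nat + nat) list \<Rightarrow> complex" where
  "word_coeff [] [] = 1"
| "word_coeff (Inl h # w) (Inl k # i) = Rep_ell2 h (Suc k) * word_coeff w i"
| "word_coeff (Inr h # w) (Inr k # i) = Rep_ell2 h (Suc k) * word_coeff w i"
| "word_coeff _ _ = 0"

lemma word_coeff_nonzero: "word_coeff w i \<noteq> 0 \<Longrightarrow> map letter_index w = map letter_index i"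
  by (induction w i rule: word_coeff.induct) auto

lemma has_sum_product:
  fixes f :: "'i \<Rightarrow> complex" and g :: "'j \<Rightarrow> complex"
  assumes "(f has_sum a) A" "(g has_sum b) B"
  shows "((\<lambda>(i, j). f i * g j) has_sum (a * b)) (A \<times> B)"
proof (rule has_sum_SigmaI)
  show "((\<lambda>j. case (i, j) of (i, j) \<Rightarrow> f i * g j) has_sum f i * b) B" for i
    using has_sum_cmult_right[OF assms(2), of "f i"] by simp
  show "((\<lambda>i. f i * b) has_sum a * b) A"
    by (rule has_sum_cmult_left[OF assms(1)])
  have fa: "(\<lambda>i. norm (f i)) summable_on A" and ga: "(\<lambda>j. norm (g j)) summable_on B"
    using assms summable_on_iff_abs_summable_on_complex summable_on_def by blast+
  have "(\<lambda>p. norm (case p of (i, j) \<Rightarrow> f i * g j)) summable_on A \<times> B"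
    unfolding Infinite_Sum.abs_summable_on_Sigma_iff
  proof (intro conjI ballI)
    show "(\<lambda>y. norm (case (x, y) of (i, j) \<Rightarrow> f i * g j)) summable_on B" for x
      using ga by (simp add: norm_mult summable_on_cmult_right)
    have "(\<lambda>x. norm (\<Sum>\<^sub>\<infinity>y\<in>B. norm (case (x, y) of (i, j) \<Rightarrow> f i * g j)))
        = (\<lambda>x. norm (f x) * norm (\<Sum>\<^sub>\<infinity>y\<in>B. norm (g y)))"
      using ga by (simp add: norm_mult infsum_cmult_right abs_mult)
    then show "(\<lambda>x. norm (\<Sum>\<^sub>\<infinity>y\<in>B. norm (case (x, y) of (i, j) \<Rightarrow> f i * g j))) summable_on A"
      using summable_on_cmult_left[OF fa] by simp
  qed
  then show "(\<lambda>(i, j). f i * g j) summable_on A \<times> B"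
    using summable_on_iff_abs_summable_on_complex by blast
qed

text \<open>The coordinate at 0 drops out because \<open>h\<close> is orthogonal to
  \<open>delta 0\<close>; the shift matches index \<open>k\<close> with
  \<open>delta (Suc k)\<close>.\<close>

lemma has_sum_cinner_tail:
  assumes "cinner h (delta 0) = 0"
  shows "((\<lambda>k. Rep_ell2 g (Suc k) * cnj (Rep_ell2 h (Suc k))) has_sum cinner g h) UNIV"
proof (rule norm_summable_imp_has_sum)
  have s: "(\<lambda>k. Rep_ell2 g k * cnj (Rep_ell2 h k)) sums cinner g h"
    unfolding cinner_ell2.rep_eq by (intro summable_sums square_summable_prod ell2_summable)
  have "Rep_ell2 h 0 = 0" using assms by (simp add: cinner_delta)
  then show "(\<lambda>k. Rep_ell2 g (Suc k) * cnj (Rep_ell2 h (Suc k))) sums cinner g h"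
    using s sums_Suc_iff[of "\<lambda>k. Rep_ell2 g k * cnj (Rep_ell2 h k)" "cinner g h"] by simp
  have "summable (\<lambda>k. norm (Rep_ell2 g k * cnj (Rep_ell2 h k)))"
  proof (rule summable_comparison_test')
    show "summable (\<lambda>k. (cmod (Rep_ell2 g k))\<^sup>2 + (cmod (Rep_ell2 h k))\<^sup>2)"
      by (intro summable_add ell2_summable)
    show "norm (norm (Rep_ell2 g k * cnj (Rep_ell2 h k))) \<le> (cmod (Rep_ell2 g k))\<^sup>2 + (cmod (Rep_ell2 h k))\<^sup>2" for k
    proof -
      have "norm (norm (Rep_ell2 g k * cnj (Rep_ell2 h k))) = cmod (Rep_ell2 g k) * cmod (Rep_ell2 h k)"
        by (simp add: norm_mult)
      moreover have "0 \<le> cmod (Rep_ell2 g k) * cmod (Rep_ell2 h k)" by simp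
      ultimately show ?thesis
        using sum_squares_bound[of "cmod (Rep_ell2 g k)" "cmod (Rep_ell2 h k)"] by linarith
    qed
  qed
  then show "summable (\<lambda>k. norm (Rep_ell2 g (Suc k) * cnj (Rep_ell2 h (Suc k))))"
    by (subst summable_Suc_iff)
qed

lemma has_sum_Cons:
  fixes F :: "(nat + nat) list \<Rightarrow> complex" and \<iota> :: "nat \<Rightarrow> nat + nat"
  assumes "inj \<iota>" and "(f has_sum a) UNIV" "(G has_sum b) UNIV"
    and "\<And>k i. F (\<iota> k # i) = f k * G i" and "\<And>i. i \<notin> range (\<lambda>(k, i). \<iota> k # i) \<Longrightarrow> F i = 0"
  shows "(F has_sum a * b) UNIV"
proof -
  have inj: "inj (\<lambda>(k :: nat, i). \<iota> k # i)" using assms(1) by (auto simp: inj_def)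
  have "((\<lambda>(k, i). f k * G i) has_sum a * b) (UNIV \<times> UNIV)"
    by (rule has_sum_product[OF assms(2,3)])
  also have "(\<lambda>(k, i). f k * G i) = F \<circ> (\<lambda>(k, i). \<iota> k # i)"
    by (rule ext) (auto simp: assms(4))
  finally have "(F has_sum a * b) (range (\<lambda>(k, i). \<iota> k # i))"
    by (simp only: has_sum_reindex[OF inj] UNIV_Times_UNIV)
  then show ?thesis
    using has_sum_cong_neutral[of UNIV "range (\<lambda>(k, i). \<iota> k # i)" F F "a * b"] assms(5) by auto
qed

text \<open>Parseval for elementary tensors: coefficients are multiplicative along the word, so the
  sum factors letter by letter. Words with different patterns of spaces have no common
  index.\<close>

lemma has_sum_word_coeff:
  assumes "\<forall>u\<in>set w. case u of Inl h \<Rightarrow> cinner h (delta 0) = 0 | Inr h \<Rightarrow> cinner h (delta 0) = 0"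
  shows "((\<lambda>i. word_coeff v i * cnj (word_coeff w i)) has_sum word_cinner v w) UNIV"
proof (cases "map letter_index v = map letter_index w")
  case False
  then have "word_coeff v i * cnj (word_coeff w i) = 0" for i
    using word_coeff_nonzero[of v i] word_coeff_nonzero[of w i] by force
  moreover have "word_cinner v w = 0" using word_cinner_nonzero False by blast
  ultimately show ?thesis by (simp add: has_sum_0)
next
  case True
  then show ?thesis
    using assms
  proof (induction v w rule: word_cinner.induct)
    case 1
    have "((\<lambda>i. word_coeff [] i * cnj (word_coeff [] i)) has_sum 1) {[]}"
      using has_sum_finite[of "{[]}" "\<lambda>i. word_coeff [] i * cnj (word_coeff [] i)"] by simp
    moreover have "word_coeff [] i = 0" if "i \<noteq> []" for i using that by (cases i) auto
    ultimately show ?case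
      using has_sum_cong_neutral[of "{[]}" UNIV "\<lambda>i. word_coeff [] i * cnj (word_coeff [] i)"
          "\<lambda>i. word_coeff [] i * cnj (word_coeff [] i)"] by auto
  next
    case (2 g v h w)
    show ?case
      unfolding word_cinner.simps
    proof (rule has_sum_Cons[OF inj_Inl has_sum_cinner_tail])
      show "((\<lambda>i. word_coeff v i * cnj (word_coeff w i)) has_sum word_cinner v w) UNIV"
        using 2 by simp
      show "word_coeff (Inl g # v) i * cnj (word_coeff (Inl h # w) i) = 0"
        if "i \<notin> range (\<lambda>(k, i). Inl k # i)" for i
        using that by (cases i; cases "hd i") auto
    qed (use 2 in auto)
  next
    case (3 g v h w)
    show ?case
      unfolding word_cinner.simps
    proof (rule has_sum_Cons[OF inj_Inr has_sum_cinner_tail])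
      show "((\<lambda>i. word_coeff v i * cnj (word_coeff w i)) has_sum word_cinner v w) UNIV"
        using 3 by simp
      show "word_coeff (Inr g # v) i * cnj (word_coeff (Inr h # w) i) = 0"
        if "i \<notin> range (\<lambda>(k, i). Inr k # i)" for i
        using that by (cases i; cases "hd i") auto
    qed (use 3 in auto)
  qed simp_all
qed

definition index_words :: "(nat + nat) list set" where
  "index_words = {i. successively (\<lambda>u v. letter_index u \<noteq> letter_index v) i}"

lemma index_words_bij: "bij_betw (from_nat_into index_words) UNIV index_words"
proof (rule bij_betw_from_nat_into)
  have "inj (\<lambda>k :: nat. [Inl k :: nat + nat])" by (auto simp: inj_def)
  then have "infinite (range (\<lambda>k :: nat. [Inl k :: nat + nat]))" by (rule range_inj_infinite)
  moreover have "range (\<lambda>k :: nat. [Inl k :: nat + nat]) \<subseteq> index_words" by (auto simp: index_words_def)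
  ultimately show "infinite index_words" using finite_subset by blast
qed simp

text \<open>The coordinates of an elementary tensor in the orthonormal basis of alternating basis
  words. Words of all shapes share one numbering, which makes the whole direct sum a copy of
  \<open>ell2\<close>.\<close>

definition ell2_word :: "(ell2 + ell2) list \<Rightarrow> ell2" where
  "ell2_word w = Abs_ell2 (\<lambda>n. word_coeff w (from_nat_into index_words n))"

lemma word_coeff_outside:
  assumes "successively (\<lambda>u v. letter_index u \<noteq> letter_index v) w" "i \<notin> index_words"
  shows "word_coeff w i = 0"
proof (rule ccontr)
  assume "word_coeff w i \<noteq> 0"
  then have "map letter_index w = map letter_index i" by (rule word_coeff_nonzero)
  then have "successively (\<noteq>) (map letter_index i)"
    using assms(1) successively_map[of "(\<noteq>)" letter_index w] by simp
  then show False using assms(2) by (simp add: index_words_def successively_map)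
qed

lemma sums_word_coeff:
  assumes "v \<in> reduced_words (delta 0) (delta 0)" "w \<in> reduced_words (delta 0) (delta 0)"
  shows "(\<lambda>n. word_coeff v (from_nat_into index_words n) * cnj (word_coeff w (from_nat_into index_words n)))
      sums word_cinner v w"
proof (rule has_sum_imp_sums)
  have "((\<lambda>i. word_coeff v i * cnj (word_coeff w i)) has_sum word_cinner v w) UNIV"
    using assms by (intro has_sum_word_coeff) (auto simp: reduced_words_def)
  then have "((\<lambda>i. word_coeff v i * cnj (word_coeff w i)) has_sum word_cinner v w) index_words"
    using has_sum_cong_neutral[of index_words UNIV "\<lambda>i. word_coeff v i * cnj (word_coeff w i)"
        "\<lambda>i. word_coeff v i * cnj (word_coeff w i)" "word_cinner v w"] assms word_coeff_outside[of v]
    by (auto simp: reduced_words_def)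
  then show "((\<lambda>n. word_coeff v (from_nat_into index_words n) * cnj (word_coeff w (from_nat_into index_words n)))
      has_sum word_cinner v w) UNIV"
    using has_sum_reindex_bij_betw[OF index_words_bij, where f = "\<lambda>i. word_coeff v i * cnj (word_coeff w i)"]
    by blast
qed

lemma Rep_ell2_word:
  assumes "w \<in> reduced_words (delta 0) (delta 0)"
  shows "Rep_ell2 (ell2_word w) n = word_coeff w (from_nat_into index_words n)"
proof -
  have "summable (\<lambda>n. Re (word_coeff w (from_nat_into index_words n) * cnj (word_coeff w (from_nat_into index_words n))))"
    using sums_word_coeff[OF assms assms] sums_Re summable_def by blast
  then have "summable (\<lambda>n. (cmod (word_coeff w (from_nat_into index_words n)))\<^sup>2)"
    by (simp flip: complex_norm_square)
  then show ?thesis by (simp add: ell2_word_def Abs_ell2_inverse)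
qed

definition basis_word :: "(nat + nat) list \<Rightarrow> (ell2 + ell2) list" where
  "basis_word = map (map_sum (\<lambda>k. delta (Suc k)) (\<lambda>k. delta (Suc k)))"

lemma word_coeff_basis_word: "word_coeff (basis_word i) j = (if i = j then 1 else 0)"
proof (induction i arbitrary: j)
  case Nil
  then show ?case by (cases j) (auto simp: basis_word_def)
next
  case (Cons u i)
  then show ?case
    by (cases j; cases u; cases "hd j") (auto simp: basis_word_def delta.rep_eq)
qed

lemma basis_word_reduced:
  assumes "i \<in> index_words"
  shows "basis_word i \<in> reduced_words (delta 0) (delta 0)"
proof -
  have "letter_index (map_sum (\<lambda>k. delta (Suc k)) (\<lambda>k. delta (Suc k)) u) = letter_index u" for u :: "nat + nat"
    by (cases u) auto
  moreover have "case map_sum (\<lambda>k. delta (Suc k)) (\<lambda>k. delta (Suc k)) u of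
      Inl h \<Rightarrow> cinner h (delta 0) = 0 | Inr h \<Rightarrow> cinner h (delta 0) = 0" for u :: "nat + nat"
    by (cases u) (auto simp: cinner_delta_delta)
  ultimately show ?thesis
    using assms by (simp add: basis_word_def reduced_words_def index_words_def successively_map)
qed

theorem is_free_product_ell2_word: "is_free_product (delta 0) (delta 0) ell2_word"
  unfolding is_free_product_def
proof (intro conjI ballI norm_delta)
  let ?RW = "reduced_words (delta 0) (delta 0)"
  show "cinner (ell2_word v) (ell2_word w) = word_cinner v w" if "v \<in> ?RW" "w \<in> ?RW" for v w
    using sums_word_coeff[OF that] by (simp add: cinner_ell2.rep_eq Rep_ell2_word that sums_iff)
  \<comment> \<open>Totality: each \<open>delta n\<close> is the image of the basis word with number
    \<open>n\<close>.\<close>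
  have "range delta \<subseteq> ell2_word ` ?RW"
  proof clarify
    fix n
    let ?i = "from_nat_into index_words n"
    have bij: "?i \<in> index_words" "from_nat_into index_words m = ?i \<longleftrightarrow> m = n" for m
      using index_words_bij by (auto simp: bij_betw_def inj_on_eq_iff)
    have "delta n = ell2_word (basis_word ?i)"
      by (rule ell2_eqI)
        (simp add: Rep_ell2_word basis_word_reduced bij(1) word_coeff_basis_word delta.rep_eq bij(2) eq_commute[of ?i])
    then show "delta n \<in> ell2_word ` ?RW" using basis_word_reduced[OF bij(1)] by blast
  qed
  then show "closure (cspan (ell2_word ` ?RW)) = UNIV"
    using total_delta closure_mono[OF complex_space.span_mono] by blast
qed


section \<open>The decomposition of the free convolution\<close>

lemma monotone_conv_eqI:
  assumes "prob_space \<rho>" "sets \<rho> = sets borel"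
    and F: "\<And>z. z \<in> upper \<Longrightarrow> reciprocal_cauchy \<rho> z = reciprocal_cauchy \<mu> (reciprocal_cauchy \<nu> z)"
  shows "\<mu> \<rhd> \<nu> = \<rho>"
  unfolding monotone_conv_def
proof (rule the_equality)
  fix \<rho>' assume \<rho>': "prob_space \<rho>' \<and> sets \<rho>' = sets borel \<and>
    (\<forall>z. Im z > 0 \<longrightarrow> reciprocal_cauchy \<rho>' z = reciprocal_cauchy \<mu> (reciprocal_cauchy \<nu> z))"
  show "\<rho>' = \<rho>"
  proof (rule cauchy_transform_inject)
    fix z assume "z \<in> upper"
    then have "reciprocal_cauchy \<rho>' z = reciprocal_cauchy \<rho> z" using \<rho>' F by (simp add: upper_def)
    then show "cauchy_transform \<rho>' z = cauchy_transform \<rho> z" by (simp add: reciprocal_cauchy_def)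
  qed (use \<rho>' assms in auto)
qed (use assms in \<open>auto simp: upper_def\<close>)

lemma bounded_clinear_bound:
  assumes "bounded_clinear A"
  obtains K where "K > 0" "\<And>h. norm (A h) \<le> K * norm h"
  using bounded_linear.pos_bounded[OF bounded_clinear_bounded_linear[OF assms]] that
  by (metis mult.commute)

lemma norm_funpow_le:
  fixes A :: "'a::real_normed_vector \<Rightarrow> 'a"
  assumes "\<And>h. norm (A h) \<le> K * norm h" "K \<ge> 0"
  shows "norm ((A ^^ n) h) \<le> K ^ n * norm h"
proof (induction n)
  case (Suc n)
  have "norm (A ((A ^^ n) h)) \<le> K * norm ((A ^^ n) h)" by (rule assms)
  also have "\<dots> \<le> K * (K ^ n * norm h)" by (intro mult_left_mono Suc assms)
  finally show ?case by (simp add: mult.assoc)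
qed simp

theorem monotone_conv_distribution:
  fixes a b :: "'h::chilbert_space \<Rightarrow> 'h"
  assumes mon: "monotone_indep \<xi> a b" and a: "bounded_clinear a" and b: "bounded_clinear b" and unit: "norm \<xi> = 1"
    and \<mu>: "has_distribution \<xi> a \<mu>" and \<nu>: "has_distribution \<xi> b \<nu>"
    and \<rho>: "has_distribution \<xi> (\<lambda>h. a h + b h) \<rho>"
  shows "\<mu> \<rhd> \<nu> = \<rho>"
proof -
  define S where "S = (\<lambda>h. a h + b h)"
  have S: "bounded_clinear S" unfolding S_def by (rule bounded_clinear_plus[OF a b])
  obtain Ka Kb KS where K: "Ka > 0" "\<And>h. norm (a h) \<le> Ka * norm h" "Kb > 0" "\<And>h. norm (b h) \<le> Kb * norm h"
    "KS > 0" "\<And>h. norm (S h) \<le> KS * norm h"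
    using bounded_clinear_bound[OF a] bounded_clinear_bound[OF b] bounded_clinear_bound[OF S] by metis
  define L where "L = max Ka (max Kb KS)"
  have L: "L > 0" using K by (simp add: L_def)
  have le: "norm (a h) \<le> L * norm h" "norm (b h) \<le> L * norm h" "norm (S h) \<le> L * norm h" for h
  proof -
    have "Ka \<le> L" "Kb \<le> L" "KS \<le> L" by (simp_all add: L_def)
    then have "Ka * norm h \<le> L * norm h" "Kb * norm h \<le> L * norm h" "KS * norm h \<le> L * norm h"
      by (simp_all add: mult_right_mono)
    then show "norm (a h) \<le> L * norm h" "norm (b h) \<le> L * norm h" "norm (S h) \<le> L * norm h"
      using K(2)[of h] K(4)[of h] K(6)[of h] by linarith+
  qed
  define s where "s n m = vstate \<xi> ((a ^^ m) \<circ> (S ^^ n))" for n m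
  define \<alpha> where "\<alpha> m = vstate \<xi> (a ^^ m)" for m
  define \<beta> where "\<beta> n = vstate \<xi> (b ^^ n)" for n
  have rec: "s n m = \<beta> n * \<alpha> m + (\<Sum>j<n. \<beta> j * s (n - 1 - j) (Suc m))" for n m
    unfolding s_def \<alpha>_def \<beta>_def S_def by (rule monotone_moment_recursion[OF mon a b unit])
  have s_le: "cmod (s n m) \<le> L ^ m * L ^ n" for n m
  proof -
    have "cmod (s n m) \<le> norm ((a ^^ m) ((S ^^ n) \<xi>)) * norm \<xi>"
      unfolding s_def vstate_def comp_apply by (rule cinner_Cauchy_Schwarz)
    also have "\<dots> \<le> L ^ m * norm ((S ^^ n) \<xi>)"
      using norm_funpow_le[of a L m "(S ^^ n) \<xi>"] le L by (simp add: unit)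
    also have "\<dots> \<le> L ^ m * (L ^ n * norm \<xi>)"
      using L le by (intro mult_left_mono norm_funpow_le) auto
    finally show ?thesis by (simp add: unit)
  qed
  have \<beta>_le: "cmod (\<beta> n) \<le> L ^ n" for n
  proof -
    have "cmod (\<beta> n) \<le> norm ((b ^^ n) \<xi>) * norm \<xi>"
      unfolding \<beta>_def vstate_def by (rule cinner_Cauchy_Schwarz)
    also have "\<dots> \<le> L ^ n" using norm_funpow_le[of b L n \<xi>] le L by (simp add: unit)
    finally show ?thesis .
  qed
  have cs: "compactly_supported_prob \<mu>" "compactly_supported_prob \<nu>" "compactly_supported_prob \<rho>"
    and mom: "\<And>n. complex_of_real (\<integral>x. x ^ n \<partial>\<mu>) = \<alpha> n" "\<And>n. complex_of_real (\<integral>x. x ^ n \<partial>\<nu>) = \<beta> n"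
      "\<And>n. complex_of_real (\<integral>x. x ^ n \<partial>\<rho>) = s n 0"
    using \<mu> \<nu> \<rho> unfolding has_distribution_def \<alpha>_def \<beta>_def s_def S_def by auto
  note D\<mu> = compactly_supportedD[OF cs(1)] and D\<nu> = compactly_supportedD[OF cs(2)] and D\<rho> = compactly_supportedD[OF cs(3)]
  obtain R1 where R1: "R1 > 0" "AE x in \<mu>. \<bar>x\<bar> \<le> R1" using compactly_supported_bound[OF cs(1)] by blast
  obtain R2 where R2: "R2 > 0" "AE x in \<nu>. \<bar>x\<bar> \<le> R2" using compactly_supported_bound[OF cs(2)] by blast
  obtain R3 where R3: "R3 > 0" "AE x in \<rho>. \<bar>x\<bar> \<le> R3" using compactly_supported_bound[OF cs(3)] by blast
  \<comment> \<open>Beyond 4 L the series in t = 1 / z satisfy the bound 1/4, beyond R1 + R2 the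
    point F_\<nu>(z) has modulus above R1, and beyond R3 the moment series of \<rho>
    converges.\<close>
  define R where "R = 4 * L + R1 + R2 + R3"
  have large: "reciprocal_cauchy \<rho> z = reciprocal_cauchy \<mu> (reciprocal_cauchy \<nu> z)" if z: "Im z > R" for z
  proof -
    have zR: "cmod z > R" using abs_Im_le_cmod[of z] z by linarith
    then have big: "cmod z > 4 * L" "cmod z > R1 + R2" "cmod z > R2" "cmod z > R3" and z0: "cmod z > 0"
      using R1(1) R2(1) R3(1) L unfolding R_def by linarith+
    have zu: "z \<in> upper" using z R1(1) R2(1) R3(1) L by (simp add: upper_def R_def)
    define t where "t = 1 / z"
    define B where "B = (\<Sum>n. \<beta> n * t ^ n)"
    have t: "cmod t * L \<le> 1 / 4" using big(1) z0 by (simp add: t_def norm_divide field_simps)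
    have gen: "(\<lambda>m. \<alpha> m * t ^ m * B ^ Suc m) sums (\<Sum>n. s n 0 * t ^ n)"
      unfolding B_def by (rule monotone_recursion_generating_function[OF rec s_le \<beta>_le L t])
    have pow: "c / z ^ Suc n = t * (c * t ^ n)" for c n by (simp add: t_def power_divide)
    have "t \<noteq> 0" using z0 by (auto simp: t_def)
    have series: "cauchy_transform M z = t * (\<Sum>n. c n * t ^ n)"
      if "(\<lambda>n. c n / z ^ Suc n) sums cauchy_transform M z" for c M
    proof -
      have "(\<lambda>n. t * (c n * t ^ n)) sums cauchy_transform M z" using that by (simp only: pow)
      then have "(\<lambda>n. c n * t ^ n) sums (cauchy_transform M z / t)"
        using sums_mult[of _ _ "1 / t"] \<open>t \<noteq> 0\<close> by fastforce
      then show ?thesis using \<open>t \<noteq> 0\<close> by (simp add: sums_iff)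
    qed
    have G\<nu>: "cauchy_transform \<nu> z = t * B"
      unfolding B_def using cauchy_transform_series[OF D\<nu> R2(2) big(3)] R2(1) by (intro series) (simp add: mom)
    have G\<rho>: "cauchy_transform \<rho> z = t * (\<Sum>n. s n 0 * t ^ n)"
      using cauchy_transform_series[OF D\<rho> R3(2) big(4)] R3(1) by (intro series) (simp add: mom)
    define w where "w = reciprocal_cauchy \<nu> z"
    have w: "w = 1 / (t * B)" by (simp add: w_def reciprocal_cauchy_def G\<nu>)
    have "cmod (t * B) \<le> 1 / (cmod z - R2)"
      using norm_cauchy_transform_le[OF D\<nu> R2(2) zu big(3)] by (simp add: G\<nu>)
    moreover have "t * B \<noteq> 0" using cauchy_transform_nonzero[OF D\<nu> zu] by (simp add: G\<nu>)
    ultimately have "cmod z - R2 \<le> cmod w"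
      using big(3) by (simp add: w norm_divide field_simps)
    then have "cmod w > R1" using big(2) by simp
    then have "(\<lambda>m. \<alpha> m / w ^ Suc m) sums cauchy_transform \<mu> w"
      using cauchy_transform_series[OF D\<mu> R1(2), of w] R1(1) by (simp add: mom)
    \<comment> \<open>1 / w = t B turns the moment series of G_\<mu> at \<open>w\<close> into
      \<open>t\<close> times the series \<open>gen\<close>.\<close>
    moreover have "(\<lambda>m. \<alpha> m / w ^ Suc m) = (\<lambda>m. t * (\<alpha> m * t ^ m * B ^ Suc m))"
      by (rule ext) (simp add: w power_divide power_mult_distrib mult_ac)
    moreover have "(\<lambda>m. t * (\<alpha> m * t ^ m * B ^ Suc m)) sums (t * (\<Sum>n. s n 0 * t ^ n))"
      by (rule sums_mult[OF gen])
    ultimately have "cauchy_transform \<mu> w = cauchy_transform \<rho> z"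
      using sums_unique2 unfolding G\<rho> by metis
    then show ?thesis by (simp add: reciprocal_cauchy_def w_def[unfolded reciprocal_cauchy_def, symmetric])
  qed
  show ?thesis
  proof (rule monotone_conv_eqI[OF D\<rho>])
    fix z assume "z \<in> upper"
    then show "reciprocal_cauchy \<rho> z = reciprocal_cauchy \<mu> (reciprocal_cauchy \<nu> z)"
    proof (rule upper_continuation[OF holomorphic_reciprocal_cauchy[OF D\<rho>] _ large, rotated -1])
      have "(reciprocal_cauchy \<mu> \<circ> reciprocal_cauchy \<nu>) holomorphic_on upper"
        by (rule holomorphic_on_compose_gen[OF holomorphic_reciprocal_cauchy[OF D\<nu>] holomorphic_reciprocal_cauchy[OF D\<mu>]])
          (use reciprocal_cauchy_upper[OF D\<nu>] in blast)
      then show "(\<lambda>z. reciprocal_cauchy \<mu> (reciprocal_cauchy \<nu> z)) holomorphic_on upper" by (simp add: o_def)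
      show "R \<ge> 0" using R1(1) R2(1) R3(1) L by (simp add: R_def)
    qed
  qed
qed

section \<open>Well-definedness of the free and s-free convolutions\<close>

lemma has_distribution_cong:
  assumes "has_distribution \<xi> A \<mu>" "\<And>n. vstate \<xi> (A ^^ n) = vstate \<eta> (B ^^ n)"
  shows "has_distribution \<eta> B \<mu>"
  using assms by (simp add: has_distribution_def)

lemma selfadjoint_plus: "selfadjoint A \<Longrightarrow> selfadjoint B \<Longrightarrow> selfadjoint (\<lambda>h. A h + B h)"
  by (simp add: selfadjoint_def bounded_clinear_plus cinner_add_left cinner_add_right)

text \<open>The two variables are transferred separately; only their moments have to survive, since
  freeness is built into the free product on \<open>ell2\<close>.\<close>

lemma ell2_pair:
  fixes x1 :: "'a::chilbert_space \<Rightarrow> 'a" and x2 :: "'b::chilbert_space \<Rightarrow> 'b"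
  assumes "selfadjoint x1" "selfadjoint x2" "norm \<xi>1 = 1" "norm \<xi>2 = 1"
    and "has_distribution \<xi>1 x1 \<mu>" "has_distribution \<xi>2 x2 \<nu>"
  obtains y1 y2 where "free_product_pair (delta 0) (delta 0) ell2_word y1 y2"
    "has_distribution (delta 0) y1 \<mu>" "has_distribution (delta 0) y2 \<nu>"
proof -
  obtain y1 where y1: "selfadjoint y1" "\<And>n. vstate (delta 0) (y1 ^^ n) = vstate \<xi>1 (x1 ^^ n)"
    using ell2_realization[OF assms(1,3)] by blast
  obtain y2 where y2: "selfadjoint y2" "\<And>n. vstate (delta 0) (y2 ^^ n) = vstate \<xi>2 (x2 ^^ n)"
    using ell2_realization[OF assms(2,4)] by blast
  have "free_product_pair (delta 0) (delta 0) ell2_word y1 y2"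
    by (intro free_product_pair.intro free_product.intro is_free_product_ell2_word
        free_product_pair_axioms.intro y1 y2)
  then show ?thesis
    using that has_distribution_cong[OF assms(5)] has_distribution_cong[OF assms(6)] y1(2) y2(2) by metis
qed

lemma free_sum_distribution_cong:
  fixes A B :: "'a::chilbert_space \<Rightarrow> 'a" and A' B' :: "'b::chilbert_space \<Rightarrow> 'b"
  assumes "free_indep \<xi> A B" "selfadjoint A" "selfadjoint B" "norm \<xi> = 1"
    "has_distribution \<xi> A \<mu>" "has_distribution \<xi> B \<nu>"
    and "free_indep \<xi>' A' B'" "selfadjoint A'" "selfadjoint B'" "norm \<xi>' = 1"
    "has_distribution \<xi>' A' \<mu>" "has_distribution \<xi>' B' \<nu>"
  shows "vstate \<xi> ((\<lambda>h. A h + B h) ^^ n) = vstate \<xi>' ((\<lambda>h. A' h + B' h) ^^ n)"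
  by (rule free_sum_moments_unique[of _ _ _ _ _ _ "\<lambda>n. \<integral>x. x ^ n \<partial>\<mu>" "\<lambda>n. \<integral>x. x ^ n \<partial>\<nu>"])
    (use assms in \<open>simp_all add: selfadjoint_bounded_clinear has_distribution_def\<close>)

text \<open>For existence, the given pair is replaced by a free pair on \<open>ell2\<close> with the
  same laws. For uniqueness, the moments of the sum are the same for all such pairs, and they
  determine a compactly supported measure.\<close>

lemma free_conv_eqI:
  fixes A B :: "'h::chilbert_space \<Rightarrow> 'h"
  assumes free: "free_indep \<xi> A B" "selfadjoint A" "selfadjoint B" "norm \<xi> = 1"
    "has_distribution \<xi> A \<mu>" "has_distribution \<xi> B \<nu>"
    and \<rho>: "has_distribution \<xi> (\<lambda>h. A h + B h) \<rho>"
  shows "\<mu> \<boxplus> \<nu> = \<rho>"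
  unfolding free_conv_def
proof (rule the_equality)
  obtain y1 y2 where y: "free_product_pair (delta 0) (delta 0) ell2_word y1 y2"
    "has_distribution (delta 0) y1 \<mu>" "has_distribution (delta 0) y2 \<nu>"
    using ell2_pair[OF free(2,3,4,4,5,6)] by blast
  interpret Y: free_product_pair "delta 0" "delta 0" ell2_word y1 y2 by (rule y)
  have 1: "free_indep Y.\<Omega> Y.X1 Y.X2" "selfadjoint Y.X1" "selfadjoint Y.X2" "norm Y.\<Omega> = 1"
    "has_distribution Y.\<Omega> Y.X1 \<mu>" "has_distribution Y.\<Omega> Y.X2 \<nu>"
    using Y.free_indep_lambda[OF Y.selfadjoint] Y.selfadjoint_lambda1[OF Y.selfadjoint(1)]
      Y.selfadjoint_lambda2[OF Y.selfadjoint(2)] Y.vacuum(2)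
      has_distribution_cong[OF y(2) Y.vstate_lambda1_funpow[OF Y.selfadjoint(1), symmetric]]
      has_distribution_cong[OF y(3) Y.vstate_lambda2_funpow[OF Y.selfadjoint(2), symmetric]] by blast+
  moreover have "has_distribution Y.\<Omega> (\<lambda>h. Y.X1 h + Y.X2 h) \<rho>"
    by (rule has_distribution_cong[OF \<rho> free_sum_distribution_cong[OF free 1]])
  ultimately show "\<exists>(\<xi> :: ell2) A B. norm \<xi> = 1 \<and> selfadjoint A \<and> selfadjoint B \<and>
     free_indep \<xi> A B \<and> has_distribution \<xi> A \<mu> \<and> has_distribution \<xi> B \<nu> \<and>
     has_distribution \<xi> (\<lambda>h. A h + B h) \<rho>" by blast
  fix \<rho>' assume "\<exists>(\<xi> :: ell2) A B. norm \<xi> = 1 \<and> selfadjoint A \<and> selfadjoint B \<and>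
     free_indep \<xi> A B \<and> has_distribution \<xi> A \<mu> \<and> has_distribution \<xi> B \<nu> \<and>
     has_distribution \<xi> (\<lambda>h. A h + B h) \<rho>'"
  then obtain \<xi>' :: ell2 and A' B' where 2: "free_indep \<xi>' A' B'" "selfadjoint A'" "selfadjoint B'" "norm \<xi>' = 1"
    "has_distribution \<xi>' A' \<mu>" "has_distribution \<xi>' B' \<nu>" and \<rho>': "has_distribution \<xi>' (\<lambda>h. A' h + B' h) \<rho>'"
    by blast
  show "\<rho>' = \<rho>"
    by (rule has_distribution_unique[OF \<rho>' \<rho> free_sum_distribution_cong[OF 2 free]])
qed

context free_product_pair
begin

lemma a_plus_b: "(\<lambda>h. a h + b h) = (\<lambda>h. X1 h + X2 h)"
  by (simp add: b_def)

lemma norm_units: "norm \<xi>1 = 1" "norm \<xi>2 = 1"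
  using free_product by (simp_all add: is_free_product_def)

lemma free_sum:
  assumes "has_distribution \<xi>1 x1 \<mu>" "has_distribution \<xi>2 x2 \<nu>"
  shows "free_indep \<Omega> X1 X2" "selfadjoint X1" "selfadjoint X2" "norm \<Omega> = 1"
    "has_distribution \<Omega> X1 \<mu>" "has_distribution \<Omega> X2 \<nu>"
  using free_indep_lambda[OF selfadjoint] selfadjoint_lambda1[OF selfadjoint(1)]
    selfadjoint_lambda2[OF selfadjoint(2)] vacuum(2)
    has_distribution_cong[OF assms(1) vstate_lambda1_funpow[OF selfadjoint(1), symmetric]]
    has_distribution_cong[OF assms(2) vstate_lambda2_funpow[OF selfadjoint(2), symmetric]] by blast+

lemma has_distribution_a: "has_distribution \<xi>2 x2 \<nu> \<Longrightarrow> has_distribution \<Omega> a \<nu>"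
  by (rule has_distribution_cong[OF _ vstate_a_funpow[symmetric]])

end

text \<open>
  The moments of the sum and those of \<open>a\<close> determine those of \<open>b\<close>, by monotone independence; hence
  the s-free convolution is well defined.
\<close>

lemma vstate_b_funpow_unique:
  assumes P: "free_product_pair \<xi>1 \<xi>2 T x1 x2" and Q: "free_product_pair \<eta>1 \<eta>2 U y1 y2"
    and x: "has_distribution \<xi>1 x1 \<mu>" "has_distribution \<xi>2 x2 \<nu>"
    and y: "has_distribution \<eta>1 y1 \<mu>" "has_distribution \<eta>2 y2 \<nu>"
  shows "vstate (T []) (free_product_pair.b \<xi>1 \<xi>2 T x1 x2 ^^ n) = vstate (U []) (free_product_pair.b \<eta>1 \<eta>2 U y1 y2 ^^ n)"
proof -
  interpret P: free_product_pair \<xi>1 \<xi>2 T x1 x2 by (rule P)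
  interpret Q: free_product_pair \<eta>1 \<eta>2 U y1 y2 by (rule Q)
  have a: "vstate P.\<Omega> (P.a ^^ m) = vstate Q.\<Omega> (Q.a ^^ m)" for m
    using P.has_distribution_a[OF x(2)] Q.has_distribution_a[OF y(2)] by (simp add: has_distribution_def)
  have "vstate P.\<Omega> ((\<lambda>h. P.a h + P.b h) ^^ k) = vstate Q.\<Omega> ((\<lambda>h. Q.a h + Q.b h) ^^ k)" for k
    unfolding P.a_plus_b Q.a_plus_b by (rule free_sum_distribution_cong[OF P.free_sum[OF x] Q.free_sum[OF y]])
  then have "vstate P.\<Omega> (P.a ^^ 0 \<circ> (\<lambda>h. P.a h + P.b h) ^^ k) = vstate Q.\<Omega> (Q.a ^^ 0 \<circ> (\<lambda>h. Q.a h + Q.b h) ^^ k)" for k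
    by simp
  moreover have "vstate P.\<Omega> (P.a ^^ 0) = 1" using P.vacuum(1) by (simp add: vstate_def)
  ultimately show ?thesis
    by (intro monotone_recursion_unique[where \<alpha> = "\<lambda>m. vstate P.\<Omega> (P.a ^^ m)"
          and s = "\<lambda>n m. vstate P.\<Omega> (P.a ^^ m \<circ> (\<lambda>h. P.a h + P.b h) ^^ n)"
          and s' = "\<lambda>n m. vstate Q.\<Omega> (Q.a ^^ m \<circ> (\<lambda>h. Q.a h + Q.b h) ^^ n)"
          and \<beta> = "\<lambda>n. vstate P.\<Omega> (P.b ^^ n)" and \<beta>' = "\<lambda>n. vstate Q.\<Omega> (Q.b ^^ n)"]
        monotone_moment_recursion[OF P.monotone_indep_ab P.a_bounded_clinear P.b_bounded_clinear P.vacuum(2)]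
        monotone_moment_recursion[OF Q.monotone_indep_ab Q.a_bounded_clinear Q.b_bounded_clinear Q.vacuum(2), folded a])
qed

context free_product_pair
begin

text \<open>Both halves rest on \<open>vstate_b_funpow_unique\<close>: once to move \<rho> to a
  model on \<open>ell2\<close>, once to compare an arbitrary model with the present one.\<close>

lemma s_free_conv_eqI:
  assumes x: "has_distribution \<xi>1 x1 \<mu>" "has_distribution \<xi>2 x2 \<nu>" and \<rho>: "has_distribution \<Omega> b \<rho>"
  shows "\<mu> \<boxplus>\<^sub>s \<nu> = \<rho>"
  unfolding s_free_conv_def
proof (rule the_equality)
  obtain y1 y2 where y: "free_product_pair (delta 0) (delta 0) ell2_word y1 y2"
    "has_distribution (delta 0) y1 \<mu>" "has_distribution (delta 0) y2 \<nu>"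
    using ell2_pair[OF selfadjoint norm_units x] by blast
  interpret Y: free_product_pair "delta 0" "delta 0" ell2_word y1 y2 by (rule y)
  have "has_distribution Y.\<Omega> (s_free_sum (delta 0) (delta 0) ell2_word y1 y2) \<rho>"
    using has_distribution_cong[OF \<rho>] vstate_b_funpow_unique[OF free_product_pair_axioms y(1) x y(2,3)]
      Y.vstate_s_free_sum by metis
  then show "\<exists>(\<xi>1 :: ell2) (\<xi>2 :: ell2) (T :: (ell2 + ell2) list \<Rightarrow> ell2) x1 x2.
     is_free_product \<xi>1 \<xi>2 T \<and> selfadjoint x1 \<and> selfadjoint x2 \<and>
     has_distribution \<xi>1 x1 \<mu> \<and> has_distribution \<xi>2 x2 \<nu> \<and>
     has_distribution (T []) (s_free_sum \<xi>1 \<xi>2 T x1 x2) \<rho>"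
    using y(2,3) Y.free_product Y.selfadjoint by blast
  fix \<rho>' assume "\<exists>(\<xi>1 :: ell2) (\<xi>2 :: ell2) (T :: (ell2 + ell2) list \<Rightarrow> ell2) x1 x2.
     is_free_product \<xi>1 \<xi>2 T \<and> selfadjoint x1 \<and> selfadjoint x2 \<and>
     has_distribution \<xi>1 x1 \<mu> \<and> has_distribution \<xi>2 x2 \<nu> \<and>
     has_distribution (T []) (s_free_sum \<xi>1 \<xi>2 T x1 x2) \<rho>'"
  then obtain \<eta>1 \<eta>2 :: ell2 and U :: "(ell2 + ell2) list \<Rightarrow> ell2" and z1 z2
    where z: "is_free_product \<eta>1 \<eta>2 U" "selfadjoint z1" "selfadjoint z2" "has_distribution \<eta>1 z1 \<mu>"
      "has_distribution \<eta>2 z2 \<nu>" and \<rho>': "has_distribution (U []) (s_free_sum \<eta>1 \<eta>2 U z1 z2) \<rho>'"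
    by blast
  interpret W: free_product_pair \<eta>1 \<eta>2 U z1 z2
    by (intro free_product_pair.intro free_product.intro free_product_pair_axioms.intro z)
  have "vstate W.\<Omega> (s_free_sum \<eta>1 \<eta>2 U z1 z2 ^^ n) = vstate \<Omega> (b ^^ n)" for n
    using W.vstate_s_free_sum[of n]
      vstate_b_funpow_unique[OF free_product_pair_axioms W.free_product_pair_axioms x z(4,5), of n] by simp
  then show "\<rho>' = \<rho>" by (rule has_distribution_unique[OF \<rho>' \<rho>])
qed

text \<open>The case j = 2: \<open>a\<close> is taken from the second space and has law \<nu>, which
  therefore stands on the left of \<rhd>.\<close>

theorem decomposition:
  assumes x: "has_distribution \<xi>1 x1 \<mu>" "has_distribution \<xi>2 x2 \<nu>"
  shows "has_distribution \<Omega> (\<lambda>h. X1 h + X2 h) (\<mu> \<boxplus> \<nu>)"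
    and "has_distribution \<Omega> b (\<mu> \<boxplus>\<^sub>s \<nu>)"
    and "\<mu> \<boxplus> \<nu> = \<nu> \<rhd> (\<mu> \<boxplus>\<^sub>s \<nu>)"
proof -
  note free = free_sum[OF x]
  obtain \<rho> where \<rho>: "has_distribution \<Omega> (\<lambda>h. X1 h + X2 h) \<rho>"
    using selfadjoint_has_distribution[OF selfadjoint_plus[OF free(2,3)] free(4)] by blast
  have 1: "\<mu> \<boxplus> \<nu> = \<rho>" by (rule free_conv_eqI[OF free \<rho>])
  obtain \<sigma> where \<sigma>: "has_distribution \<Omega> b \<sigma>"
    using selfadjoint_has_distribution[OF b_selfadjoint free(4)] by blast
  have 2: "\<mu> \<boxplus>\<^sub>s \<nu> = \<sigma>" by (rule s_free_conv_eqI[OF x \<sigma>])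
  have "\<nu> \<rhd> \<sigma> = \<rho>"
    by (rule monotone_conv_distribution[OF monotone_indep_ab a_bounded_clinear b_bounded_clinear free(4)
          has_distribution_a[OF x(2)] \<sigma>]) (simp add: a_plus_b \<rho>)
  then show "has_distribution \<Omega> (\<lambda>h. X1 h + X2 h) (\<mu> \<boxplus> \<nu>)"
    and "has_distribution \<Omega> b (\<mu> \<boxplus>\<^sub>s \<nu>)" and "\<mu> \<boxplus> \<nu> = \<nu> \<rhd> (\<mu> \<boxplus>\<^sub>s \<nu>)"
    using \<rho> \<sigma> by (simp_all add: 1 2)
qed

end

theorem lemma9p2:
  fixes \<xi>1 :: "'a::chilbert_space" and \<xi>2 :: "'b::chilbert_space"
    and T :: "('a + 'b) list \<Rightarrow> 'h::chilbert_space"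
    and x1 :: "'a \<Rightarrow> 'a" and x2 :: "'b \<Rightarrow> 'b"
    and X1 X2 Z1 Z2 :: "'h \<Rightarrow> 'h"
    and \<mu> \<nu> :: "real measure"
  assumes "compactly_supported_prob \<mu>" and "compactly_supported_prob \<nu>"
    and "is_free_product \<xi>1 \<xi>2 T"
    and "selfadjoint x1" and "selfadjoint x2"
    and "has_distribution \<xi>1 x1 \<mu>" and "has_distribution \<xi>2 x2 \<nu>"
    and "X1 = lambda1 \<xi>1 \<xi>2 T x1" and "X2 = lambda2 \<xi>1 \<xi>2 T x2"
    and "\<And>h. X1 h + X2 h = compress \<xi>1 \<xi>2 T 1 X1 1 h + Z1 h"
    and "\<And>h. X1 h + X2 h = compress \<xi>1 \<xi>2 T 2 X2 1 h + Z2 h"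
  shows "monotone_indep (T []) (compress \<xi>1 \<xi>2 T 1 X1 1) Z1 \<and>
         monotone_indep (T []) (compress \<xi>1 \<xi>2 T 2 X2 1) Z2 \<and>
         has_distribution (T []) (\<lambda>h. X1 h + X2 h) (\<mu> \<boxplus> \<nu>) \<and>
         has_distribution (T []) (compress \<xi>1 \<xi>2 T 1 X1 1) \<mu> \<and>
         has_distribution (T []) Z1 (\<nu> \<boxplus>\<^sub>s \<mu>) \<and>
         has_distribution (T []) (compress \<xi>1 \<xi>2 T 2 X2 1) \<nu> \<and>
         has_distribution (T []) Z2 (\<mu> \<boxplus>\<^sub>s \<nu>) \<and>
         \<mu> \<boxplus> \<nu> = \<mu> \<rhd> (\<nu> \<boxplus>\<^sub>s \<mu>) \<and>
         \<nu> \<boxplus> \<mu> = \<nu> \<rhd> (\<mu> \<boxplus>\<^sub>s \<nu>)"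
proof -
  interpret P: free_product_pair \<xi>1 \<xi>2 T x1 x2
    by (intro free_product_pair.intro free_product.intro free_product_pair_axioms.intro assms)
  \<comment> \<open>The case j = 1 is the case j = 2 with the spaces exchanged: \<open>Q.a\<close>
    is X_1(1) and \<open>Q.b\<close> is Z_1.\<close>
  interpret Q: free_product_pair \<xi>2 \<xi>1 "\<lambda>w. T (map flip w)" x2 x1
    by (rule P.swap_pair)
  have X1: "X1 = P.X1" and X2: "X2 = P.X2" using assms by blast+
  have QX: "Q.X1 = X2" "Q.X2 = X1" by (simp_all add: lambda_flip X1 X2)
  have Pa: "P.a = compress \<xi>1 \<xi>2 T 2 X2 1" by (simp add: P.a_def X2)
  have Qa: "Q.a = compress \<xi>1 \<xi>2 T 1 X1 1" by (simp add: Q.a_def QX compress_flip One_nat_def)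
  have Pb: "P.b = Z2"
    using assms(11) by (simp add: fun_eq_iff P.b_def Pa flip: X1 X2)
  have Qb: "Q.b = Z1"
    using assms(10) by (simp add: fun_eq_iff Q.b_def Qa QX add.commute)
  note Pd = P.decomposition[OF assms(6,7)] and Qd = Q.decomposition[OF assms(7,6)]
  \<comment> \<open>Both orders give the law of the same operator X_1 + X_2, so \<boxplus> commutes
    on these measures.\<close>
  have "has_distribution (T []) (\<lambda>h. X1 h + X2 h) (\<nu> \<boxplus> \<mu>)"
    using Qd(1) by (simp add: QX add.commute)
  moreover have "has_distribution (T []) (\<lambda>h. X1 h + X2 h) (\<mu> \<boxplus> \<nu>)"
    using Pd(1) by (simp add: X1 X2)
  ultimately have comm: "\<mu> \<boxplus> \<nu> = \<nu> \<boxplus> \<mu>"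
    using has_distribution_unique by blast
  show ?thesis
    using P.monotone_indep_ab Q.monotone_indep_ab Pd Qd comm
      P.has_distribution_a[OF assms(7)] Q.has_distribution_a[OF assms(6)]
    by (simp add: Pa Qa Pb Qb X1[symmetric] X2[symmetric])
qed

end
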